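(* Let $\mathcal{Z}\subset\mathrm{Sym}(p)$ be a linear subspace satisfying (Z0) and (Z1) with respect to an ordered partition $(n_1,\dots,n_r)$ of $p$, and let $x\in\mathcal{Z}\cap\mathrm{Sym}^+(p)$. Then there exists a unique $T\in\mathfrak{h}^+$ with $x=TT^\top$. Writing $T=\sum_{i\in[r]}\sum_{\alpha\in[d_i]}\big(t_{i,\alpha}\tilde e^{(i)}_\alpha+\sum_{\gamma\in J_{i,\alpha}}\tau_{i,\gamma}\tilde f^{(i)}_\gamma\big)$ and $\tau^{(i)}_\alpha=(\tau_{i,\gamma})_{\gamma\in J_{i,\alpha}}\in\mathbb{R}^{m_{i,\alpha}}$, we have: (i) $\det x=\prod_{i\in[r]}\prod_{\alpha\in[d_i]}\big(t_{i,\alpha}^2/\mu_{i,\alpha}\big)^{\mu_{i,\alpha}}$; (ii) for every $A\in\mathrm{Sym}(p)$, $\operatorname{tr}(xA)=\sum_{i\in[r]}\sum_{\alpha\in[d_i]}\begin{bmatrix}t_{i,\alpha}&(\tau^{(i)}_\alpha)^\top\end{bmatrix}\phi_{i,\alpha}(A)\begin{bmatrix}t_{i,\alpha}\\ \tau^{(i)}_\alpha\end{bmatrix}$, where a term with $m_{i,\alpha}=0$ is interpreted as $\lambda_{i,\alpha}(A)t_{i,\alpha}^2$; (iii) in the coordinates $(t_{i,\alpha},\tau^{(i)}_\alpha)$ (ranging over $t_{i,\alpha}>0$, $\tau^{(i)}_\alpha\in\mathbb{R}^{m_{i,\alpha}}$), the Lebesgue measure $\mathrm{d}x$ on $\mathcal{Z}\cap\mathrm{Sym}^+(p)$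 is $\mathrm{d}x=\prod_{i\in[r]}\prod_{\alpha\in[d_i]}\big\{2^{1+m_{i,\alpha}/2}\mu_{i,\alpha}^{-(1+m_{i,\alpha})/2}t_{i,\alpha}^{1+m_{i,\alpha}}\,\mathrm{d}t_{i,\alpha}\,\mathrm{d}\tau^{(i)}_\alpha\big\}$, where $\mathrm{d}\tau^{(i)}_\alpha$ is Lebesgue measure on $\mathbb{R}^{m_{i,\alpha}}$.
   Context: Block notation: for an ordered partition $(n_1,\dots,n_r)$ of $p$ (positive integers summing to $p$), write $x\in\mathrm{Sym}(p)$ in blocks $X_{kh}\in\mathbb{R}^{n_k\times n_h}$. $\mathrm{BlockTri}(x)$ keeps the blocks $X_{kh}$ with $k\ge h$ and zeroes the others. For a linear subspace $\mathcal{Z}\subset\mathrm{Sym}(p)$: $M_i(\mathcal{Z})=\{x\in\mathcal{Z}: X_{kh}=0$ unless $(k,h)=(i,i)\}$, $L_i(\mathcal{Z})=\{x\in\mathcal{Z}: X_{kh}=0$ unless $k>h=i$ or $h>k=i\}$. Conditions: (Z0) $I_p\in\mathcal{Z}$ and $\mathcal{Z}=(\bigoplus_{i\in[r]}M_i(\mathcal{Z}))\oplus(\bigoplus_{i\in[r-1]}L_i(\mathcal{Z}))$; (Z1) $\mathrm{BlockTri}(x)\mathrm{BlockTri}(x)^\top\in\mathcal{Z}$ for all $x\in\mathcal{Z}$. Structure data: let $e^{(i)}$ be the $p\times p$ matrix whose $(i,i)$ block is $I_{n_i}$ and other blocks are $0$. Under (Z0),(Z1), each $M_i(\mathcal{Z})$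 is closed under $x\circ y=(xy+yx)/2$ and is a Euclidean Jordan algebra with identity $e^{(i)}$; let $\{c^{(i)}_\alpha\}_{\alpha\in[d_i]}$ be a Jordan frame of it, i.e. a maximal family of nonzero mutually orthogonal idempotents ($c^{(i)}_\alpha c^{(i)}_\beta=\delta_{\alpha\beta}c^{(i)}_\alpha$) in $M_i(\mathcal{Z})$ with $\sum_\alpha c^{(i)}_\alpha=e^{(i)}$ ($d_i$ is the rank of $M_i(\mathcal{Z})$). Put $\mu_{i,\alpha}=\operatorname{rank}c^{(i)}_\alpha$, $\tilde e^{(i)}_\alpha=c^{(i)}_\alpha/\sqrt{\mu_{i,\alpha}}$, $c^{(i)}_{>\alpha}=\sum_{\beta>\alpha}c^{(i)}_\beta$, and $\mathfrak{h}_{i,\alpha}=c^{(i)}_{>\alpha}M_i(\mathcal{Z})c^{(i)}_\alpha\oplus L_i(\mathcal{Z})c^{(i)}_\alpha\subset\mathbb{R}^{p\times p}$, with an orthonormal basis $\{\tilde f^{(i)}_\gamma\}_{\gamma\in J_{i,\alpha}}$ for $\langle X,Y\rangle=\operatorname{tr}(XY^\top)$ ($J_{i,\alpha}$ possibly empty); $m_{i,\alpha}=|J_{i,\alpha}|=\dim\mathfrak{h}_{i,\alpha}$. For $A\in\mathrm{Sym}(p)$: $\lambda_{i,\alpha}(A)=\operatorname{tr}(A\tilde e^{(i)}_\alpha\tilde e^{(i)}_\alpha)$; if $m_{i,\alpha}>0$, $v_{i,\alpha}(A)\in\mathbb{R}^{1\times m_{i,\alpha}}$ with entries $\operatorname{tr}(A\tilde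 e^{(i)}_\alpha(\tilde f^{(i)}_\gamma)^\top)$, $\psi_{i,\alpha}(A)\in\mathrm{Sym}(m_{i,\alpha})$ with entries $\operatorname{tr}(A\tilde f^{(i)}_\gamma(\tilde f^{(i)}_{\gamma'})^\top)$, and $\phi_{i,\alpha}(A)=\begin{bmatrix}\lambda_{i,\alpha}(A)&v_{i,\alpha}(A)\\ v_{i,\alpha}(A)^\top&\psi_{i,\alpha}(A)\end{bmatrix}$; if $m_{i,\alpha}=0$, $\phi_{i,\alpha}(A)=\lambda_{i,\alpha}(A)$. Let $\mathfrak{h}=\bigoplus_{i,\alpha}(\mathbb{R}c^{(i)}_\alpha\oplus\mathfrak{h}_{i,\alpha})$ and $\mathfrak{h}^+$ the set of $T=\sum_{i}\sum_{\alpha}(t_{i,\alpha}\tilde e^{(i)}_\alpha+\sum_{\gamma\in J_{i,\alpha}}\tau_{i,\gamma}\tilde f^{(i)}_\gamma)$ with $t_{i,\alpha}>0$, $\tau_{i,\gamma}\in\mathbb{R}$. Lebesgue measure on $\mathcal{Z}$: if $(J_k)_k$ is an orthonormal basis of $\mathcal{Z}$ for the trace inner product and $x=\sum_k\alpha_kJ_k$, then $\mathrm{d}x=\prod_k\mathrm{d}\alpha_k$. *)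

theory Defs
  imports "HOL-Analysis.Analysis"
begin

text \<open>Matrices are elements of real^'n^'n, where the finite linearly ordered type 'n
  indexes rows/columns, p = CARD('n).  An ordered partition (n_1,...,n_r) of p is encoded by a
  monotone surjection blk from 'n onto {1..r}: row/column a belongs to block blk a, so blocks
  are contiguous, nonempty, and ordered; n_k = card {a. blk a = k}.  The Euclidean inner product
  on real^'n^'n is tr(X Y^T).\<close>

type_synonym 'n sqmat = "real^'n^'n"

definition ordered_partition :: "('n::{finite,linorder} \<Rightarrow> nat) \<Rightarrow> nat \<Rightarrow> bool" where
  "ordered_partition blk r \<longleftrightarrow> mono blk \<and> blk ` UNIV = {1..r}"

definition symm :: "'n::finite sqmat \<Rightarrow> bool" where
  "symm x \<longleftrightarrow> transpose x = x"

definition posdef :: "'n::finite sqmat \<Rightarrow> bool" where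
  "posdef x \<longleftrightarrow> transpose x = x \<and> (\<forall>v. v \<noteq> 0 \<longrightarrow> v \<bullet> (x *v v) > 0)"

definition BlockTri :: "('n::finite \<Rightarrow> nat) \<Rightarrow> 'n sqmat \<Rightarrow> 'n sqmat" where
  "BlockTri blk x = (\<chi> a b. if blk a \<ge> blk b then x $ a $ b else 0)"

definition Mblk :: "('n::finite \<Rightarrow> nat) \<Rightarrow> 'n sqmat set \<Rightarrow> nat \<Rightarrow> 'n sqmat set" where
  "Mblk blk Z i = {x \<in> Z. \<forall>a b. x $ a $ b \<noteq> 0 \<longrightarrow> blk a = i \<and> blk b = i}"

definition Lblk :: "('n::finite \<Rightarrow> nat) \<Rightarrow> 'n sqmat set \<Rightarrow> nat \<Rightarrow> 'n sqmat set" where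
  "Lblk blk Z i = {x \<in> Z. \<forall>a b. x $ a $ b \<noteq> 0 \<longrightarrow>
      (blk a > blk b \<and> blk b = i) \<or> (blk b > blk a \<and> blk a = i)}"

definition eblk :: "('n::finite \<Rightarrow> nat) \<Rightarrow> nat \<Rightarrow> 'n sqmat" where
  "eblk blk i = (\<chi> a b. if a = b \<and> blk a = i then 1 else 0)"

text \<open>(Z0): I_p in Z and Z is the (automatically direct) sum of the M_i(Z), i in [r], and
  the L_i(Z), i in [r-1].\<close>
definition condZ0 :: "('n::finite \<Rightarrow> nat) \<Rightarrow> nat \<Rightarrow> 'n sqmat set \<Rightarrow> bool" where
  "condZ0 blk r Z \<longleftrightarrow> mat 1 \<in> Z \<and>
     Z = {(\<Sum>i=1..r. y i) + (\<Sum>i=1..r-1. z i) | y z.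
            (\<forall>i\<in>{1..r}. y i \<in> Mblk blk Z i) \<and> (\<forall>i\<in>{1..r-1}. z i \<in> Lblk blk Z i)}"

definition condZ1 :: "('n::finite \<Rightarrow> nat) \<Rightarrow> 'n sqmat set \<Rightarrow> bool" where
  "condZ1 blk Z \<longleftrightarrow> (\<forall>x\<in>Z. BlockTri blk x ** transpose (BlockTri blk x) \<in> Z)"

definition orth_idem_family :: "'n::finite sqmat set \<Rightarrow> nat \<Rightarrow> (nat \<Rightarrow> 'n sqmat) \<Rightarrow> bool" where
  "orth_idem_family S k c \<longleftrightarrow>
     (\<forall>a\<in>{1..k}. c a \<in> S \<and> c a \<noteq> 0) \<and>
     (\<forall>a\<in>{1..k}. \<forall>b\<in>{1..k}. c a ** c b = (if a = b then c a else 0))"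

definition jordan_frame ::
  "('n::finite \<Rightarrow> nat) \<Rightarrow> 'n sqmat set \<Rightarrow> nat \<Rightarrow> nat \<Rightarrow> (nat \<Rightarrow> 'n sqmat) \<Rightarrow> bool" where
  "jordan_frame blk Z i d c \<longleftrightarrow>
     orth_idem_family (Mblk blk Z i) d c \<and> (\<Sum>a=1..d. c a) = eblk blk i \<and>
     \<not> (\<exists>k c'. k > d \<and> orth_idem_family (Mblk blk Z i) k c')"

definition hsp :: "('n::finite \<Rightarrow> nat) \<Rightarrow> 'n sqmat set \<Rightarrow> nat \<Rightarrow> nat \<Rightarrow> (nat \<Rightarrow> 'n sqmat)
                    \<Rightarrow> nat \<Rightarrow> 'n sqmat set" where
  "hsp blk Z i d c \<alpha> = {(\<Sum>\<beta>\<in>{\<alpha><..d}. c \<beta>) ** y ** c \<alpha> + z ** c \<alpha> | y z.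
                            y \<in> Mblk blk Z i \<and> z \<in> Lblk blk Z i}"

definition orthonormal_basis :: "'a::real_inner set \<Rightarrow> nat \<Rightarrow> (nat \<Rightarrow> 'a) \<Rightarrow> bool" where
  "orthonormal_basis S m f \<longleftrightarrow>
     (\<forall>a\<in>{1..m}. \<forall>b\<in>{1..m}. f a \<bullet> f b = (if a = b then 1 else 0)) \<and>
     span (f ` {1..m}) = S"

definition subspace_lebesgue :: "'a::euclidean_space set \<Rightarrow> 'a measure" where
  "subspace_lebesgue Z =
     (let J = (SOME J. orthonormal_basis Z (dim Z) J)
      in distr (PiM {1..dim Z} (\<lambda>_. lborel)) borel (\<lambda>\<alpha>. \<Sum>k=1..dim Z. \<alpha> k *\<^sub>R J k))"

definition mu :: "(nat \<Rightarrow> nat \<Rightarrow> 'n::finite sqmat) \<Rightarrow> nat \<Rightarrow> nat \<Rightarrow> nat" where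
  "mu c i \<alpha> = rank (c i \<alpha>)"

definition etil :: "(nat \<Rightarrow> nat \<Rightarrow> 'n::finite sqmat) \<Rightarrow> nat \<Rightarrow> nat \<Rightarrow> 'n sqmat" where
  "etil c i \<alpha> = (1 / sqrt (real (mu c i \<alpha>))) *\<^sub>R c i \<alpha>"

text \<open>The element T = sum_i sum_alpha (t_{i,alpha} e~_alpha^(i) + sum_gamma tau_{i,alpha,gamma} f~_gamma)
  of h, where the basis of h_{i,alpha} is f i alpha 1, ..., f i alpha (m i alpha).\<close>
definition hT :: "nat \<Rightarrow> (nat \<Rightarrow> nat) \<Rightarrow> (nat \<Rightarrow> nat \<Rightarrow> nat) \<Rightarrow> (nat \<Rightarrow> nat \<Rightarrow> 'n::finite sqmat)
     \<Rightarrow> (nat \<Rightarrow> nat \<Rightarrow> nat \<Rightarrow> 'n sqmat) \<Rightarrow> (nat \<Rightarrow> nat \<Rightarrow> real) \<Rightarrow> (nat \<Rightarrow> nat \<Rightarrow> nat \<Rightarrow> real)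
     \<Rightarrow> 'n sqmat" where
  "hT r d m c f t \<tau> = (\<Sum>i=1..r. \<Sum>\<alpha>=1..d i.
      t i \<alpha> *\<^sub>R etil c i \<alpha> + (\<Sum>\<gamma>=1..m i \<alpha>. \<tau> i \<alpha> \<gamma> *\<^sub>R f i \<alpha> \<gamma>))"

definition hplus :: "nat \<Rightarrow> (nat \<Rightarrow> nat) \<Rightarrow> (nat \<Rightarrow> nat \<Rightarrow> nat) \<Rightarrow> (nat \<Rightarrow> nat \<Rightarrow> 'n::finite sqmat)
     \<Rightarrow> (nat \<Rightarrow> nat \<Rightarrow> nat \<Rightarrow> 'n sqmat) \<Rightarrow> 'n sqmat set" where
  "hplus r d m c f = {hT r d m c f t \<tau> | t \<tau>. \<forall>i\<in>{1..r}. \<forall>\<alpha>\<in>{1..d i}. t i \<alpha> > 0}"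

text \<open>phi_{i,alpha}(A) as a (1+m)x(1+m) matrix with indices 0..m: entry (0,0) is lambda,
  (0,gamma) and (gamma,0) are the entries of v, (gamma,gamma') those of psi.\<close>
definition phi :: "(nat \<Rightarrow> nat \<Rightarrow> 'n::finite sqmat) \<Rightarrow> (nat \<Rightarrow> nat \<Rightarrow> nat \<Rightarrow> 'n sqmat)
     \<Rightarrow> nat \<Rightarrow> nat \<Rightarrow> 'n sqmat \<Rightarrow> nat \<Rightarrow> nat \<Rightarrow> real" where
  "phi c f i \<alpha> A a b =
     (if a = 0 \<and> b = 0 then trace (A ** etil c i \<alpha> ** etil c i \<alpha>)
      else if a = 0 then trace (A ** etil c i \<alpha> ** transpose (f i \<alpha> b))
      else if b = 0 then trace (A ** etil c i \<alpha> ** transpose (f i \<alpha> a))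
      else trace (A ** f i \<alpha> a ** transpose (f i \<alpha> b)))"

definition phi_quad :: "(nat \<Rightarrow> nat \<Rightarrow> nat) \<Rightarrow> (nat \<Rightarrow> nat \<Rightarrow> 'n::finite sqmat)
     \<Rightarrow> (nat \<Rightarrow> nat \<Rightarrow> nat \<Rightarrow> 'n sqmat) \<Rightarrow> nat \<Rightarrow> nat \<Rightarrow> 'n sqmat \<Rightarrow> real \<Rightarrow> (nat \<Rightarrow> real) \<Rightarrow> real" where
  "phi_quad m c f i \<alpha> A t \<tau> =
     (let w = (\<lambda>a. if a = 0 then t else \<tau> a)
      in \<Sum>a=0..m i \<alpha>. \<Sum>b=0..m i \<alpha>. w a * phi c f i \<alpha> A a b * w b)"

text \<open>Coordinates for part (iii): index (i,alpha,0) carries t_{i,alpha}, index (i,alpha,gamma),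
  1 <= gamma <= m_{i,alpha}, carries tau_{i,gamma}.\<close>
definition coord_idx :: "nat \<Rightarrow> (nat \<Rightarrow> nat) \<Rightarrow> (nat \<Rightarrow> nat \<Rightarrow> nat) \<Rightarrow> (nat \<times> nat \<times> nat) set" where
  "coord_idx r d m = {(i, \<alpha>, \<gamma>) | i \<alpha> \<gamma>. i \<in> {1..r} \<and> \<alpha> \<in> {1..d i} \<and> \<gamma> \<in> {0..m i \<alpha>}}"

definition coord_T :: "nat \<Rightarrow> (nat \<Rightarrow> nat) \<Rightarrow> (nat \<Rightarrow> nat \<Rightarrow> nat) \<Rightarrow> (nat \<Rightarrow> nat \<Rightarrow> 'n::finite sqmat)
     \<Rightarrow> (nat \<Rightarrow> nat \<Rightarrow> nat \<Rightarrow> 'n sqmat) \<Rightarrow> (nat \<times> nat \<times> nat \<Rightarrow> real) \<Rightarrow> 'n sqmat" where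
  "coord_T r d m c f u = hT r d m c f (\<lambda>i \<alpha>. u (i, \<alpha>, 0)) (\<lambda>i \<alpha> \<gamma>. u (i, \<alpha>, \<gamma>))"

definition coord_dom :: "nat \<Rightarrow> (nat \<Rightarrow> nat) \<Rightarrow> (nat \<times> nat \<times> nat \<Rightarrow> real) set" where
  "coord_dom r d = {u. \<forall>i\<in>{1..r}. \<forall>\<alpha>\<in>{1..d i}. u (i, \<alpha>, 0) > 0}"

definition coord_density :: "nat \<Rightarrow> (nat \<Rightarrow> nat) \<Rightarrow> (nat \<Rightarrow> nat \<Rightarrow> nat) \<Rightarrow> (nat \<Rightarrow> nat \<Rightarrow> 'n::finite sqmat)
     \<Rightarrow> (nat \<times> nat \<times> nat \<Rightarrow> real) \<Rightarrow> real" where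
  "coord_density r d m c u = (\<Prod>i=1..r. \<Prod>\<alpha>=1..d i.
      2 powr (1 + real (m i \<alpha>) / 2) * real (mu c i \<alpha>) powr (- (1 + real (m i \<alpha>)) / 2)
      * u (i, \<alpha>, 0) ^ (1 + m i \<alpha>))"

end

theory Submission
  imports Defs "HOL-Library.List_Lexorder" "HOL-Probability.Distributions"
begin

text \<open>Order the idempotents \<open>c\<^sub>k\<close>, \<open>k = (i, \<alpha>)\<close>, of all Jordan frames lexicographically. Maximality of the
  frames gives \<open>c\<^sub>k Z c\<^sub>k = \<real> c\<^sub>k\<close>, and (Z1) gives \<open>XX\<^sup>T \<in> Z\<close> and \<open>X + X\<^sup>T \<in> Z\<close> for all
  \<open>X\<close> in \<open>h\<^sub>k = c\<^sub>>\<^sub>k Z c\<^sub>k\<close>. Hence the Cholesky algorithm, eliminating one idempotent at a time,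
  stays inside \<open>Z\<close>: it produces \<open>T\<close>, its columns are determined recursively, and \<open>T\<close> is block
  triangular with diagonal blocks \<open>t\<^sub>k c\<^sub>k / \<surd>\<mu>\<^sub>k\<close>.

  For the measure, the matrices \<open>c\<^sub>k / \<surd>\<mu>\<^sub>k\<close> and \<open>(f + f\<^sup>T) / \<surd>2\<close>, with \<open>f\<close> in the bases of
  the \<open>h\<^sub>k\<close>, form an orthonormal basis of \<open>Z\<close>. In the corresponding coordinates \<open>TT\<^sup>T\<close> has entries
  \<open>t\<^sub>k\<^sup>2 / \<surd>\<mu>\<^sub>k\<close> and \<open>\<surd>2 t\<^sub>k \<tau>\<^sub>k / \<surd>\<mu>\<^sub>k\<close> up to terms depending on earlier columns only, so the
  substitution is triangular and the coordinates can be integrated out one by one.\<close>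

section \<open>Matrices\<close>

text \<open>Primitivity makes block elimination scalar: a pivot \<open>c k ** x ** c k\<close> is a
  multiple \<open>a\<close> of \<open>c k\<close>, so its root and its inverse need only the number
  \<open>sqrt a\<close>. A column then has the form s c + X with c = \<open>c k\<close> and X in its
  column space, and its Gram matrix is s^2 c + s (X + X^T) + XX^T. This is why exactly X + X^T and
  XX^T have to lie in \<open>Z\<close>. Since (Z1) speaks of whole lower block triangles only, both
  must be extracted from it by polarisation and Jordan identities. \<open>subspace_lebesgue\<close>
  takes its orthonormal basis from a choice operator, so independence of the basis has to be proved
  before an adapted basis can be used. Origin of the density: t^2 / sqrt \<mu> has derivative 2 t /
  sqrt \<mu>, and each of the m coordinates \<tau> of the column has slope sqrt 2 t / sqrt \<mu>,
  where sqrt 2 is the norm of f + f^T because f is orthogonal to f^T. The product of these 1 + m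
  slopes is 2^(1 + m/2) \<mu>^(-(1 + m)/2) t^(1 + m).\<close>

lemma bounded_bilinear_matrix_mult:
  "bounded_bilinear ((**) :: 'n::finite sqmat \<Rightarrow> 'n sqmat \<Rightarrow> 'n sqmat)"
  by (subst bilinear_conv_bounded_bilinear[symmetric])
    (auto simp: bilinear_def matrix_add_ldistrib scalar_matrix_assoc[symmetric] matrix_scalar_ac
      matrix_matrix_mult_def vec_eq_iff sum.distrib distrib_left distrib_right sum_distrib_left mult_ac
      intro!: linearI)

interpretation mm: bounded_bilinear "(**) :: 'n::finite sqmat \<Rightarrow> 'n sqmat \<Rightarrow> 'n sqmat"
  by (rule bounded_bilinear_matrix_mult)

lemma linear_transpose: "linear (transpose :: 'n::finite sqmat \<Rightarrow> 'n sqmat)"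
  by (auto simp: transpose_def vec_eq_iff intro!: linearI)

lemmas transpose_add = linear_add[OF linear_transpose]
  and transpose_diff = linear_diff[OF linear_transpose]
  and transpose_sum = linear_sum[OF linear_transpose]
  and transpose_0 [simp] = linear_0[OF linear_transpose]

lemma inner_eq_trace: "(X :: 'n::finite sqmat) \<bullet> Y = trace (X ** transpose Y)"
  by (simp add: inner_vec_def trace_def matrix_matrix_mult_def transpose_def)

lemma inner_transpose: "transpose (X :: 'n::finite sqmat) \<bullet> transpose Y = X \<bullet> Y"
  unfolding inner_vec_def transpose_def by (simp add: inner_vec_def) (rule sum.swap)

lemma inner_mult_left: "((A :: 'n::finite sqmat) ** (X :: 'n sqmat)) \<bullet> Y = X \<bullet> (transpose A ** Y)"
proof -
  have "(A ** X) \<bullet> Y = trace (A ** (X ** transpose Y))"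
    by (simp only: inner_eq_trace matrix_mul_assoc)
  also have "\<dots> = trace (X ** transpose Y ** A)"
    by (rule trace_mul_sym)
  finally show ?thesis
    by (simp add: inner_eq_trace matrix_transpose_mul matrix_mul_assoc)
qed

lemma inner_mult_right: "((X :: 'n::finite sqmat) ** (A :: 'n sqmat)) \<bullet> Y = X \<bullet> (Y ** transpose A)"
  by (simp only: inner_eq_trace matrix_transpose_mul matrix_mul_assoc transpose_transpose)

lemma mult_transpose_self_eq_0: "X = 0" if "transpose X ** X = 0" for X :: "'n::finite sqmat"
proof -
  have "X \<bullet> X = mat 1 \<bullet> (transpose X ** X)"
    using inner_mult_left[of X "mat 1" X] by simp
  with that show ?thesis by simp
qed

lemma inner_matrix_vector_symm:
  "transpose A = A \<Longrightarrow> v \<bullet> (A *v w) = (A *v v) \<bullet> w" for A :: "'n::finite sqmat"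
  by (metis dot_lmul_matrix transpose_matrix_vector)

lemma matrix_eq_0_iff: "A = 0 \<longleftrightarrow> (\<forall>v. A *v v = 0)" for A :: "'n::finite sqmat"
  by (metis matrix_eq matrix_vector_mult_0)

lemma det_mult_transpose_self: "det (T ** transpose T) = (det T)\<^sup>2" for T :: "'n::finite sqmat"
  by (simp add: det_mul det_transpose power2_eq_square)

text \<open>The ranges of \<open>c\<close> and of \<open>mat 1 - c\<close> are orthogonal
  complements, so orthonormal bases of the two together are an eigenbasis. Its vectors are the
  columns of \<open>Q\<close>, and \<open>S\<close> marks those taken from the range of
  \<open>c\<close>.\<close>

lemma projection_diagonalization:
  fixes c :: "'n::finite sqmat"
  assumes sym: "transpose c = c" and idem: "c ** c = c"
  obtains Q S where "orthogonal_matrix Q" "card S = rank c"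
    "c = Q ** (\<chi> a b. if a = b \<and> a \<in> S then 1 else 0) ** transpose Q"
proof -
  let ?R = "range ((*v) c)"
  have subR: "subspace ?R"
    by (intro linear_subspace_image matrix_vector_mul_linear subspace_UNIV)
  obtain B1 where B1: "B1 \<subseteq> ?R" "pairwise orthogonal B1" "\<And>x. x \<in> B1 \<Longrightarrow> norm x = 1"
    "independent B1" "card B1 = dim ?R" "span B1 = ?R"
    using orthonormal_basis_subspace[OF subR] by metis
  let ?N = "range ((*v) (mat 1 - c))"
  have subN: "subspace ?N"
    by (intro linear_subspace_image matrix_vector_mul_linear subspace_UNIV)
  obtain B2 where B2: "B2 \<subseteq> ?N" "pairwise orthogonal B2" "\<And>x. x \<in> B2 \<Longrightarrow> norm x = 1"
    "independent B2" "card B2 = dim ?N" "span B2 = ?N"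
    using orthonormal_basis_subspace[OF subN] by metis
  have cR: "c *v x = x" if "x \<in> B1" for x
    using B1(1) that idem by (auto simp: matrix_vector_mul_assoc)
  have cN: "c *v x = 0" if "x \<in> B2" for x
  proof -
    obtain y where "x = (mat 1 - c) *v y" using B2(1) \<open>x \<in> B2\<close> by blast
    then have "c *v x = (c ** (mat 1 - c)) *v y"
      by (simp add: matrix_vector_mul_assoc)
    then show ?thesis by (simp add: mm.diff_right idem)
  qed
  have orth12: "orthogonal x y" if "x \<in> B1" "y \<in> B2" for x y
    by (metis cN cR inner_matrix_vector_symm inner_zero_right orthogonal_def sym that)
  have n0: "x \<noteq> 0" if "x \<in> B1 \<union> B2" for x
    using that B1(3) B2(3) by fastforce
  have disj: "B1 \<inter> B2 = {}"
    using cR cN n0 by fastforce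
  let ?B = "B1 \<union> B2"
  have pw: "pairwise orthogonal ?B"
    using B1(2) B2(2) orth12 unfolding pairwise_def by (metis Un_iff orthogonal_commute)
  have ind: "independent ?B"
    using pairwise_orthogonal_independent[OF pw] n0 by auto
  have "span ?B = UNIV"
  proof -
    have "x \<in> span ?B" for x
    proof -
      have "c *v x \<in> span ?B" using B1(6) span_mono[of B1 ?B] by blast
      moreover have "(mat 1 - c) *v x \<in> span ?B" using B2(6) span_mono[of B2 ?B] by blast
      ultimately have "c *v x + (mat 1 - c) *v x \<in> span ?B" by (rule span_add)
      then show ?thesis by (simp add: algebra_simps)
    qed
    then show ?thesis by auto
  qed
  then have cardB: "card ?B = CARD('n)"
    using ind by (metis dim_UNIV dim_eq_card_independent dim_span DIM_cart DIM_real mult_1_right)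
  have finB: "finite ?B" using ind independent_bound by blast
  then obtain h where h: "bij_betw h (UNIV::'n set) ?B"
    using cardB finite_same_card_bij[of "UNIV::'n set" ?B] by auto
  define Q :: "'n sqmat" where "Q = (\<chi> a b. h b $ a)"
  define S where "S = {a. h a \<in> B1}"
  have hB: "h a \<in> ?B" for a using h by (auto simp: bij_betw_def)
  have hinj: "h a = h b \<longleftrightarrow> a = b" for a b using h by (auto simp: bij_betw_def inj_on_def)
  have hh: "h a \<bullet> h b = (if a = b then 1 else 0)" for a b
  proof (cases "a = b")
    case True
    then show ?thesis using hB[of b] B1(3) B2(3) by (auto simp: dot_square_norm)
  next
    case False
    then have "orthogonal (h a) (h b)"
      using pw hB hinj by (auto simp: pairwise_def)
    then show ?thesis using False by (simp add: orthogonal_def)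
  qed
  have "transpose Q ** Q = mat 1"
    using hh by (auto simp: vec_eq_iff matrix_matrix_mult_def transpose_def Q_def mat_def inner_vec_def)
  then have orth: "orthogonal_matrix Q"
    by (simp add: orthogonal_matrix)
  let ?D = "(\<chi> a b. if a = b \<and> a \<in> S then 1 else 0) :: 'n sqmat"
  have cQ: "c ** Q = Q ** ?D"
  proof -
    have "(c *v h b) = (if b \<in> S then h b else 0)" for b
      using cR cN hB[of b] by (auto simp: S_def)
    then have "(\<Sum>k\<in>UNIV. c $ a $ k * h b $ k) = (if b \<in> S then h b $ a else 0)" for a b
      by (metis (mono_tags, lifting) matrix_vector_mult_def sum.cong vec_lambda_beta zero_index)
    moreover have "(\<Sum>k\<in>UNIV. h k $ a * (if k = b \<and> k \<in> S then 1 else 0))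
        = (\<Sum>k\<in>UNIV. if k = b then (if b \<in> S then h b $ a else 0) else 0)" for a b
      by (rule sum.cong) auto
    ultimately show ?thesis
      by (simp add: vec_eq_iff matrix_matrix_mult_def Q_def)
  qed
  have QQ: "Q ** transpose Q = mat 1"
    using orth by (simp add: orthogonal_matrix_def)
  have "c = c ** (Q ** transpose Q)" by (simp add: QQ)
  also have "\<dots> = Q ** ?D ** transpose Q"
    by (simp add: matrix_mul_assoc cQ)
  finally have "c = Q ** ?D ** transpose Q" .
  moreover have "card S = rank c"
  proof -
    have "bij_betw h S B1"
      using h by (auto simp: S_def bij_betw_def inj_on_def)
    then show ?thesis
      using B1(5) by (simp add: bij_betw_same_card rank_dim_range)
  qed
  ultimately show ?thesis using orth that by blast
qed

text \<open>Supplies the norm of a frame element: tr (c c^T) = tr c, which is why dividing by sqrt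
  \<mu> normalises it.\<close>

lemma trace_projection:
  fixes c :: "'n::finite sqmat"
  assumes "transpose c = c" "c ** c = c"
  shows "trace c = real (rank c)"
proof -
  obtain Q S where Q: "orthogonal_matrix Q" "card S = rank c"
    "c = Q ** (\<chi> a b. if a = b \<and> a \<in> S then 1 else 0) ** transpose Q"
    using projection_diagonalization[OF assms] .
  let ?D = "(\<chi> a b. if a = b \<and> a \<in> S then 1 else 0) :: 'n sqmat"
  have "trace c = trace (transpose Q ** (Q ** ?D))"
    unfolding Q(3) by (rule trace_mul_sym)
  also have "\<dots> = trace ?D"
    using Q(1) by (simp add: matrix_mul_assoc orthogonal_matrix_def)
  also have "\<dots> = real (card S)"
    by (simp add: trace_def sum.If_cases)
  finally show ?thesis using Q(2) by simp
qed

lemma det_scale_projection: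
  fixes c :: "'n::finite sqmat"
  assumes "transpose c = c" "c ** c = c"
  shows "det (mat 1 + (s - 1) *\<^sub>R c) = s ^ rank c"
proof -
  obtain Q S where Q: "orthogonal_matrix Q" "card S = rank c"
    "c = Q ** (\<chi> a b. if a = b \<and> a \<in> S then 1 else 0) ** transpose Q"
    using projection_diagonalization[OF assms] .
  let ?D = "(\<chi> a b. if a = b \<and> a \<in> S then 1 else 0) :: 'n sqmat"
  have QQ: "Q ** transpose Q = mat 1"
    using Q(1) by (simp add: orthogonal_matrix_def)
  have "mat 1 + (s - 1) *\<^sub>R c = Q ** (mat 1 + (s - 1) *\<^sub>R ?D) ** transpose Q"
    by (simp add: mm.add_left mm.add_right mm.scaleR_left mm.scaleR_right QQ flip: Q(3))
  then have "det (mat 1 + (s - 1) *\<^sub>R c) = det (mat 1 + (s - 1) *\<^sub>R ?D) * det (Q ** transpose Q)"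
    by (simp add: det_mul)
  also have "\<dots> = det (mat 1 + (s - 1) *\<^sub>R ?D)"
    by (simp add: QQ)
  also have "\<dots> = (\<Prod>a\<in>UNIV. if a \<in> S then s else 1)"
    by (subst det_diagonal) (auto simp: mat_def intro!: prod.cong)
  also have "\<dots> = s ^ card S"
    by (simp add: prod.If_cases)
  finally show ?thesis using Q(2) by simp
qed

text \<open>\<open>1 + F\<close> and \<open>1 - F\<close> are mutually inverse and conjugate by the reflection \<open>1 - 2c\<close>,
  so the determinant is \<open>\<plusminus>1\<close>; it is the square of the determinant of \<open>1 + F/2\<close>.\<close>

lemma det_unipotent:
  fixes c F :: "'n::finite sqmat"
  assumes cc: "c ** c = c" and Fc: "F ** c = F" and cF: "c ** F = 0"
  shows "det (mat 1 + F) = 1"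
proof -
  have FF: "F ** F = 0"
    by (metis Fc cF matrix_mul_assoc mm.zero_right)
  have pm: "(det (mat 1 + s *\<^sub>R F))\<^sup>2 = 1" for s
  proof -
    let ?R = "mat 1 - 2 *\<^sub>R c"
    have RR: "?R ** ?R = mat 1"
      by (simp add: mm.diff_left mm.diff_right mm.scaleR_left mm.scaleR_right cc)
        (simp flip: scaleR_2 add: algebra_simps)
    have "?R ** (mat 1 + s *\<^sub>R F) ** ?R = ?R ** ?R + s *\<^sub>R (?R ** F ** ?R)"
      by (simp add: mm.add_right mm.add_left mm.scaleR_left mm.scaleR_right)
    also have "?R ** F ** ?R = - F"
      by (simp add: mm.diff_left mm.diff_right mm.scaleR_left mm.scaleR_right cF Fc)
        (simp add: scaleR_2)
    finally have "det (mat 1 - s *\<^sub>R F) = det (?R ** (mat 1 + s *\<^sub>R F) ** ?R)"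
      by (simp add: RR)
    also have "\<dots> = det (mat 1 + s *\<^sub>R F) * det (?R ** ?R)"
      by (simp add: det_mul)
    finally have *: "det (mat 1 - s *\<^sub>R F) = det (mat 1 + s *\<^sub>R F)"
      by (simp add: RR)
    have "(mat 1 + s *\<^sub>R F) ** (mat 1 - s *\<^sub>R F) = mat 1"
      by (simp add: mm.diff_right mm.add_left mm.scaleR_left mm.scaleR_right FF)
    then show ?thesis using *
      by (metis det_I det_mul power2_eq_square)
  qed
  have "(mat 1 + (1/2) *\<^sub>R F) ** (mat 1 + (1/2) *\<^sub>R F) = mat 1 + F"
    by (simp add: mm.add_right mm.add_left mm.scaleR_left mm.scaleR_right FF flip: scaleR_add_left)
  then have "det (mat 1 + F) = (det (mat 1 + (1/2) *\<^sub>R F))\<^sup>2"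
    by (metis det_mul power2_eq_square)
  then show ?thesis using pm by simp
qed

section \<open>Triangular factorization in a Peirce frame\<close>

definition above :: "('k \<Rightarrow> 'n::finite sqmat) \<Rightarrow> 'k set \<Rightarrow> ('k \<Rightarrow> 'o::linorder) \<Rightarrow> 'k \<Rightarrow> 'n sqmat" where
  "above c K rk k = (\<Sum>l\<in>{l\<in>K. rk k < rk l}. c l)"

text \<open>The spaces \<open>h\<^sub>i\<^sub>,\<^sub>\<alpha>\<close> in the uniform shape \<open>c\<^sub>>\<^sub>k Z c\<^sub>k\<close>, where the
  idempotents of all blocks are ordered by \<open>rk\<close>.\<close>
definition colspace ::
  "'n::finite sqmat set \<Rightarrow> ('k \<Rightarrow> 'n sqmat) \<Rightarrow> 'k set \<Rightarrow> ('k \<Rightarrow> 'o::linorder) \<Rightarrow> 'k \<Rightarrow> 'n sqmat set" where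
  "colspace Z c K rk k = (\<lambda>x. above c K rk k ** x ** c k) ` Z"

text \<open>Everything the factorization needs, with the blocks forgotten: all idempotents form a
  single ordered family. \<open>c_primitive\<close> makes the pivots scalar, while
  \<open>sym_col\<close> and \<open>gram_col\<close> keep the Gram matrix of a column, and hence
  every Schur complement, inside \<open>Z\<close>.\<close>

locale peirce_frame =
  fixes Z :: "'n::finite sqmat set" and K :: "'k set" and rk :: "'k \<Rightarrow> 'o::linorder"
    and c :: "'k \<Rightarrow> 'n sqmat"
  assumes subspace_Z: "subspace Z"
    and symm_Z: "x \<in> Z \<Longrightarrow> transpose x = x"
    and finite_K: "finite K"
    and inj_rk: "inj_on rk K"
    and c_in_Z: "k \<in> K \<Longrightarrow> c k \<in> Z"
    and c_nonzero: "k \<in> K \<Longrightarrow> c k \<noteq> 0"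
    and c_mult: "k \<in> K \<Longrightarrow> l \<in> K \<Longrightarrow> c k ** c l = (if k = l then c k else 0)"
    and c_sum: "(\<Sum>k\<in>K. c k) = mat 1"
    and c_primitive: "x \<in> Z \<Longrightarrow> k \<in> K \<Longrightarrow> \<exists>s. c k ** x ** c k = s *\<^sub>R c k"
    and sym_col: "k \<in> K \<Longrightarrow> X \<in> colspace Z c K rk k \<Longrightarrow> X + transpose X \<in> Z"
    and gram_col: "k \<in> K \<Longrightarrow> X \<in> colspace Z c K rk k \<Longrightarrow> X ** transpose X \<in> Z"
begin

abbreviation H where "H \<equiv> colspace Z c K rk"

lemma c_sym: "k \<in> K \<Longrightarrow> transpose (c k) = c k"
  using c_in_Z symm_Z by blast

lemma c_idem: "k \<in> K \<Longrightarrow> c k ** c k = c k"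
  by (simp add: c_mult)

lemma rank_c_pos: "k \<in> K \<Longrightarrow> rank (c k) > 0"
  using c_nonzero rank_eq_0 by blast

lemma mult_above: "k \<in> K \<Longrightarrow> l \<in> K \<Longrightarrow> c l ** above c K rk k = (if rk k < rk l then c l else 0)"
proof -
  assume kl: "k \<in> K" "l \<in> K"
  have "c l ** above c K rk k = (\<Sum>j\<in>{j\<in>K. rk k < rk j}. if j = l then c l else 0)"
    unfolding above_def mm.sum_right using kl by (intro sum.cong) (auto simp: c_mult)
  then show ?thesis using kl finite_K by simp
qed

lemma above_sym: "transpose (above c K rk k) = above c K rk k"
  by (auto simp: above_def transpose_sum c_sym intro!: sum.cong)

lemma subspace_H: "subspace (H k)"
  unfolding colspace_def
  by (rule linear_subspace_image[OF _ subspace_Z])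
    (auto intro!: linearI simp: mm.add_left mm.add_right mm.scaleR_left mm.scaleR_right)

lemma H_mult_c:
  assumes "k \<in> K" "X \<in> H k"
  shows "X ** c k = X" "l \<in> K \<Longrightarrow> l \<noteq> k \<Longrightarrow> X ** c l = 0"
  using assms by (auto simp: colspace_def c_mult simp flip: matrix_mul_assoc)

lemma c_mult_H:
  assumes "k \<in> K" "X \<in> H k" "l \<in> K" "rk l \<le> rk k"
  shows "c l ** X = 0"
  using assms by (auto simp: colspace_def mult_above matrix_mul_assoc)

text \<open>A column of a lower triangular matrix: a scalar diagonal part \<open>s\<close> and an
  arbitrary part below the diagonal.\<close>

definition column where "column k s S \<longleftrightarrow> (\<exists>X\<in>H k. S = s *\<^sub>R c k + X)"

lemma column_mult:
  assumes "k \<in> K" "column k s S"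
  shows "S ** c k = S" "l \<in> K \<Longrightarrow> l \<noteq> k \<Longrightarrow> S ** c l = 0" "c k ** S = s *\<^sub>R c k"
    "l \<in> K \<Longrightarrow> rk l < rk k \<Longrightarrow> c l ** S = 0"
  using assms H_mult_c[of k] c_mult_H[of k]
  by (auto simp: column_def mm.add_left mm.add_right mm.scaleR_left mm.scaleR_right c_mult)

lemma column_transpose_mult:
  assumes "k \<in> K" "column k s S"
  shows "c k ** transpose S = transpose S" "l \<in> K \<Longrightarrow> l \<noteq> k \<Longrightarrow> c l ** transpose S = 0"
    "transpose S ** c k = s *\<^sub>R c k" "l \<in> K \<Longrightarrow> rk l < rk k \<Longrightarrow> transpose S ** c l = 0"
  using column_mult[OF assms] c_sym assms(1)
  by (metis matrix_transpose_mul transpose_0 transpose_scalar)+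

lemma column_gram:
  assumes k: "k \<in> K" and S: "column k s S"
  shows "S ** transpose S \<in> Z"
proof -
  obtain X where X: "X \<in> H k" "S = s *\<^sub>R c k + X"
    using S by (auto simp: column_def)
  have Xc: "c k ** transpose X = transpose X"
    using H_mult_c(1)[OF k X(1)] c_sym[OF k] by (metis matrix_transpose_mul)
  have "S ** transpose S = (s * s) *\<^sub>R c k + s *\<^sub>R (X + transpose X) + X ** transpose X"
    using k by (simp add: X(2) transpose_add transpose_scalar mm.add_left mm.add_right mm.scaleR_left
        mm.scaleR_right c_idem c_sym Xc H_mult_c(1)[OF k X(1)] algebra_simps)
  then show ?thesis
    using k X(1) by (auto intro!: subspace_add[OF subspace_Z] subspace_scale[OF subspace_Z]
        c_in_Z sym_col gram_col)
qed

lemma column_mult_transpose: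
  assumes "k \<in> K" "l \<in> K" "k \<noteq> l" "column k s S" "column l t R"
  shows "S ** transpose R = 0"
proof -
  have "S ** transpose R = S ** (c k ** (c l ** transpose R))"
    using assms by (metis column_mult(1) column_transpose_mult(1) matrix_mul_assoc)
  then show ?thesis using assms by (simp add: matrix_mul_assoc c_mult column_mult)
qed

text \<open>Cross terms vanish because different columns are supported on orthogonal idempotents
  from the right. So each column contributes to TT^T independently, which is what makes the trace
  formula (ii) split into a sum.\<close>

lemma tri_gram:
  assumes S: "\<And>k. k \<in> K \<Longrightarrow> column k (s k) (S k)"
  shows "(\<Sum>k\<in>K. S k) ** transpose (\<Sum>k\<in>K. S k) = (\<Sum>k\<in>K. S k ** transpose (S k))"
proof -
  have "(\<Sum>k\<in>K. S k) ** transpose (\<Sum>k\<in>K. S k) = (\<Sum>k\<in>K. \<Sum>l\<in>K. S k ** transpose (S l))"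
    by (simp only: transpose_sum mm.sum_left) (simp only: mm.sum_right)
  also have "\<dots> = (\<Sum>k\<in>K. \<Sum>l\<in>K. if l = k then S k ** transpose (S k) else 0)"
    using column_mult_transpose[OF _ _ _ S S] by (intro sum.cong) auto
  also have "\<dots> = (\<Sum>k\<in>K. S k ** transpose (S k))"
    using finite_K by simp
  finally show ?thesis .
qed

lemma tri_gram_in_Z:
  assumes "\<And>k. k \<in> K \<Longrightarrow> column k (s k) (S k)"
  shows "(\<Sum>k\<in>K. S k) ** transpose (\<Sum>k\<in>K. S k) \<in> Z"
  by (subst tri_gram) (use assms column_gram in \<open>auto intro!: subspace_sum[OF subspace_Z]\<close>)

text \<open>\<open>T\<close> is the product of the elementary factors \<open>1 + (S\<^sub>k - c\<^sub>k)\<close> in increasing order.\<close>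
lemma det_tri:
  assumes S: "\<And>k. k \<in> K \<Longrightarrow> column k (s k) (S k)" and s: "\<And>k. k \<in> K \<Longrightarrow> s k \<noteq> 0"
  shows "det (\<Sum>k\<in>K. S k) = (\<Prod>k\<in>K. s k ^ rank (c k))"
proof -
  have elem: "det (mat 1 + (S k - c k)) = s k ^ rank (c k)" if k: "k \<in> K" for k
  proof -
    obtain X where X: "X \<in> H k" "S k = s k *\<^sub>R c k + X"
      using S[OF k] by (auto simp: column_def)
    \<comment> \<open>An elementary factor is a unipotent matrix, of determinant 1, times the
      scaling by \<open>s k\<close> on the range of \<open>c k\<close>.\<close>
    have "(mat 1 + (1 / s k) *\<^sub>R X) ** (mat 1 + (s k - 1) *\<^sub>R c k)
        = mat 1 + (1 / s k) *\<^sub>R X + (s k - 1) *\<^sub>R c k + ((s k - 1) / s k) *\<^sub>R X"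
      by (simp add: mm.add_left mm.add_right mm.scaleR_left mm.scaleR_right H_mult_c(1)[OF k X(1)]
          scaleR_add_right)
    also have "\<dots> = mat 1 + (s k - 1) *\<^sub>R c k + (1 / s k + (s k - 1) / s k) *\<^sub>R X"
      by (simp add: scaleR_add_left)
    also have "1 / s k + (s k - 1) / s k = 1"
      using s[OF k] by (simp flip: add_divide_distrib)
    finally have "mat 1 + (S k - c k) = (mat 1 + (1 / s k) *\<^sub>R X) ** (mat 1 + (s k - 1) *\<^sub>R c k)"
      by (simp add: X(2) scaleR_diff_left algebra_simps)
    moreover have "det (mat 1 + (1 / s k) *\<^sub>R X) = 1"
      using k X(1) by (intro det_unipotent[where c="c k"])
        (auto simp: c_idem mm.scaleR_left mm.scaleR_right H_mult_c c_mult_H)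
    ultimately show ?thesis
      using k by (simp add: det_mul det_scale_projection c_sym c_idem)
  qed
  have "A \<subseteq> K \<Longrightarrow> det (mat 1 + (\<Sum>k\<in>A. S k - c k)) = (\<Prod>k\<in>A. s k ^ rank (c k))" if "finite A" for A
    using that
  proof (induction A rule: finite_ranking_induct[where f = rk])
    case empty
    then show ?case by simp
  next
    case (insert b A)
    show ?case
    proof (cases "b \<in> A")
      case True
      then show ?thesis using insert by (simp add: insert_absorb)
    next
      case False
      have b: "b \<in> K" and A: "A \<subseteq> K" using insert.prems by auto
      \<comment> \<open>Indices are inserted by increasing rank, so the new factor is multiplied on
        the right. An earlier column meets only the rows of column \<open>b\<close> that lie before
        its diagonal, and these are zero.\<close>
      have "(S k - c k) ** (S b - c b) = 0" if "k \<in> A" for k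
      proof -
        have k: "k \<in> K" "k \<noteq> b" using that A False by auto
        then have lt: "rk k < rk b"
          using insert.hyps(2)[OF that] b inj_rk by (metis inj_onD order_le_less)
        have "S k ** S b = S k ** (c k ** S b)"
          using column_mult(1)[OF k(1) S[OF k(1)]] by (simp add: matrix_mul_assoc)
        then show ?thesis
          using k b lt by (simp add: mm.diff_left mm.diff_right column_mult[OF b S[OF b]]
              column_mult[OF k(1) S[OF k(1)]] c_mult)
      qed
      then have step: "(mat 1 + (\<Sum>k\<in>A. S k - c k)) ** (mat 1 + (S b - c b))
          = mat 1 + (\<Sum>k\<in>insert b A. S k - c k)"
        using insert.hyps(1) False
        by (simp add: mm.add_left mm.add_right mm.sum_left del: sum_subtractf)
      have "det (mat 1 + (\<Sum>k\<in>insert b A. S k - c k)) = (\<Prod>k\<in>A. s k ^ rank (c k)) * s b ^ rank (c b)"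
        by (simp only: step[symmetric] det_mul insert.IH[OF A] elem[OF b])
      then show ?thesis
        using insert.hyps(1) False by (simp add: mult.commute del: sum_subtractf)
    qed
  qed
  from this[OF finite_K] show ?thesis
    by (simp add: sum_subtractf c_sum)
qed

lemma tri_posdef:
  assumes S: "\<And>k. k \<in> K \<Longrightarrow> column k (s k) (S k)" and s: "\<And>k. k \<in> K \<Longrightarrow> s k > 0"
  shows "posdef ((\<Sum>k\<in>K. S k) ** transpose (\<Sum>k\<in>K. S k))"
proof -
  let ?T = "\<Sum>k\<in>K. S k"
  have nz: "s k \<noteq> 0" if "k \<in> K" for k
    using s[OF that] by simp
  then have "(\<Prod>k\<in>K. s k ^ rank (c k)) \<noteq> 0"
    using finite_K by simp
  then have "det ?T \<noteq> 0"
    using det_tri[OF S nz] by simp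
  then have inv: "invertible (transpose ?T)"
    by (simp add: invertible_det_nz det_transpose)
  have "v \<bullet> ((?T ** transpose ?T) *v v) > 0" if "v \<noteq> 0" for v
  proof -
    have "transpose ?T *v v \<noteq> 0"
      using inv that by (metis invertible_def matrix_vector_mul_assoc matrix_vector_mul_lid matrix_vector_mult_0_right)
    moreover have "v \<bullet> ((?T ** transpose ?T) *v v) = (transpose ?T *v v) \<bullet> (transpose ?T *v v)"
      by (metis dot_lmul_matrix matrix_vector_mul_assoc transpose_matrix_vector)
    ultimately show ?thesis by simp
  qed
  then show ?thesis
    by (auto simp: posdef_def matrix_transpose_mul)
qed

text \<open>Once the rows before \<open>k\<close> have been eliminated, column \<open>k\<close>
  consists of the pivot and an element of \<open>H k\<close>.\<close>

lemma Z_mult_c: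
  assumes k: "k \<in> K" and x: "x \<in> Z"
    and low: "\<And>l. l \<in> K \<Longrightarrow> rk l < rk k \<Longrightarrow> c l ** x ** c k = 0"
  shows "x ** c k = c k ** x ** c k + above c K rk k ** x ** c k"
proof -
  have "x ** c k = (\<Sum>l\<in>K. c l ** x ** c k)"
    using c_sum by (metis matrix_mul_lid mm.sum_left)
  also have "\<dots> = (\<Sum>l\<in>insert k {l\<in>K. rk k < rk l}. c l ** x ** c k)"
    using k low finite_K inj_rk
    by (intro sum.mono_neutral_right) (auto, metis inj_onD linorder_neqE)
  also have "\<dots> = c k ** x ** c k + above c K rk k ** x ** c k"
    using finite_K by (subst sum.insert) (auto simp: above_def mm.sum_left)
  finally show ?thesis .
qed

text \<open>Eliminating the minimal index \<open>k\<close> of \<open>U\<close> replaces \<open>x\<close> by its Schur complement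
  \<open>x - x c\<^sub>k x / a\<close>, where \<open>c\<^sub>k x c\<^sub>k = a c\<^sub>k\<close>.\<close>
lemma cholesky_upset:
  assumes "U \<subseteq> K" "\<And>k l. k \<in> U \<Longrightarrow> l \<in> K \<Longrightarrow> rk k < rk l \<Longrightarrow> l \<in> U" "x \<in> Z"
    "\<And>l. l \<in> K - U \<Longrightarrow> c l ** x = 0"
    "\<And>v l. l \<in> U \<Longrightarrow> c l *v v \<noteq> 0 \<Longrightarrow> v \<bullet> (x *v v) > 0"
  shows "\<exists>s S. (\<forall>k\<in>U. s k > 0 \<and> column k (s k) (S k)) \<and> x = (\<Sum>k\<in>U. S k ** transpose (S k))"
  using assms
proof (induction "card U" arbitrary: U x)
  case 0
  then have "U = {}" using finite_K by (simp add: finite_subset)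
  then have "(\<Sum>l\<in>K. c l) ** x = 0"
    unfolding mm.sum_left using 0 by (intro sum.neutral) auto
  then show ?case using \<open>U = {}\<close> by (simp add: c_sum)
next
  case (Suc n)
  \<comment> \<open>After the first step the remainder is only semidefinite, as it kills the ranges
    of the eliminated idempotents. The invariant is therefore positivity on vectors with a nonzero
    component in some \<open>l\<close> of \<open>U\<close>.\<close>
  note up = Suc.prems(2) and xZ = Suc.prems(3) and zero = Suc.prems(4) and pos = Suc.prems(5)
  have finU: "finite U" using finite_K Suc.prems(1) finite_subset by blast
  have "U \<noteq> {}" using Suc.hyps(2) by auto
  then obtain k where kU: "k \<in> U" and kmin: "\<And>l. l \<in> U \<Longrightarrow> rk k \<le> rk l"
    using ex_min_if_finite[of "rk ` U"] finU by (metis arg_min_if_finite(1) arg_min_least)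
  have k: "k \<in> K" using kU Suc.prems(1) by auto
  note symx = symm_Z[OF xZ]
  obtain a where a: "c k ** x ** c k = a *\<^sub>R c k" using c_primitive[OF xZ k] by auto
  have "a > 0"
  proof -
    obtain v where v: "c k *v v \<noteq> 0" using c_nonzero[OF k] matrix_eq_0_iff by blast
    let ?w = "c k *v v"
    have "c k *v ?w \<noteq> 0" using v by (simp add: matrix_vector_mul_assoc c_idem k)
    then have "0 < ?w \<bullet> (x *v ?w)" using pos kU by blast
    also have "?w \<bullet> (x *v ?w) = v \<bullet> ((c k ** x ** c k) *v v)"
      by (simp add: inner_matrix_vector_symm[OF c_sym[OF k]] flip: matrix_vector_mul_assoc)
    also have "\<dots> = a * (v \<bullet> (c k *v v))"
      by (simp add: a scaleR_matrix_vector_assoc[symmetric])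
    also have "v \<bullet> (c k *v v) = ?w \<bullet> ?w"
      by (metis c_idem c_sym inner_matrix_vector_symm k matrix_vector_mul_assoc)
    finally show ?thesis by (metis inner_ge_zero mult_nonpos_nonneg not_less)
  qed
  define s where "s = sqrt a"
  have s: "s > 0" "s * s = a" using \<open>a > 0\<close> by (auto simp: s_def)
  define S where "S = (1 / s) *\<^sub>R (x ** c k)"
  have colS: "column k s S"
  proof -
    have "x ** c k = c k ** x ** c k + above c K rk k ** x ** c k"
    proof (rule Z_mult_c[OF k xZ])
      fix l assume "l \<in> K" "rk l < rk k"
      then have "l \<in> K - U" using kmin by force
      then show "c l ** x ** c k = 0" by (simp add: zero)
    qed
    then have "S = (1 / s) *\<^sub>R (a *\<^sub>R c k + above c K rk k ** x ** c k)"
      by (simp add: S_def a)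
    also have "\<dots> = s *\<^sub>R c k + (1 / s) *\<^sub>R (above c K rk k ** x ** c k)"
      using s by (simp add: scaleR_add_right field_simps flip: s(2))
    finally have "S = s *\<^sub>R c k + (1 / s) *\<^sub>R (above c K rk k ** x ** c k)" .
    moreover have "(1 / s) *\<^sub>R (above c K rk k ** x ** c k) \<in> H k"
      by (rule subspace_scale[OF subspace_H]) (use xZ in \<open>auto simp: colspace_def\<close>)
    ultimately show ?thesis by (auto simp: column_def)
  qed
  have SS: "S ** transpose S = (1 / a) *\<^sub>R (x ** c k ** x)"
  proof -
    have "S ** transpose S = (1 / (s * s)) *\<^sub>R (x ** c k ** (c k ** x))"
      by (simp add: S_def transpose_scalar matrix_transpose_mul c_sym[OF k] symx mm.scaleR_left mm.scaleR_right)
    also have "x ** c k ** (c k ** x) = x ** (c k ** c k) ** x"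
      by (simp only: matrix_mul_assoc)
    finally show ?thesis by (simp add: s(2) c_idem[OF k])
  qed
  define x' where "x' = x - S ** transpose S"
  define U' where "U' = U - {k}"
  have "\<exists>s S. (\<forall>k\<in>U'. s k > 0 \<and> column k (s k) (S k)) \<and> x' = (\<Sum>k\<in>U'. S k ** transpose (S k))"
  proof (rule Suc.hyps(1))
    show "n = card U'" using Suc.hyps(2) kU finU by (simp add: U'_def)
    show "U' \<subseteq> K" using Suc.prems(1) by (auto simp: U'_def)
    show "l \<in> U'" if "j \<in> U'" "l \<in> K" "rk j < rk l" for j l
      using that up[of j l] kmin[of j] by (auto simp: U'_def)
    show "x' \<in> Z"
      unfolding x'_def by (rule subspace_diff[OF subspace_Z xZ column_gram[OF k colS]])
    show "c l ** x' = 0" if l: "l \<in> K - U'" for l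
    proof (cases "l = k")
      case True
      have "c k ** (x ** c k ** x) = a *\<^sub>R (c k ** x)"
        by (metis a matrix_mul_assoc mm.scaleR_left)
      then show ?thesis
        using \<open>a > 0\<close> True by (simp add: x'_def SS mm.diff_right mm.scaleR_right)
    next
      case False
      then have "c l ** x = 0" using l zero by (auto simp: U'_def)
      then show ?thesis
        by (simp add: x'_def SS mm.diff_right mm.scaleR_right matrix_mul_assoc)
    qed
    show "v \<bullet> (x' *v v) > 0" if l: "l \<in> U'" and v: "c l *v v \<noteq> 0" for v l
    proof -
      let ?p = "c k *v (x *v v)"
      \<comment> \<open>Completing the square: \<open>?w\<close> minimises the quadratic form of
        \<open>x\<close> over \<open>v\<close> plus the range of \<open>c k\<close>, and the minimum
        is the value of the form of \<open>x'\<close> at \<open>v\<close>. The component of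
        \<open>v\<close> along \<open>c l\<close> is unchanged, so the positivity of
        \<open>x\<close> applies to \<open>?w\<close>.\<close>
      let ?w = "v - (1 / a) *\<^sub>R ?p"
      have lK: "l \<in> K" "l \<noteq> k" "l \<in> U" using l Suc.prems(1) by (auto simp: U'_def)
      have "c l *v ?p = 0"
        by (subst matrix_vector_mul_assoc) (use lK k in \<open>simp add: c_mult\<close>)
      then have "c l *v ?w \<noteq> 0"
        using v by (simp add: matrix_vector_mult_diff_distrib matrix_vector_mult_scaleR)
      then have "0 < ?w \<bullet> (x *v ?w)" using pos lK by blast
      also have "?w \<bullet> (x *v ?w) = v \<bullet> (x *v v) - (1 / a) * (v \<bullet> (x *v ?p))
          - (1 / a) * (?p \<bullet> (x *v v)) + (1 / a) * (1 / a) * (?p \<bullet> (x *v ?p))"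
        by (simp add: matrix_vector_mult_diff_distrib matrix_vector_mult_scaleR inner_diff_left
            inner_diff_right algebra_simps)
      also have "?p \<bullet> (x *v v) = v \<bullet> (x *v ?p)"
        by (metis inner_commute inner_matrix_vector_symm symx)
      also have "?p \<bullet> (x *v ?p) = a * (v \<bullet> (x *v ?p))"
      proof -
        have "?p \<bullet> (x *v ?p) = (x *v v) \<bullet> ((c k ** x ** c k) *v (x *v v))"
          by (simp add: inner_matrix_vector_symm[OF c_sym[OF k]] flip: matrix_vector_mul_assoc)
        also have "\<dots> = a * ((x *v v) \<bullet> (c k *v (x *v v)))"
          by (simp add: a scaleR_matrix_vector_assoc[symmetric])
        finally show ?thesis by (simp add: inner_matrix_vector_symm[OF symx])
      qed
      finally have "0 < v \<bullet> (x *v v) - (1 / a) * (v \<bullet> (x *v ?p))"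
        using \<open>a > 0\<close> by simp
      then show ?thesis
        by (simp add: x'_def SS matrix_vector_mult_diff_rdistrib inner_diff_right
            scaleR_matrix_vector_assoc[symmetric] flip: matrix_vector_mul_assoc)
    qed
  qed
  then obtain s' S' where S': "\<forall>k\<in>U'. s' k > 0 \<and> column k (s' k) (S' k)"
    "x' = (\<Sum>k\<in>U'. S' k ** transpose (S' k))" by auto
  have "x = (\<Sum>j\<in>U. (S'(k := S)) j ** transpose ((S'(k := S)) j))"
  proof -
    have "(\<Sum>j\<in>U. (S'(k := S)) j ** transpose ((S'(k := S)) j))
        = S ** transpose S + (\<Sum>j\<in>U'. (S'(k := S)) j ** transpose ((S'(k := S)) j))"
      unfolding U'_def using kU finU by (subst sum.remove[of _ k]) auto
    also have "(\<Sum>j\<in>U'. (S'(k := S)) j ** transpose ((S'(k := S)) j)) = x'"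
      unfolding S'(2) by (intro sum.cong) (auto simp: U'_def)
    finally show ?thesis by (simp add: x'_def)
  qed
  moreover have "\<forall>j\<in>U. (s'(k := s)) j > 0 \<and> column j ((s'(k := s)) j) ((S'(k := S)) j)"
    using S'(1) colS s(1) by (auto simp: U'_def)
  ultimately show ?case by blast
qed

lemma cholesky_exists:
  assumes "x \<in> Z" "posdef x"
  obtains s S where "\<And>k. k \<in> K \<Longrightarrow> s k > 0" "\<And>k. k \<in> K \<Longrightarrow> column k (s k) (S k)"
    "x = (\<Sum>k\<in>K. S k) ** transpose (\<Sum>k\<in>K. S k)"
proof -
  have "\<exists>s S. (\<forall>k\<in>K. s k > 0 \<and> column k (s k) (S k)) \<and> x = (\<Sum>k\<in>K. S k ** transpose (S k))"
  proof (rule cholesky_upset)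
    show "v \<bullet> (x *v v) > 0" if "c l *v v \<noteq> 0" for v l
      using that assms(2) by (cases "v = 0") (auto simp: posdef_def)
  qed (use assms in auto)
  then show ?thesis using that tri_gram by (metis (mono_tags, lifting))
qed

text \<open>The recursion for the columns: \<open>transpose (S l) ** c k\<close> vanishes for
  \<open>l\<close> after \<open>k\<close> and is \<open>s k\<close> times \<open>c k\<close> for
  \<open>l = k\<close>, so only earlier columns enter besides \<open>S k\<close>. It yields both the
  uniqueness of the factor and the triangular shape of the coordinate change.\<close>

lemma gram_mult_c:
  assumes S: "\<And>k. k \<in> K \<Longrightarrow> column k (s k) (S k)" and k: "k \<in> K"
  shows "(\<Sum>l\<in>K. S l ** transpose (S l)) ** c k
    = s k *\<^sub>R S k + (\<Sum>l\<in>{l\<in>K. rk l < rk k}. S l ** transpose (S l)) ** c k"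
proof -
  have "(\<Sum>l\<in>K. S l ** transpose (S l)) ** c k = (\<Sum>l\<in>K. S l ** (transpose (S l) ** c k))"
    by (simp add: mm.sum_left matrix_mul_assoc)
  also have "\<dots> = (\<Sum>l\<in>insert k {l\<in>K. rk l < rk k}. S l ** (transpose (S l) ** c k))"
    using k finite_K inj_rk column_transpose_mult(4)[OF _ S]
    by (intro sum.mono_neutral_right) (auto, metis inj_onD linorder_neqE mm.zero_right)
  also have "\<dots> = s k *\<^sub>R S k + (\<Sum>l\<in>{l\<in>K. rk l < rk k}. S l ** (transpose (S l) ** c k))"
    using finite_K k by (subst sum.insert)
      (auto simp: column_transpose_mult[OF k S] column_mult[OF k S] mm.scaleR_right)
  finally show ?thesis by (simp add: mm.sum_left matrix_mul_assoc)
qed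

text \<open>Induction on the number of smaller indices. If the earlier columns agree, the recursion
  leaves s S = t R for column \<open>k\<close>; comparing diagonal parts gives s^2 = t^2, and
  positivity selects the root.\<close>

lemma cholesky_unique:
  assumes S: "\<And>k. k \<in> K \<Longrightarrow> column k (s k) (S k)" and s: "\<And>k. k \<in> K \<Longrightarrow> s k > 0"
    and R: "\<And>k. k \<in> K \<Longrightarrow> column k (t k) (R k)" and t: "\<And>k. k \<in> K \<Longrightarrow> t k > 0"
    and eq: "(\<Sum>k\<in>K. S k ** transpose (S k)) = (\<Sum>k\<in>K. R k ** transpose (R k))"
    and k: "k \<in> K"
  shows "S k = R k" "s k = t k"
proof -
  have "S k = R k \<and> s k = t k"
    using k
  proof (induction "card {l\<in>K. rk l < rk k}" arbitrary: k rule: less_induct)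
    case less
    have IH: "S l = R l" if l: "l \<in> K" "rk l < rk k" for l
    proof -
      have "{j\<in>K. rk j < rk l} \<subset> {j\<in>K. rk j < rk k}" using l by fastforce
      then have "card {j\<in>K. rk j < rk l} < card {j\<in>K. rk j < rk k}"
        using finite_K by (intro psubset_card_mono) auto
      then show ?thesis using less.hyps l(1) by blast
    qed
    then have "(\<Sum>l\<in>{l\<in>K. rk l < rk k}. S l ** transpose (S l)) ** c k
        = (\<Sum>l\<in>{l\<in>K. rk l < rk k}. R l ** transpose (R l)) ** c k"
      by simp
    then have *: "s k *\<^sub>R S k = t k *\<^sub>R R k"
      using gram_mult_c[OF S less.prems] gram_mult_c[OF R less.prems] eq by simp
    then have "c k ** (s k *\<^sub>R S k) = c k ** (t k *\<^sub>R R k)" by simp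
    then have "(s k * s k) *\<^sub>R c k = (t k * t k) *\<^sub>R c k"
      by (simp add: mm.scaleR_right column_mult[OF less.prems S] column_mult[OF less.prems R] less.prems)
    then have "s k * s k = t k * t k" using c_nonzero[OF less.prems] by simp
    then have "s k = t k" using s[OF less.prems] t[OF less.prems] by (metis abs_of_pos real_sqrt_abs2)
    then show ?case using * s[OF less.prems] by simp
  qed
  then show "S k = R k" "s k = t k" by auto
qed

end

section \<open>Jordan subspaces and block structure\<close>

text \<open>Near t = 0 a nonzero linear term dominates; t = -a / B with B > |b| already makes the
  expression negative.\<close>

lemma quadratic_nonneg_imp_zero:
  fixes a b :: real
  assumes "\<And>t. 0 \<le> 2 * t * a + t\<^sup>2 * b"
  shows "a = 0"
proof -
  define B where "B = \<bar>b\<bar> + 1"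
  have B: "B > 0" "b - 2 * B < 0" by (auto simp: B_def)
  have "0 \<le> 2 * (- a / B) * a + (- a / B)\<^sup>2 * b" by (rule assms)
  also have "\<dots> = (a / B)\<^sup>2 * (b - 2 * B)"
    using B(1) by (simp add: power2_eq_square field_simps)
  finally have "(a / B)\<^sup>2 = 0"
    using B(2) by (metis mult_pos_neg not_less zero_less_power2 zero_power2)
  then show ?thesis using B(1) by simp
qed

section \<open>Jordan algebras of symmetric matrices and their primitive idempotents\<close>

locale jordan_subspace =
  fixes M :: "'n::finite sqmat set"
  assumes subspace_M: "subspace M"
    and symm_M: "x \<in> M \<Longrightarrow> transpose x = x"
    and square_M: "x \<in> M \<Longrightarrow> x ** x \<in> M"
begin

lemma jordan_M:
  assumes "x \<in> M" "y \<in> M" shows "x ** y + y ** x \<in> M"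
proof -
  have "x ** y + y ** x = (x + y) ** (x + y) - x ** x - y ** y"
    by (simp add: mm.add_left mm.add_right)
  then show ?thesis
    using assms by (metis square_M subspace_M subspace_add subspace_diff)
qed

text \<open>The quadratic representation expressed through the Jordan product: 2 xyx = x(xy + yx) +
  (xy + yx)x - (x^2 y + y x^2). Polarising it in x then gives \<open>triple_M\<close>.\<close>

lemma quad_M:
  assumes x: "x \<in> M" and y: "y \<in> M" shows "x ** y ** x \<in> M"
proof -
  have "x ** (x ** y + y ** x) + (x ** y + y ** x) ** x - (x ** x ** y + y ** (x ** x))
      = 2 *\<^sub>R (x ** y ** x)"
    by (simp add: mm.add_left mm.add_right matrix_mul_assoc scaleR_2)
  moreover have "x ** (x ** y + y ** x) + (x ** y + y ** x) ** x - (x ** x ** y + y ** (x ** x)) \<in> M"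
    by (intro subspace_diff[OF subspace_M] jordan_M square_M x y)
  ultimately have "(1/2) *\<^sub>R (2 *\<^sub>R (x ** y ** x)) \<in> M"
    by (metis subspace_M subspace_scale)
  then show ?thesis by simp
qed

lemma triple_M:
  assumes x: "x \<in> M" and y: "y \<in> M" and w: "w \<in> M" shows "x ** y ** w + w ** y ** x \<in> M"
proof -
  have "x ** y ** w + w ** y ** x = (x + w) ** y ** (x + w) - x ** y ** x - w ** y ** w"
    by (simp add: mm.add_left mm.add_right matrix_mul_assoc)
  then show ?thesis
    using assms by (metis quad_M subspace_M subspace_add subspace_diff)
qed

text \<open>If \<open>u\<close> annihilates a vector of the range of \<open>c\<close>, then multiplication by \<open>u\<close> is bijective
  on the span of the positive powers of \<open>u\<close>, whose unit element is an idempotent strictly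
  below \<open>c\<close>.\<close>
lemma singular_imp_idempotent:
  assumes u: "u \<in> M" "u \<noteq> 0" and cu: "c ** u = u" "u ** c = u"
    and v: "c *v v = v" "v \<noteq> 0" "u *v v = 0"
  obtains e where "e \<in> M" "e ** e = e" "e \<noteq> 0" "e \<noteq> c" "c ** e = e" "e ** c = e"
proof -
  define pw where "pw n = (((**) u) ^^ n) u" for n :: nat
  define S where "S = span (range pw)"
  have pw0: "pw 0 = u" and pwS: "pw (Suc n) = u ** pw n" for n
    by (simp_all add: pw_def)
  have lin: "linear ((**) u :: 'n sqmat \<Rightarrow> 'n sqmat)"
    by (rule bounded_linear.linear[OF mm.bounded_linear_right])
  have comm: "u ** pw n = pw n ** u" for n
  proof (induction n)
    case (Suc n)
    have "u ** pw (Suc n) = u ** (pw n ** u)" by (simp only: pwS Suc)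
    then show ?case by (simp only: pwS matrix_mul_assoc)
  qed (simp add: pw0)
  have pwM: "pw n \<in> M" for n
  proof (induction n)
    case (Suc n)
    have "(1/2) *\<^sub>R (u ** pw n + pw n ** u) \<in> M"
      using u(1) Suc by (intro subspace_scale[OF subspace_M] jordan_M)
    moreover have "(1/2) *\<^sub>R (u ** pw n + pw n ** u) = pw (Suc n)"
      by (simp add: pwS flip: comm scaleR_2)
    ultimately show ?case by simp
  qed (simp add: pw0 u)
  have cpw: "c ** pw n = pw n \<and> pw n ** c = pw n" for n
    by (induction n) (simp_all add: pw0 pwS cu matrix_mul_assoc, simp flip: matrix_mul_assoc)
  have S_induct: "P a" if a: "a \<in> S" and P0: "subspace {a. P a}" and Pn: "\<And>n. P (pw n)" for P a
    using span_minimal[of "range pw" "{a. P a}"] a P0 Pn by (auto simp: S_def)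
  have SM: "a \<in> M" if "a \<in> S" for a
    using S_induct[of a "\<lambda>a. a \<in> M"] that pwM subspace_M by simp
  have Scomm: "u ** a = a ** u" if "a \<in> S" for a
    using S_induct[of a "\<lambda>a. u ** a = a ** u"] that comm
    by (simp add: subspace_def mm.add_left mm.add_right mm.scaleR_left mm.scaleR_right)
  have Sc: "c ** a = a" "a ** c = a" if "a \<in> S" for a
    using S_induct[of a "\<lambda>a. c ** a = a \<and> a ** c = a"] that cpw
    by (auto simp: subspace_def mm.add_left mm.add_right mm.scaleR_left mm.scaleR_right)
  have subS: "subspace S" by (simp add: S_def)
  \<comment> \<open>If \<open>u\<close> kills \<open>a\<close>, so does every element of
    \<open>S\<close>. But \<open>a\<close> is itself in \<open>S\<close>, so a a = 0, and
    \<open>a\<close> is symmetric.\<close>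
  have inj: "a = 0" if a: "a \<in> S" and ua: "u ** a = 0" for a
  proof -
    have "pw n ** a = 0" for n
      by (induction n) (simp_all add: pw0 pwS ua flip: matrix_mul_assoc)
    then have "b ** a = 0" if "b \<in> S" for b
      using S_induct[of b "\<lambda>b. b ** a = 0"] that
      by (auto simp: subspace_def mm.add_left mm.scaleR_left)
    then show ?thesis
      using mult_transpose_self_eq_0[of a] symm_M[OF SM[OF a]] a by auto
  qed
  have surj: "(**) u ` S = S"
  proof (rule subspace_dim_equal)
    show "subspace ((**) u ` S)" using lin subS by (rule linear_subspace_image)
    have "(**) u ` S = span ((**) u ` range pw)"
      unfolding S_def by (rule linear_span_image[OF lin, symmetric])
    also have "\<dots> \<subseteq> S"
      unfolding S_def by (rule span_mono) (auto simp flip: pwS)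
    finally show "(**) u ` S \<subseteq> S" .
    have "inj_on ((**) u) (span S)"
      using linear_injective_on_subspace_0[OF lin subS] inj subS by (simp add: span_eq_iff[THEN iffD2])
    then show "dim ((**) u ` S) \<ge> dim S"
      using dim_image_eq[OF lin] by simp
  qed (fact subS)
  have uS: "u \<in> S"
    unfolding S_def by (metis pw0 rangeI span_base)
  have solve: "\<exists>b\<in>S. a = u ** b" if "a \<in> S" for a
    using that by (subst (asm) surj[symmetric]) blast
  obtain e where e: "e \<in> S" "u ** e = u"
    using solve[OF uS] by auto
  have unit: "e ** a = a" if a: "a \<in> S" for a
  proof -
    obtain b where b: "b \<in> S" "a = u ** b"
      using solve[OF a] by blast
    then show ?thesis using Scomm[OF e(1)] e(2) by (simp add: matrix_mul_assoc)
  qed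
  have "e \<noteq> c"
  proof
    \<comment> \<open>Then \<open>c\<close> would be a multiple of \<open>u\<close> and would kill
      \<open>v\<close>, although it fixes \<open>v\<close>.\<close>
    assume "e = c"
    then obtain b where b: "b \<in> S" "c = u ** b"
      using solve[OF e(1)] by blast
    then have "c *v v = b *v (u *v v)"
      using Scomm[OF b(1)] by (simp add: matrix_vector_mul_assoc)
    then show False using v by simp
  qed
  moreover have "e \<noteq> 0" using e(2) u(2) by auto
  ultimately show ?thesis
    using that[of e] SM[OF e(1)] unit[OF e(1)] Sc[OF e(1)] by blast
qed

text \<open>The singular element of \<open>singular_imp_idempotent\<close> is \<open>\<lambda> c - c x c\<close>, where \<open>\<lambda>\<close> is the
  maximum of the Rayleigh quotient of \<open>c x c\<close> on the range of \<open>c\<close>.\<close>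
lemma primitive_imp_scalar:
  assumes c: "c \<in> M" "c ** c = c" "c \<noteq> 0" and x: "x \<in> M"
    and prim: "\<And>e. e \<in> M \<Longrightarrow> e ** e = e \<Longrightarrow> c ** e = e \<Longrightarrow> e ** c = e \<Longrightarrow> e = 0 \<or> e = c"
  shows "\<exists>s. c ** x ** c = s *\<^sub>R c"
proof -
  let ?w = "c ** x ** c"
  let ?V = "{v. c *v v = v} \<inter> sphere 0 1"
  have "closed {v. c *v v = v}"
    by (intro closed_Collect_eq continuous_intros)
  then have "compact ?V" by (rule closed_Int_compact) simp
  moreover have "?V \<noteq> {}"
  proof -
    obtain v where v: "c *v v \<noteq> 0" using c(3) matrix_eq_0_iff by blast
    have "c *v (c *v v) = c *v v" by (simp add: matrix_vector_mul_assoc c(2))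
    then have "(1 / norm (c *v v)) *\<^sub>R (c *v v) \<in> ?V"
      using v by (simp add: matrix_vector_mult_scaleR)
    then show ?thesis by blast
  qed
  moreover have "continuous_on ?V (\<lambda>v. v \<bullet> (?w *v v))"
    by (intro continuous_intros)
  ultimately have "\<exists>v\<in>?V. \<forall>y\<in>?V. y \<bullet> (?w *v y) \<le> v \<bullet> (?w *v v)"
    by (rule continuous_attains_sup)
  then obtain v where v: "v \<in> ?V" and vmax: "\<And>y. y \<in> ?V \<Longrightarrow> y \<bullet> (?w *v y) \<le> v \<bullet> (?w *v v)"
    by blast
  define s where "s = v \<bullet> (?w *v v)"
  define u where "u = s *\<^sub>R c - ?w"
  have uM: "u \<in> M"
    unfolding u_def by (intro subspace_diff[OF subspace_M] subspace_scale[OF subspace_M] quad_M c(1) x)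
  have cu: "c ** u = u" "u ** c = u"
    by (simp_all add: u_def mm.diff_left mm.diff_right mm.scaleR_left mm.scaleR_right c(2) matrix_mul_assoc)
      (simp add: c(2) flip: matrix_mul_assoc)
  have vv: "c *v v = v" "v \<bullet> v = 1" using v by (auto simp: dot_square_norm)
  have nonneg: "y \<bullet> (u *v y) \<ge> 0" if y: "c *v y = y" for y
  proof (cases "y = 0")
    case False
    have "(1 / norm y) *\<^sub>R y \<in> ?V" using y False by (simp add: matrix_vector_mult_scaleR)
    from vmax[OF this] have "(1 / norm y) * (1 / norm y) * (y \<bullet> (?w *v y)) \<le> s"
      by (simp add: s_def matrix_vector_mult_scaleR)
    then have "y \<bullet> (?w *v y) \<le> s * (norm y * norm y)"
      using False by (simp add: field_simps)
    then show ?thesis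
      by (simp add: u_def matrix_vector_mult_diff_rdistrib inner_diff_right y dot_square_norm power2_eq_square
          flip: scaleR_matrix_vector_assoc)
  qed simp
  have v0: "v \<bullet> (u *v v) = 0"
    by (simp add: u_def matrix_vector_mult_diff_rdistrib inner_diff_right vv flip: scaleR_matrix_vector_assoc)
      (simp add: s_def)
  have "u *v v = 0"
  proof -
    let ?y = "u *v v"
    let ?b = "?y \<bullet> (u *v ?y)"
    have cy: "c *v ?y = ?y" by (simp add: matrix_vector_mul_assoc cu)
    \<comment> \<open>The form of \<open>u\<close> is nonnegative on the range of \<open>c\<close>
      and zero at the maximiser \<open>v\<close>. Moving from \<open>v\<close> in the direction
      \<open>u *v v\<close> changes it by a linear term with coefficient 2 |uv|^2, which must
      therefore vanish.\<close>
    have q: "0 \<le> 2 * t * (?y \<bullet> ?y) + t\<^sup>2 * ?b" for t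
    proof -
      have "0 \<le> (v + t *\<^sub>R ?y) \<bullet> (u *v (v + t *\<^sub>R ?y))"
        by (rule nonneg) (simp add: matrix_vector_right_distrib matrix_vector_mult_scaleR vv cy)
      also have "\<dots> = 2 * t * (?y \<bullet> ?y) + t\<^sup>2 * ?b"
        using inner_matrix_vector_symm[OF symm_M[OF uM], of v ?y] v0
        by (simp add: matrix_vector_right_distrib matrix_vector_mult_scaleR inner_add_left inner_add_right
            power2_eq_square inner_commute algebra_simps)
      finally show ?thesis .
    qed
    then show ?thesis
      using quadratic_nonneg_imp_zero[of "?y \<bullet> ?y" ?b] by simp
  qed
  moreover have "v \<noteq> 0" using vv by auto
  ultimately have "u = 0"
    using singular_imp_idempotent[OF uM _ cu vv(1)] prim by metis
  then have "c ** x ** c = s *\<^sub>R c" by (simp add: u_def)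
  then show ?thesis by blast
qed

end

section \<open>Block structure and the consequences of (Z0) and (Z1)\<close>

lemma mult_eblk:
  "(x ** eblk blk i) $ a $ b = (if blk b = i then x $ a $ b else 0)"
  "(eblk blk i ** x) $ a $ b = (if blk a = i then x $ a $ b else 0)"
  for x :: "'n::finite sqmat"
proof -
  have "(x ** eblk blk i) $ a $ b = (\<Sum>k\<in>UNIV. if k = b then (if blk b = i then x $ a $ b else 0) else 0)"
    unfolding matrix_matrix_mult_def eblk_def vec_lambda_beta by (rule sum.cong) auto
  then show "(x ** eblk blk i) $ a $ b = (if blk b = i then x $ a $ b else 0)" by simp
  have "(eblk blk i ** x) $ a $ b = (\<Sum>k\<in>UNIV. if k = a then (if blk a = i then x $ a $ b else 0) else 0)"
    unfolding matrix_matrix_mult_def eblk_def vec_lambda_beta by (rule sum.cong) auto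
  then show "(eblk blk i ** x) $ a $ b = (if blk a = i then x $ a $ b else 0)" by simp
qed

lemma eblk_mult_eblk: "eblk blk i ** eblk blk j = (if i = j then eblk blk i else (0 :: 'n::finite sqmat))"
  by (auto simp: vec_eq_iff mult_eblk) (auto simp: eblk_def)

lemma Mblk_eblk:
  assumes "y \<in> Mblk blk Z i"
  shows "y ** eblk blk i = y" "eblk blk i ** y = y"
    "j \<noteq> i \<Longrightarrow> y ** eblk blk j = 0" "j \<noteq> i \<Longrightarrow> eblk blk j ** y = 0"
  using assms by (auto simp: vec_eq_iff mult_eblk Mblk_def)

lemma Lblk_eblk:
  assumes "z \<in> Lblk blk Z i"
  shows "eblk blk j ** z ** eblk blk j = 0" "BlockTri blk z = z ** eblk blk i"
  using assms by (fastforce simp: vec_eq_iff mult_eblk Lblk_def BlockTri_def)+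

lemma BlockTri_add: "BlockTri blk (x + y) = BlockTri blk x + BlockTri blk y"
  by (simp add: BlockTri_def vec_eq_iff)

lemma BlockTri_Mblk: "y \<in> Mblk blk Z i \<Longrightarrow> BlockTri blk y = y"
  by (fastforce simp: vec_eq_iff BlockTri_def Mblk_def)

locale block_space =
  fixes blk :: "'n::{finite,linorder} \<Rightarrow> nat" and r :: nat and Z :: "'n sqmat set"
  assumes part: "ordered_partition blk r"
    and subspace_Z: "subspace Z" and symm_Z: "x \<in> Z \<Longrightarrow> transpose x = x"
    and Z0: "condZ0 blk r Z" and Z1: "condZ1 blk Z"
begin

abbreviation E where "E \<equiv> eblk blk"
abbreviation M where "M \<equiv> Mblk blk Z"
abbreviation L where "L \<equiv> Lblk blk Z"

lemma blk_range: "blk a \<in> {1..r}"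
  using part by (auto simp: ordered_partition_def)

lemma MZ: "y \<in> M i \<Longrightarrow> y \<in> Z" and LZ: "z \<in> L i \<Longrightarrow> z \<in> Z"
  by (auto simp: Mblk_def Lblk_def)

lemma subspace_M: "subspace (M i)"
  using subspace_Z by (auto simp: Mblk_def subspace_def) (metis add.right_neutral)+

lemma zero_L: "0 \<in> L i"
  using subspace_0[OF subspace_Z] by (auto simp: Lblk_def)

lemma M_I: "y \<in> Z \<Longrightarrow> E i ** y ** E i = y \<Longrightarrow> y \<in> M i"
  unfolding Mblk_def vec_eq_iff mult_eblk by auto metis+

lemma Z_decomp:
  assumes "x \<in> Z"
  obtains y z where "x = (\<Sum>i=1..r. y i) + (\<Sum>i=1..r. z i)"
    "\<forall>i\<in>{1..r}. y i \<in> M i \<and> z i \<in> L i"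
proof -
  obtain y z where yz: "x = (\<Sum>i=1..r. y i) + (\<Sum>i=1..r-1. z i)"
    "\<forall>i\<in>{1..r}. y i \<in> M i" "\<forall>i\<in>{1..r-1}. z i \<in> L i"
    using assms Z0 unfolding condZ0_def by blast
  \<comment> \<open>(Z0) provides no off-diagonal component for the last block. Padding with 0 lets
    both sums run over the same range.\<close>
  let ?z = "\<lambda>i. if i \<in> {1..r-1} then z i else 0"
  have "(\<Sum>i=1..r-1. z i) = (\<Sum>i=1..r. ?z i)"
    by (intro sum.mono_neutral_cong_left) auto
  then have "x = (\<Sum>i=1..r. y i) + (\<Sum>i=1..r. ?z i)" using yz(1) by simp
  moreover have "?z i \<in> L i" for i using yz(3) zero_L by auto
  ultimately show ?thesis using yz(2) that[of y ?z] by blast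
qed

lemma Z1_polar:
  assumes x: "x \<in> Z" and y: "y \<in> Z"
  shows "BlockTri blk x ** transpose (BlockTri blk y) + BlockTri blk y ** transpose (BlockTri blk x) \<in> Z"
proof -
  let ?l = "BlockTri blk"
  have "?l (x + y) ** transpose (?l (x + y)) - ?l x ** transpose (?l x) - ?l y ** transpose (?l y) \<in> Z"
    using Z1 x y by (auto simp: condZ1_def intro!: subspace_diff[OF subspace_Z] subspace_add[OF subspace_Z])
  then show ?thesis
    by (simp add: BlockTri_add transpose_add mm.add_left mm.add_right algebra_simps)
qed

text \<open>On a single diagonal block \<open>BlockTri\<close> is the identity, so (Z1) is closure
  under squares there. This alone makes \<open>M i\<close> a Jordan algebra.\<close>

lemma M_square: "y \<in> M i \<Longrightarrow> y ** y \<in> M i"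
proof -
  assume y: "y \<in> M i"
  have "y ** y \<in> Z"
    using Z1 MZ[OF y] BlockTri_Mblk[OF y] symm_Z[OF MZ[OF y]] by (metis condZ1_def)
  moreover have "E i ** (y ** y) ** E i = y ** y"
    by (metis Mblk_eblk(1,2)[OF y] matrix_mul_assoc)
  ultimately show ?thesis by (rule M_I)
qed

sublocale jordan: jordan_subspace "M i" for i
  by unfold_locales (auto intro: subspace_M M_square symm_Z MZ)

text \<open>This is where (Z0) matters: in the decomposition of \<open>x\<close> the parts in
  \<open>L j\<close> have no diagonal blocks, so the compression is exactly the component in
  \<open>M i\<close>.\<close>

lemma compress_M: "x \<in> Z \<Longrightarrow> E i ** x ** E i \<in> M i" if i: "i \<in> {1..r}"
proof -
  assume x: "x \<in> Z"
  obtain y z where yz: "x = (\<Sum>i=1..r. y i) + (\<Sum>i=1..r. z i)"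
    "\<forall>i\<in>{1..r}. y i \<in> M i \<and> z i \<in> L i" by (rule Z_decomp[OF x])
  have yM: "y j \<in> M j" and zL: "z j \<in> L j" if "j \<in> {1..r}" for j
    using yz(2) that by auto
  have "(\<Sum>j=1..r. E i ** z j ** E i) = 0"
    by (intro sum.neutral ballI Lblk_eblk(1)[OF zL])
  moreover have "(\<Sum>j=1..r. E i ** y j ** E i) = (\<Sum>j=1..r. if j = i then y i else 0)"
    by (intro sum.cong refl) (simp add: Mblk_eblk[OF yM])
  ultimately have "E i ** x ** E i = y i"
    using i by (simp add: yz(1) mm.add_left mm.add_right mm.sum_left mm.sum_right)
  then show ?thesis using yz(2) i by simp
qed

text \<open>(Z1) polarised at \<open>z\<close> and \<open>c\<close>. The lower part of
  \<open>z\<close> is \<open>z ** E i\<close>, and \<open>E i\<close> is absorbed by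
  \<open>c\<close>, so the mixed product is \<open>z ** c\<close> and its transpose is
  \<open>c ** z\<close>.\<close>

lemma L_mult:
  assumes z: "z \<in> L i" and c: "c \<in> M i"
  shows "z ** c + c ** z \<in> L i"
proof -
  have zc: "blk a > blk b \<and> blk b = i" if "(z ** c) $ a $ b \<noteq> 0" for a b
  proof -
    obtain k where "z $ a $ k * c $ k $ b \<noteq> 0"
      using \<open>(z ** c) $ a $ b \<noteq> 0\<close> unfolding matrix_matrix_mult_def vec_lambda_beta
      by (meson sum.neutral)
    then have "z $ a $ k \<noteq> 0" "c $ k $ b \<noteq> 0" by auto
    moreover from this have "blk k = i \<and> blk b = i"
      using c by (simp add: Mblk_def)
    ultimately show ?thesis using z by (fastforce simp: Lblk_def)
  qed
  have trzc: "transpose (z ** c) = c ** z"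
    using z c by (simp add: matrix_transpose_mul symm_Z LZ MZ)
  have cz: "(c ** z) $ a $ b = (z ** c) $ b $ a" for a b
    by (simp add: transpose_def flip: trzc)
  have "BlockTri blk z ** transpose (BlockTri blk c) + BlockTri blk c ** transpose (BlockTri blk z) \<in> Z"
    using z c by (intro Z1_polar MZ LZ)
  also have lc: "BlockTri blk z ** transpose (BlockTri blk c) = z ** c"
    using z c by (simp add: BlockTri_Mblk Lblk_eblk symm_Z MZ Mblk_eblk flip: matrix_mul_assoc)
  also have "BlockTri blk c ** transpose (BlockTri blk z) = transpose (BlockTri blk z ** transpose (BlockTri blk c))"
    by (simp add: matrix_transpose_mul)
  also have "\<dots> = c ** z" by (simp only: lc trzc)
  finally have "z ** c + c ** z \<in> Z" .
  then show ?thesis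
    unfolding Lblk_def
  proof (intro CollectI conjI allI impI)
    fix a b assume "(z ** c + c ** z) $ a $ b \<noteq> 0"
    then have "(z ** c) $ a $ b \<noteq> 0 \<or> (z ** c) $ b $ a \<noteq> 0" by (auto simp: cz)
    then show "blk a > blk b \<and> blk b = i \<or> blk b > blk a \<and> blk a = i" using zc by blast
  qed
qed

text \<open>The lower part of \<open>u = w + (zc + cz)\<close> with \<open>w = byc + cyb\<close> is \<open>w + zc\<close>, and its Gram matrix
  differs from \<open>XX\<^sup>T\<close>, where \<open>X = wc + zc\<close>, by \<open>w\<^sup>2 - wcw\<close>.\<close>
lemma gram_Z:
  assumes y: "y \<in> M i" and z: "z \<in> L i" and b: "b \<in> M i" and c: "c \<in> M i"
    and cc: "c ** c = c" and bc: "b ** c = 0"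
  shows "(b ** y ** c + z ** c) ** transpose (b ** y ** c + z ** c) \<in> Z"
proof -
  have tr: "transpose y = y" "transpose z = z" "transpose b = b" "transpose c = c"
    using assms by (auto simp: symm_Z MZ LZ)
  define w where "w = b ** y ** c + c ** y ** b"
  have w: "w \<in> M i" unfolding w_def by (rule jordan.triple_M[OF b y c])
  have trw: "transpose w = w" using w by (simp add: symm_Z MZ)
  have ccA: "A ** c ** c = A ** c" for A
    by (simp add: cc flip: matrix_mul_assoc)
  have bcA: "A ** b ** c = 0" for A
    by (simp add: bc flip: matrix_mul_assoc)
  have wc: "w ** c = b ** y ** c"
    by (simp add: w_def mm.add_left ccA bcA)
  note zc = L_mult[OF z c]
  let ?u = "w + (z ** c + c ** z)"
  have cEi: "A ** c ** E i = A ** c" "c ** E i = c" for A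
    by (metis Mblk_eblk(1)[OF c] matrix_mul_assoc)+
  \<comment> \<open>The part \<open>c ** z\<close> lies in the block row \<open>i\<close>, right of
    the diagonal, since the diagonal block of \<open>z\<close> is zero. Hence
    \<open>BlockTri\<close> removes it and keeps \<open>z ** c\<close>.\<close>
  have "c ** z ** E i = c ** (E i ** z ** E i)"
    by (metis Mblk_eblk(1)[OF c] matrix_mul_assoc)
  then have "c ** z ** E i = 0" by (simp add: Lblk_eblk[OF z])
  then have "BlockTri blk ?u = w + z ** c"
    by (simp add: BlockTri_add[of _ w] BlockTri_Mblk[OF w] Lblk_eblk(2)[OF zc] mm.add_left cEi)
  moreover have "?u \<in> Z"
    by (intro subspace_add[OF subspace_Z] MZ[OF w] LZ[OF zc])
  ultimately have "(w + z ** c) ** transpose (w + z ** c) \<in> Z"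
    using Z1 by (metis condZ1_def)
  then have "(w + z ** c) ** transpose (w + z ** c) - w ** w + w ** c ** w \<in> Z"
    by (intro subspace_add[OF subspace_Z] subspace_diff[OF subspace_Z] MZ[OF M_square[OF w]]
        MZ[OF jordan.quad_M[OF w c]])
  also have "(w + z ** c) ** transpose (w + z ** c) - w ** w + w ** c ** w
      = (w ** c + z ** c) ** transpose (w ** c + z ** c)"
    by (simp add: transpose_add matrix_transpose_mul trw tr mm.add_left mm.add_right matrix_mul_assoc ccA)
  finally show ?thesis by (simp add: wc)
qed

end

text \<open>A proper idempotent \<open>e\<close> below \<open>c \<alpha>\<close> would split it into
  \<open>e\<close> and \<open>c \<alpha> - e\<close>. Putting \<open>e\<close> at position \<alpha>
  and the remainder at the new position \<open>Suc d\<close> gives a longer orthogonal family,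
  against the maximality of the frame.\<close>

lemma jordan_frame_primitive:
  assumes frame: "jordan_frame blk Z i d c" and \<alpha>: "\<alpha> \<in> {1..d}"
    and M: "subspace (Mblk blk Z i)"
    and e: "e \<in> Mblk blk Z i" "e ** e = e" "c \<alpha> ** e = e" "e ** c \<alpha> = e"
  shows "e = 0 \<or> e = c \<alpha>"
proof (rule ccontr)
  assume ne: "\<not> (e = 0 \<or> e = c \<alpha>)"
  have cc: "\<And>a b. a \<in> {1..d} \<Longrightarrow> b \<in> {1..d} \<Longrightarrow> c a ** c b = (if a = b then c a else 0)"
    and cM: "\<And>a. a \<in> {1..d} \<Longrightarrow> c a \<in> Mblk blk Z i \<and> c a \<noteq> 0"
    using frame by (auto simp: jordan_frame_def orth_idem_family_def)
  have ce: "c b ** e = 0" "e ** c b = 0" if "b \<in> {1..d}" "b \<noteq> \<alpha>" for b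
  proof -
    have "c b ** e = c b ** c \<alpha> ** e" by (metis e(3) matrix_mul_assoc)
    then show "c b ** e = 0" using that \<alpha> by (simp add: cc)
    have "e ** c b = e ** (c \<alpha> ** c b)" by (metis e(4) matrix_mul_assoc)
    then show "e ** c b = 0" using that \<alpha> by (simp add: cc)
  qed
  let ?c = "\<lambda>b. if b = \<alpha> then e else if b = Suc d then c \<alpha> - e else c b"
  have "orth_idem_family (Mblk blk Z i) (Suc d) ?c"
    unfolding orth_idem_family_def
  proof (intro conjI ballI)
    fix a assume "a \<in> {1..Suc d}"
    then show "?c a \<in> Mblk blk Z i" "?c a \<noteq> 0"
      using \<alpha> ne e(1) cM[OF \<alpha>] cM[of a] subspace_diff[OF M] by (auto simp: le_Suc_eq)
  next
    have trich: "a = \<alpha> \<or> a = Suc d \<and> a \<noteq> \<alpha> \<or> a \<in> {1..d} \<and> a \<noteq> \<alpha> \<and> a \<noteq> Suc d" if "a \<in> {1..Suc d}" for a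
      using that \<alpha> by auto
    fix a b assume "a \<in> {1..Suc d}" "b \<in> {1..Suc d}"
    from trich[OF this(1)] trich[OF this(2)] show "?c a ** ?c b = (if a = b then ?c a else 0)"
      by (elim disjE conjE) (use \<alpha> in \<open>simp_all add: mm.diff_left mm.diff_right e cc ce\<close>)
  qed
  then have "\<exists>k c'. k > d \<and> orth_idem_family (Mblk blk Z i) k c'"
    by (intro exI[of _ "Suc d"] exI[of _ ?c] conjI) simp_all
  then show False
    using frame by (simp add: jordan_frame_def)
qed

section \<open>The frames of all blocks as one Peirce frame\<close>

locale framed_block_space = block_space blk r Z
  for blk :: "'n::{finite,linorder} \<Rightarrow> nat" and r :: nat and Z :: "'n sqmat set" +
  fixes d :: "nat \<Rightarrow> nat" and c :: "nat \<Rightarrow> nat \<Rightarrow> 'n sqmat"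
  assumes frames: "i \<in> {1..r} \<Longrightarrow> jordan_frame blk Z i (d i) (c i)"
begin

definition K where "K = (SIGMA i:{1..r}. {1..d i})"
text \<open>Lists carry the lexicographic order.\<close>
abbreviation rk :: "nat \<times> nat \<Rightarrow> nat list" where "rk k \<equiv> [fst k, snd k]"
abbreviation ck where "ck k \<equiv> c (fst k) (snd k)"

lemma ck_M: "k \<in> K \<Longrightarrow> ck k \<in> M (fst k)" and ck_nonzero: "k \<in> K \<Longrightarrow> ck k \<noteq> 0"
  using frames by (fastforce simp: K_def jordan_frame_def orth_idem_family_def)+

lemma ck_E: "k \<in> K \<Longrightarrow> ck k ** E (fst k) = ck k" "k \<in> K \<Longrightarrow> E (fst k) ** ck k = ck k"
  using Mblk_eblk ck_M by blast+

lemma ck_mult: "k \<in> K \<Longrightarrow> l \<in> K \<Longrightarrow> ck k ** ck l = (if k = l then ck k else 0)"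
proof (cases "fst k = fst l")
  case True
  assume "k \<in> K" "l \<in> K"
  then show ?thesis
    using frames[of "fst k"] True by (auto simp: K_def jordan_frame_def orth_idem_family_def prod_eq_iff)
next
  case False
  assume kl: "k \<in> K" "l \<in> K"
  have "ck k ** ck l = ck k ** (E (fst k) ** E (fst l)) ** ck l"
    using ck_E kl by (metis matrix_mul_assoc)
  then show ?thesis using False by (auto simp: eblk_mult_eblk)
qed

lemma frame_sum: "i \<in> {1..r} \<Longrightarrow> (\<Sum>\<alpha>=1..d i. c i \<alpha>) = E i"
  using frames by (auto simp: jordan_frame_def)

lemma sum_E: "(\<Sum>i\<in>I. E i) = (\<chi> a b. if a = b \<and> blk a \<in> I then 1 else 0)" if "finite I"
proof -
  have "(\<Sum>i\<in>I. E i $ a $ b) = (\<Sum>i\<in>I. if i = blk a then (if a = b then 1 else 0) else 0)" for a b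
    by (intro sum.cong) (auto simp: eblk_def)
  then show ?thesis using that by (auto simp: vec_eq_iff)
qed

lemma ck_sum: "(\<Sum>k\<in>K. ck k) = mat 1"
proof -
  have "(\<Sum>k\<in>K. ck k) = (\<Sum>i=1..r. \<Sum>\<alpha>=1..d i. c i \<alpha>)"
    unfolding K_def by (subst sum.Sigma) (auto simp: split_def)
  also have "\<dots> = (\<Sum>i=1..r. E i)"
    by (intro sum.cong refl frame_sum) auto
  also have "\<dots> = mat 1"
    unfolding sum_E[OF finite_atLeastAtMost] using blk_range by (auto simp: mat_def vec_eq_iff)
  finally show ?thesis .
qed

lemma above_ck:
  assumes "k \<in> K"
  shows "above ck K rk k = (\<Sum>\<beta>\<in>{snd k<..d (fst k)}. c (fst k) \<beta>) + (\<Sum>j\<in>{fst k<..r}. E j)"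
proof -
  let ?A = "Pair (fst k) ` {snd k<..d (fst k)}" and ?B = "SIGMA j:{fst k<..r}. {1..d j}"
  have "{l\<in>K. rk k < rk l} = ?A \<union> ?B"
    using assms by (auto simp: K_def)
  then have "above ck K rk k = (\<Sum>l\<in>?A. ck l) + (\<Sum>l\<in>?B. ck l)"
    unfolding above_def by (auto intro!: sum.union_disjoint)
  also have "(\<Sum>l\<in>?A. ck l) = (\<Sum>\<beta>\<in>{snd k<..d (fst k)}. c (fst k) \<beta>)"
    by (subst sum.reindex) (auto simp: inj_on_def)
  also have "(\<Sum>l\<in>?B. ck l) = (\<Sum>j\<in>{fst k<..r}. \<Sum>\<alpha>=1..d j. c j \<alpha>)"
    by (subst sum.Sigma) (auto simp: split_def)
  also have "\<dots> = (\<Sum>j\<in>{fst k<..r}. E j)"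
    by (intro sum.cong refl frame_sum) auto
  finally show ?thesis .
qed

abbreviation cgt where "cgt k \<equiv> (\<Sum>\<beta>\<in>{snd k<..d (fst k)}. c (fst k) \<beta>)"

lemma cgt_M: "k \<in> K \<Longrightarrow> cgt k \<in> M (fst k)"
proof (intro subspace_sum[OF subspace_M])
  fix \<beta> assume "k \<in> K" "\<beta> \<in> {snd k<..d (fst k)}"
  then show "c (fst k) \<beta> \<in> M (fst k)"
    using ck_M[of "(fst k, \<beta>)"] by (auto simp: K_def)
qed

lemma cgt_ck: "k \<in> K \<Longrightarrow> cgt k ** ck k = 0"
  unfolding mm.sum_left
proof (intro sum.neutral ballI)
  fix \<beta> assume "k \<in> K" "\<beta> \<in> {snd k<..d (fst k)}"
  then show "c (fst k) \<beta> ** ck k = 0"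
    using ck_mult[of "(fst k, \<beta>)" k] by (auto simp: K_def prod_eq_iff split: if_splits)
qed

lemma upper_blocks_mult:
  assumes z: "z \<in> L j"
  shows "(\<Sum>j\<in>{i<..r}. E j) ** z ** E i = (if j = i then z ** E i else 0)"
proof -
  have "((\<Sum>j\<in>{i<..r}. E j) ** z) $ a $ b = (\<Sum>k\<in>UNIV. if k = a then (if blk a > i then z $ a $ b else 0) else 0)" for a b
    unfolding sum_E[OF finite_greaterThanAtMost] matrix_matrix_mult_def vec_lambda_beta
    using blk_range[of a] by (intro sum.cong) auto
  then have "((\<Sum>j\<in>{i<..r}. E j) ** z) $ a $ b = (if blk a > i then z $ a $ b else 0)" for a b
    by simp
  then show ?thesis
    using z by (fastforce simp: vec_eq_iff mult_eblk Lblk_def)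
qed

lemma above_mult_M:
  assumes k: "k \<in> K" and y: "y \<in> M j"
  shows "above ck K rk k ** y ** ck k = (if j = fst k then cgt k ** y ** ck k else 0)"
proof (cases "j = fst k")
  case True
  have "(\<Sum>j\<in>{fst k<..r}. E j) ** y = 0"
    unfolding mm.sum_left using True by (intro sum.neutral ballI Mblk_eblk(4)[OF y]) auto
  then show ?thesis using True by (simp add: above_ck[OF k] mm.add_left)
next
  case False
  have "y ** ck k = y ** E (fst k) ** ck k"
    by (metis ck_E(2)[OF k] matrix_mul_assoc)
  also have "\<dots> = 0" using False Mblk_eblk(3)[OF y, of "fst k"] by simp
  finally show ?thesis using False by (simp flip: matrix_mul_assoc)
qed

lemma above_mult_L:
  assumes k: "k \<in> K" and z: "z \<in> L j"
  shows "above ck K rk k ** z ** ck k = (if j = fst k then z ** ck k else 0)"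
proof -
  have Ec: "A ** ck k = A ** E (fst k) ** ck k" for A
    by (metis ck_E(2)[OF k] matrix_mul_assoc)
  have "cgt k ** z ** ck k = cgt k ** (E (fst k) ** z ** E (fst k)) ** ck k"
    by (metis ck_E(2)[OF k] Mblk_eblk(1)[OF cgt_M[OF k]] matrix_mul_assoc)
  then have "cgt k ** z ** ck k = 0" by (simp add: Lblk_eblk[OF z])
  moreover have "(\<Sum>j\<in>{fst k<..r}. E j) ** z ** ck k = (if j = fst k then z ** ck k else 0)"
    unfolding Ec[of "_ ** z"] upper_blocks_mult[OF z] by (simp flip: Ec)
  ultimately show ?thesis by (simp add: above_ck[OF k] mm.add_left)
qed

text \<open>The right factor selects columns of block i and the left factor the rows after (i,
  \<alpha>), so only the components of x in M_i and L_i survive, the latter without a left factor.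
  Conversely, a pair y, z is realised by the single element x = y + z.\<close>

lemma colspace_eq_hsp:
  assumes k: "k \<in> K"
  shows "colspace Z ck K rk k = hsp blk Z (fst k) (d (fst k)) (c (fst k)) (snd k)"
proof (intro equalityI subsetI)
  fix X assume "X \<in> colspace Z ck K rk k"
  then obtain x where x: "x \<in> Z" "X = above ck K rk k ** x ** ck k"
    by (auto simp: colspace_def)
  obtain y z where yz: "x = (\<Sum>i=1..r. y i) + (\<Sum>i=1..r. z i)"
    "\<forall>i\<in>{1..r}. y i \<in> M i \<and> z i \<in> L i"
    by (rule Z_decomp[OF x(1)])
  have yM: "y j \<in> M j" and zL: "z j \<in> L j" if "j \<in> {1..r}" for j
    using yz(2) that by auto
  have i: "fst k \<in> {1..r}" using k by (auto simp: K_def)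
  have "X = (\<Sum>j=1..r. above ck K rk k ** y j ** ck k) + (\<Sum>j=1..r. above ck K rk k ** z j ** ck k)"
    by (simp add: x(2) yz(1) mm.add_left mm.add_right mm.sum_left mm.sum_right)
  also have "(\<Sum>j=1..r. above ck K rk k ** y j ** ck k)
      = (\<Sum>j=1..r. if j = fst k then cgt k ** y (fst k) ** ck k else 0)"
    by (intro sum.cong refl) (simp add: above_mult_M[OF k yM])
  also have "(\<Sum>j=1..r. above ck K rk k ** z j ** ck k)
      = (\<Sum>j=1..r. if j = fst k then z (fst k) ** ck k else 0)"
    by (intro sum.cong refl) (simp add: above_mult_L[OF k zL])
  finally have "X = cgt k ** y (fst k) ** ck k + z (fst k) ** ck k"
    using i by simp
  then show "X \<in> hsp blk Z (fst k) (d (fst k)) (c (fst k)) (snd k)"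
    unfolding hsp_def using yM[OF i] zL[OF i] by blast
next
  fix X assume "X \<in> hsp blk Z (fst k) (d (fst k)) (c (fst k)) (snd k)"
  then obtain y z where yz: "y \<in> M (fst k)" "z \<in> L (fst k)" "X = cgt k ** y ** ck k + z ** ck k"
    by (auto simp: hsp_def)
  then have "X = above ck K rk k ** (y + z) ** ck k"
    by (simp add: mm.add_left mm.add_right above_mult_M[OF k] above_mult_L[OF k])
  moreover have "y + z \<in> Z" using yz by (intro subspace_add[OF subspace_Z] MZ LZ)
  ultimately show "X \<in> colspace Z ck K rk k" by (auto simp: colspace_def)
qed

sublocale peirce: peirce_frame Z K rk ck
proof
  show "subspace Z" by (fact subspace_Z)
  show "transpose x = x" if "x \<in> Z" for x using that by (rule symm_Z)
  show "finite K" by (simp add: K_def)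
  show "inj_on rk K" by (auto simp: inj_on_def prod_eq_iff)
  show "ck k \<in> Z" if "k \<in> K" for k using ck_M[OF that] by (rule MZ)
  show "ck k \<noteq> 0" if "k \<in> K" for k using that by (rule ck_nonzero)
  show "ck k ** ck l = (if k = l then ck k else 0)" if "k \<in> K" "l \<in> K" for k l
    using that by (rule ck_mult)
  show "(\<Sum>k\<in>K. ck k) = mat 1" by (rule ck_sum)
next
  fix x k assume x: "x \<in> Z" and k: "k \<in> K"
  have i: "fst k \<in> {1..r}" "snd k \<in> {1..d (fst k)}" using k by (auto simp: K_def)
  \<comment> \<open>\<open>ck k\<close> sees only one diagonal block of \<open>x\<close>.
    Compressing to it first moves the claim into the Jordan algebra \<open>M (fst k)\<close>, where
    the frame is maximal.\<close>
  have "\<exists>s. ck k ** (E (fst k) ** x ** E (fst k)) ** ck k = s *\<^sub>R ck k"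
    using jordan_frame_primitive[OF frames[OF i(1)] i(2) subspace_M]
    by (intro jordan.primitive_imp_scalar[of _ "fst k"] compress_M i x ck_M ck_nonzero k) (auto simp: ck_mult k)
  then show "\<exists>s. ck k ** x ** ck k = s *\<^sub>R ck k"
    by (metis ck_E[OF k] matrix_mul_assoc)
next
  fix k X assume k: "k \<in> K" and "X \<in> colspace Z ck K rk k"
  then obtain y z where yz: "y \<in> M (fst k)" "z \<in> L (fst k)" "X = cgt k ** y ** ck k + z ** ck k"
    by (auto simp: colspace_eq_hsp hsp_def)
  have "X + transpose X = (cgt k ** y ** ck k + ck k ** y ** cgt k) + (z ** ck k + ck k ** z)"
    by (simp add: yz(3) transpose_add matrix_transpose_mul symm_Z[OF MZ[OF cgt_M[OF k]]]
        symm_Z[OF MZ[OF ck_M[OF k]]] symm_Z[OF MZ[OF yz(1)]] symm_Z[OF LZ[OF yz(2)]] matrix_mul_assoc)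
  also have "\<dots> \<in> Z"
    by (rule subspace_add[OF subspace_Z MZ[OF jordan.triple_M[OF cgt_M[OF k] yz(1) ck_M[OF k]]]
          LZ[OF L_mult[OF yz(2) ck_M[OF k]]]])
  finally show "X + transpose X \<in> Z" .
  show "X ** transpose X \<in> Z"
    unfolding yz(3) by (rule gram_Z[OF yz(1,2) cgt_M[OF k] ck_M[OF k]]) (simp_all add: ck_mult cgt_ck k)
qed

end

section \<open>Triangular substitutions\<close>

lemma nn_integral_incseq:
  fixes f :: "'a \<Rightarrow> ennreal"
  assumes [measurable]: "f \<in> borel_measurable M" "\<And>n. A n \<in> sets M" and "incseq A"
  shows "(\<integral>\<^sup>+x. f x * indicator (\<Union>n. A n) x \<partial>M) = (SUP n. \<integral>\<^sup>+x. f x * indicator (A n) x \<partial>M)"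
proof -
  have "(SUP n. emeasure (density M f) (A n)) = emeasure (density M f) (\<Union>n. A n)"
    by (rule SUP_emeasure_incseq) (use assms in auto)
  then show ?thesis by (simp add: emeasure_density)
qed

text \<open>Integrates out one diagonal coordinate. The image of s > 0 is y > b, hence the
  assumption on \<open>h\<close>. Substitution on [0, n] and monotone convergence give the
  half-line.\<close>

lemma nn_integral_square_substitution:
  fixes h :: "real \<Rightarrow> ennreal" and a b :: real
  assumes [measurable]: "h \<in> borel_measurable borel" and a: "a > 0"
    and zero: "\<And>y. y \<le> b \<Longrightarrow> h y = 0"
  shows "(\<integral>\<^sup>+y. h y \<partial>lborel) = (\<integral>\<^sup>+s. ennreal (2 * a * s) * indicator {0<..} s * h (a * s\<^sup>2 + b) \<partial>lborel)"
proof -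
  let ?g = "\<lambda>s::real. a * s\<^sup>2 + b"
  have mono: "?g (real m) \<le> ?g (real n)" if "m \<le> n" for m n
    using that a by (auto intro!: mult_left_mono power_mono)
  have U1: "(\<Union>n. {b..?g (real n)}) = {b..}"
  proof -
    have "\<exists>n. y \<le> ?g (real n)" for y
    proof -
      obtain n :: nat where n: "max 1 ((y - b) / a) \<le> real n" using real_arch_simple by blast
      then have "(y - b) / a \<le> real n" "real n \<le> (real n)\<^sup>2" by (auto simp: power2_eq_square)
      then have "(y - b) / a \<le> (real n)\<^sup>2" by linarith
      then show ?thesis using a by (auto simp: field_simps intro!: exI[of _ n])
    qed
    then show ?thesis by auto
  qed
  have U2: "(\<Union>n. {0..real n}) = {0..}"
    by (auto simp: real_arch_simple)
  have "(\<integral>\<^sup>+y. h y \<partial>lborel) = (\<integral>\<^sup>+y. h y * indicator (\<Union>n. {b..?g (real n)}) y \<partial>lborel)"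
    unfolding U1 by (intro nn_integral_cong) (auto simp: zero split: split_indicator)
  also have "\<dots> = (SUP n. \<integral>\<^sup>+y. h y * indicator {b..?g (real n)} y \<partial>lborel)"
    using mono by (intro nn_integral_incseq) (auto simp: incseq_def dest: order_trans)
  also have "\<dots> = (SUP n. \<integral>\<^sup>+s. (h (?g s) * ennreal (2 * a * s)) * indicator {0..real n} s \<partial>lborel)"
  proof (intro SUP_cong refl)
    fix n :: nat
    show "(\<integral>\<^sup>+y. h y * indicator {b..?g (real n)} y \<partial>lborel)
        = (\<integral>\<^sup>+s. (h (?g s) * ennreal (2 * a * s)) * indicator {0..real n} s \<partial>lborel)"
    \<comment> \<open>The interval rule is applied to a nondegenerate interval. For n = 0 both
      integrands vanish identically: \<open>h b = 0\<close> on the left, and the weight at s = 0 on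
      the right.\<close>
    proof (cases "n = 0")
      case True
      have z1: "h y * indicator {b..?g (real n)} y = 0" for y
        using True by (auto simp: zero split: split_indicator)
      have z2: "(h (?g s) * ennreal (2 * a * s)) * indicator {0..real n} s = 0" for s
        using True by (auto split: split_indicator)
      show ?thesis by (simp only: z1 z2)
    next
      case False
      have "(\<integral>\<^sup>+y. h y * indicator {?g 0..?g (real n)} y \<partial>lborel)
        = (\<integral>\<^sup>+s. h (?g s) * ennreal (2 * a * s) * indicator {0..real n} s \<partial>lborel)"
        using False a by (intro nn_integral_substitution_aux)
          (auto intro!: derivative_eq_intros continuous_intros)
      then show ?thesis by simp
    qed
  qed
  also have "\<dots> = (\<integral>\<^sup>+s. (h (?g s) * ennreal (2 * a * s)) * indicator (\<Union>n. {0..real n}) s \<partial>lborel)"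
    by (intro nn_integral_incseq[symmetric]) (auto simp: incseq_def)
  also have "\<dots> = (\<integral>\<^sup>+s. ennreal (2 * a * s) * indicator {0<..} s * h (?g s) \<partial>lborel)"
    unfolding U2 by (intro nn_integral_cong) (auto split: split_indicator simp: mult.commute)
  finally show ?thesis .
qed

interpretation lborel_product: product_sigma_finite "\<lambda>_. lborel :: real measure"
  by unfold_locales

abbreviation lebPi :: "'j set \<Rightarrow> ('j \<Rightarrow> real) measure" where
  "lebPi I \<equiv> PiM I (\<lambda>_. lborel)"

text \<open>The coordinates are substituted one at a time, the last one innermost. The support of
  \<open>g\<close> lies in the image of the substitution, so the integrals can run over the whole space on
  the left-hand side.\<close>

lemma nn_integral_triangular_substitution:
  fixes I :: "'j set" and rk :: "'j \<Rightarrow> 'o::linorder" and \<phi> :: "'j \<Rightarrow> ('j \<Rightarrow> real) \<Rightarrow> real"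
    and W :: "'j \<Rightarrow> ('j \<Rightarrow> real) \<Rightarrow> ennreal" and g :: "('j \<Rightarrow> real) \<Rightarrow> ennreal"
  assumes fin: "finite I" and inj_rk: "inj_on rk I"
    and dep: "\<And>j u u'. j \<in> I \<Longrightarrow> (\<And>i. i \<in> I \<Longrightarrow> rk i \<le> rk j \<Longrightarrow> u i = u' i) \<Longrightarrow> \<phi> j u = \<phi> j u' \<and> W j u = W j u'"
    and meas: "\<And>j. j \<in> I \<Longrightarrow> \<phi> j \<in> borel_measurable (lebPi I)" "\<And>j. j \<in> I \<Longrightarrow> W j \<in> borel_measurable (lebPi I)"
    and inj: "\<And>j u u'. j \<in> I \<Longrightarrow> (\<And>i. i \<in> I \<Longrightarrow> rk i < rk j \<Longrightarrow> u i = u' i) \<Longrightarrow>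
        W j u \<noteq> 0 \<Longrightarrow> W j u' \<noteq> 0 \<Longrightarrow> \<phi> j u = \<phi> j u' \<Longrightarrow> u j = u' j"
    and subst1: "\<And>j u h. j \<in> I \<Longrightarrow> h \<in> borel_measurable borel \<Longrightarrow>
        (\<And>i. i \<in> I \<Longrightarrow> rk i < rk j \<Longrightarrow> W i u \<noteq> 0) \<Longrightarrow>
        (\<And>y. h y \<noteq> 0 \<Longrightarrow> \<exists>s. W j (u(j := s)) \<noteq> 0 \<and> \<phi> j (u(j := s)) = y) \<Longrightarrow>
        (\<integral>\<^sup>+y. h y \<partial>lborel) = (\<integral>\<^sup>+s. W j (u(j := s)) * h (\<phi> j (u(j := s))) \<partial>lborel)"
    and g: "g \<in> borel_measurable (lebPi I)"
      "\<And>v. v \<in> space (lebPi I) \<Longrightarrow> g v \<noteq> 0 \<Longrightarrow> \<exists>u. \<forall>j\<in>I. W j u \<noteq> 0 \<and> \<phi> j u = v j"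
  shows "(\<integral>\<^sup>+v. g v \<partial>lebPi I) = (\<integral>\<^sup>+u. (\<Prod>j\<in>I. W j u) * g (\<lambda>j\<in>I. \<phi> j u) \<partial>lebPi I)"
proof -
  \<comment> \<open>Initial segments of \<open>I\<close>: on them the functions \<phi> and
    \<open>W\<close> depend on no coordinate outside, so the induction can work with the product
    measure over the segment alone.\<close>
  define down where "down A \<longleftrightarrow> A \<subseteq> I \<and> (\<forall>j\<in>A. \<forall>i\<in>I. rk i \<le> rk j \<longrightarrow> i \<in> A)" for A
  have meas_down: "f \<in> borel_measurable (lebPi A)"
    if A: "down A" and j: "j \<in> A" and f: "f \<in> borel_measurable (lebPi I)"
      and fdep: "\<And>u u'. (\<And>i. i \<in> I \<Longrightarrow> rk i \<le> rk j \<Longrightarrow> u i = u' i) \<Longrightarrow> f u = f u'"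
    for A j and f :: "('j \<Rightarrow> real) \<Rightarrow> 'z::topological_space"
  proof -
    \<comment> \<open>Missing coordinates are filled with 0, which does not change \<open>f\<close>,
      as it depends only on coordinates up to \<open>j\<close>.\<close>
    have "f u = f (\<lambda>i\<in>I. if i \<in> A then u i else 0)" for u
      using A j by (intro fdep) (auto simp: down_def)
    moreover have "(\<lambda>u. f (\<lambda>i\<in>I. if i \<in> A then u i else 0)) \<in> borel_measurable (lebPi A)"
    proof (rule measurable_compose[OF _ f])
      show "(\<lambda>u. \<lambda>i\<in>I. if i \<in> A then u i else 0) \<in> lebPi A \<rightarrow>\<^sub>M lebPi I"
      proof (rule measurable_restrict)
        fix i show "(\<lambda>u. if i \<in> A then u i else 0) \<in> lebPi A \<rightarrow>\<^sub>M lborel"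
          by (cases "i \<in> A") auto
      qed
    qed
    ultimately show ?thesis by simp
  qed
  \<comment> \<open>Where the weights are nonzero the substitution is injective: at a differing
    coordinate of least rank the one-dimensional injectivity would be violated.\<close>
  have unique: "u j = u' j"
    if A: "down A" and j: "j \<in> A"
      and W: "\<And>i. i \<in> A \<Longrightarrow> W i u \<noteq> 0" "\<And>i. i \<in> A \<Longrightarrow> W i u' \<noteq> 0" and \<phi>: "\<And>i. i \<in> A \<Longrightarrow> \<phi> i u = \<phi> i u'"
    for A j u u'
  proof (rule ccontr)
    assume "u j \<noteq> u' j"
    let ?B = "{i\<in>A. u i \<noteq> u' i}"
    have "finite A" using A fin finite_subset by (auto simp: down_def)
    then have "finite ?B" "?B \<noteq> {}" using j \<open>u j \<noteq> u' j\<close> by auto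
    then obtain k where k: "k \<in> ?B" "\<And>i. i \<in> ?B \<Longrightarrow> rk k \<le> rk i"
      using ex_is_arg_min_if_finite[of ?B rk] by (auto simp: is_arg_min_linorder)
    have "u k = u' k"
    proof (rule inj)
      show "k \<in> I" using k A by (auto simp: down_def)
      show "u i = u' i" if "i \<in> I" "rk i < rk k" for i
        using that k A by (force simp: down_def)
    qed (use k W \<phi> in auto)
    then show False using k by simp
  qed
  have main: "down A \<Longrightarrow> g \<in> borel_measurable (lebPi A) \<Longrightarrow>
      (\<And>v. v \<in> space (lebPi A) \<Longrightarrow> g v \<noteq> 0 \<Longrightarrow> \<exists>u. \<forall>j\<in>A. W j u \<noteq> 0 \<and> \<phi> j u = v j) \<Longrightarrow>
      (\<integral>\<^sup>+v. g v \<partial>lebPi A) = (\<integral>\<^sup>+u. (\<Prod>j\<in>A. W j u) * g (\<lambda>j\<in>A. \<phi> j u) \<partial>lebPi A)"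
    if "finite A" for A and g :: "('j \<Rightarrow> real) \<Rightarrow> ennreal"
    using that
  proof (induction A arbitrary: g rule: finite_ranking_induct[where f = rk])
    case empty
    then show ?case by (simp add: PiM_empty nn_integral_count_space_finite)
  next
    case (insert b A)
    show ?case
    proof (cases "b \<in> A")
      case True
      then show ?thesis using insert by (simp add: insert_absorb)
    next
      case False
      let ?A' = "insert b A"
      note down' = insert.prems(1) and g_meas[measurable] = insert.prems(2) and g_supp = insert.prems(3)
      have bI: "b \<in> I" and AI: "A \<subseteq> I" using down' by (auto simp: down_def)
      have ltb: "rk j < rk b" if "j \<in> A" for j
        using insert.hyps(2)[OF that] that bI AI False inj_rk by (metis inj_onD order_le_less subsetD)
      have downA: "down A"
        using down' ltb unfolding down_def by (metis insertE insert_iff not_less subset_insertI subset_trans)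
      have dep_b: "\<phi> j (u(b := s)) = \<phi> j u" "W j (u(b := s)) = W j u" if "j \<in> A" for j u s
      proof -
        have "\<phi> j (u(b := s)) = \<phi> j u \<and> W j (u(b := s)) = W j u"
          by (rule dep) (use that ltb[OF that] AI in auto)
        then show "\<phi> j (u(b := s)) = \<phi> j u" "W j (u(b := s)) = W j u" by auto
      qed
      have m\<phi>[measurable]: "\<phi> j \<in> borel_measurable (lebPi ?A')" and mW[measurable]: "W j \<in> borel_measurable (lebPi ?A')"
        if "j \<in> ?A'" for j
        using that down' dep[of j] meas[of j] by (auto intro!: meas_down[of ?A' j] simp: down_def)
      \<comment> \<open>The last coordinate is integrated out on the target side. \<open>G\<close>
        inherits the support condition, since \<open>G v \<noteq> 0\<close> forces
        \<open>g (v(b := y)) \<noteq> 0\<close> for some \<open>y\<close>.\<close>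
      define G where "G v = (\<integral>\<^sup>+y. g (v(b := y)) \<partial>lborel)" for v
      have upd[measurable]: "(\<lambda>(v, y). v(b := y)) \<in> lebPi A \<Otimes>\<^sub>M lborel \<rightarrow>\<^sub>M lebPi ?A'"
        by (rule measurable_add_dim)
      have G_meas: "G \<in> borel_measurable (lebPi A)"
        unfolding G_def using measurable_compose[OF upd g_meas] by (simp add: split_def)
      have supp_G: "\<exists>u. \<forall>j\<in>A. W j u \<noteq> 0 \<and> \<phi> j u = v j" if v: "v \<in> space (lebPi A)" and "G v \<noteq> 0" for v
      proof -
        have "\<exists>y. g (v(b := y)) \<noteq> 0"
          using \<open>G v \<noteq> 0\<close> by (auto simp: G_def intro: ccontr)
        then obtain y where y: "g (v(b := y)) \<noteq> 0" by blast
        have "v(b := y) \<in> space (lebPi ?A')"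
          using v by (auto simp: space_PiM PiE_def extensional_def)
        from g_supp[OF this y] show ?thesis using False by (metis fun_upd_other insertCI)
      qed
      define F where "F u = (\<Prod>j\<in>?A'. W j u) * g (\<lambda>j\<in>?A'. \<phi> j u)" for u
      have F_meas: "F \<in> borel_measurable (lebPi ?A')"
        unfolding F_def by (intro borel_measurable_times_ennreal borel_measurable_prod_ennreal mW
            measurable_compose[OF _ g_meas] measurable_restrict m\<phi>) auto
      have "(\<integral>\<^sup>+v. g v \<partial>lebPi ?A') = (\<integral>\<^sup>+v. G v \<partial>lebPi A)"
        unfolding G_def using insert.hyps(1) False
        by (intro lborel_product.product_nn_integral_insert) auto
      also have "\<dots> = (\<integral>\<^sup>+u. (\<Prod>j\<in>A. W j u) * G (\<lambda>j\<in>A. \<phi> j u) \<partial>lebPi A)"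
        by (rule insert.IH[OF downA G_meas supp_G])
      also have "\<dots> = (\<integral>\<^sup>+u. (\<integral>\<^sup>+s. F (u(b := s)) \<partial>lborel) \<partial>lebPi A)"
      proof (rule nn_integral_cong)
        fix u assume u: "u \<in> space (lebPi A)"
        let ?v = "\<lambda>j\<in>A. \<phi> j u"
        have v: "?v \<in> space (lebPi A)" by (auto simp: space_PiM)
        have v_upd: "?v(b := \<phi> b (u(b := s))) = (\<lambda>j\<in>?A'. \<phi> j (u(b := s)))" for s
          using False by (auto simp: dep_b fun_eq_iff)
        have prod: "(\<Prod>j\<in>?A'. W j (u(b := s))) = W b (u(b := s)) * (\<Prod>j\<in>A. W j u)" for s
          using insert.hyps(1) False by (simp add: dep_b)
        have um[measurable]: "(\<lambda>s. u(b := s)) \<in> lborel \<rightarrow>\<^sub>M lebPi ?A'"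
          by (rule measurable_component_update[OF u False])
        have vm[measurable]: "(\<lambda>s. ?v(b := s)) \<in> lborel \<rightarrow>\<^sub>M lebPi ?A'"
          by (rule measurable_component_update[OF v False])
        have h_meas: "(\<lambda>y. g (?v(b := y))) \<in> borel_measurable borel"
          using measurable_compose[OF vm g_meas] by simp
        show "(\<Prod>j\<in>A. W j u) * G ?v = (\<integral>\<^sup>+s. F (u(b := s)) \<partial>lborel)"
        proof (cases "\<forall>j\<in>A. W j u \<noteq> 0")
          case False
          then have "(\<Prod>j\<in>A. W j u) = 0" using insert.hyps(1) by auto
          then show ?thesis unfolding F_def prod by (simp only: mult_zero_left mult_zero_right nn_integral_const)
        next
          case True
          have "G ?v = (\<integral>\<^sup>+s. W b (u(b := s)) * g (?v(b := \<phi> b (u(b := s)))) \<partial>lborel)"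
            unfolding G_def
          proof (rule subst1[OF bI h_meas])
            show "W i u \<noteq> 0" if "i \<in> I" "rk i < rk b" for i
              using that True down' by (auto simp: down_def)
            fix y assume y: "g (?v(b := y)) \<noteq> 0"
            have "?v(b := y) \<in> space (lebPi ?A')" by (auto simp: space_PiM PiE_def extensional_def)
            from g_supp[OF this y] obtain u' where
              u': "\<And>j. j \<in> ?A' \<Longrightarrow> W j u' \<noteq> 0 \<and> \<phi> j u' = (?v(b := y)) j" by blast
            \<comment> \<open>The support condition supplies a preimage \<open>u'\<close> that is
              unrelated to the fixed \<open>u\<close>. By injectivity the two agree on
              \<open>A\<close>, so \<open>s = u' b\<close> is the preimage of \<open>y\<close> over
              \<open>u\<close>.\<close>
            have "u j = u' j" if "j \<in> A" for j
            proof (rule unique[OF downA that])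
              fix i assume i: "i \<in> A"
              then have "i \<noteq> b" using \<open>b \<notin> A\<close> by blast
              then show "W i u' \<noteq> 0" "\<phi> i u = \<phi> i u'" using u'[of i] i by auto
            qed (use True in auto)
            moreover have "i \<in> A" if "i \<in> I" "rk i \<le> rk b" "i \<noteq> b" for i
              using down' that by (auto simp: down_def)
            ultimately have "\<phi> b (u(b := u' b)) = \<phi> b u' \<and> W b (u(b := u' b)) = W b u'"
              by (intro dep bI) auto
            then show "\<exists>s. W b (u(b := s)) \<noteq> 0 \<and> \<phi> b (u(b := s)) = y"
              using u'[of b] by (intro exI[of _ "u' b"]) simp
          qed
          then have "(\<Prod>j\<in>A. W j u) * G ?v
              = (\<Prod>j\<in>A. W j u) * (\<integral>\<^sup>+s. W b (u(b := s)) * g (?v(b := \<phi> b (u(b := s)))) \<partial>lborel)"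
            by simp
          also have "\<dots> = (\<integral>\<^sup>+s. (\<Prod>j\<in>A. W j u) * (W b (u(b := s)) * g (?v(b := \<phi> b (u(b := s))))) \<partial>lborel)"
          proof (rule nn_integral_cmult[symmetric])
            have "(\<lambda>s. \<phi> b (u(b := s))) \<in> borel_measurable lborel" "(\<lambda>s. W b (u(b := s))) \<in> borel_measurable lborel"
              by (rule measurable_compose[OF um m\<phi>] measurable_compose[OF um mW]; simp)+
            then show "(\<lambda>s. W b (u(b := s)) * g (?v(b := \<phi> b (u(b := s))))) \<in> borel_measurable lborel"
              using measurable_compose[OF _ h_meas, of "\<lambda>s. \<phi> b (u(b := s))" lborel]
              by (intro borel_measurable_times_ennreal) auto
          qed
          also have "\<dots> = (\<integral>\<^sup>+s. F (u(b := s)) \<partial>lborel)"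
            by (simp only: F_def prod v_upd mult_ac)
          finally show ?thesis .
        qed
      qed
      also have "\<dots> = (\<integral>\<^sup>+u. F u \<partial>lebPi ?A')"
        using insert.hyps(1) False F_meas
        by (intro lborel_product.product_nn_integral_insert[symmetric]) auto
      finally show ?thesis by (simp only: F_def)
    qed
  qed
  show ?thesis
    by (rule main[OF fin _ g]) (auto simp: down_def)
qed

section \<open>Lebesgue measure of a subspace\<close>

text \<open>A reflection acts on each coordinate separately, so it is a triangular substitution with
  all weights 1, and any injective ranking serves.\<close>

lemma nn_integral_lebPi_reflect:
  assumes fin: "finite I" and F: "F \<in> borel_measurable (lebPi I)"
  shows "(\<integral>\<^sup>+v. F (\<lambda>i\<in>I. w i - v i) \<partial>lebPi I) = (\<integral>\<^sup>+v. F v \<partial>lebPi I)"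
proof -
  obtain rk :: "'a \<Rightarrow> nat" where rk: "inj_on rk I"
    using finite_imp_inj_to_nat_seg[OF fin] by metis
  have "(\<integral>\<^sup>+v. F v \<partial>lebPi I) = (\<integral>\<^sup>+u. (\<Prod>j\<in>I. 1) * F (\<lambda>i\<in>I. w i - u i) \<partial>lebPi I)"
  proof (rule nn_integral_triangular_substitution[OF fin rk])
    fix j u and h :: "real \<Rightarrow> ennreal"
    assume h: "h \<in> borel_measurable borel"
    show "(\<integral>\<^sup>+y. h y \<partial>lborel) = (\<integral>\<^sup>+s. 1 * h (w j - (u(j := s)) j) \<partial>lborel)"
      using nn_integral_real_affine[OF h, of "-1" "w j"] by simp
  next
    fix v :: "'a \<Rightarrow> real"
    show "\<exists>u. \<forall>j\<in>I. (1::ennreal) \<noteq> 0 \<and> w j - u j = v j"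
      by (rule exI[of _ "\<lambda>j. w j - v j"]) simp
  qed (use F in auto)
  then show ?thesis by simp
qed

section \<open>Orthonormal coordinates and independence of the basis\<close>

definition orthonormal_family :: "'i set \<Rightarrow> ('i \<Rightarrow> 'a::real_inner) \<Rightarrow> bool" where
  "orthonormal_family I B \<longleftrightarrow> (\<forall>i\<in>I. \<forall>j\<in>I. B i \<bullet> B j = (if i = j then 1 else 0))"

lemma orthonormal_family_inner:
  assumes "orthonormal_family I B" "finite I" "i \<in> I"
  shows "(\<Sum>j\<in>I. v j *\<^sub>R B j) \<bullet> B i = v i"
proof -
  have "(\<Sum>j\<in>I. v j *\<^sub>R B j) \<bullet> B i = (\<Sum>j\<in>I. if j = i then v i else 0)"
    unfolding inner_sum_left using assms by (intro sum.cong) (auto simp: orthonormal_family_def)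
  then show ?thesis using assms by simp
qed

lemma orthonormal_family_norm:
  assumes "orthonormal_family I B" "finite I"
  shows "(norm (\<Sum>j\<in>I. v j *\<^sub>R B j))\<^sup>2 = (\<Sum>j\<in>I. (v j)\<^sup>2)"
proof -
  have "(\<Sum>j\<in>I. v j *\<^sub>R B j) \<bullet> (\<Sum>j\<in>I. v j *\<^sub>R B j) = (\<Sum>i\<in>I. v i * ((\<Sum>j\<in>I. v j *\<^sub>R B j) \<bullet> B i))"
    by (simp only: inner_sum_right inner_scaleR_right)
  also have "\<dots> = (\<Sum>i\<in>I. (v i)\<^sup>2)"
    by (intro sum.cong refl) (simp add: orthonormal_family_inner[OF assms] power2_eq_square)
  finally show ?thesis by (simp add: power2_norm_eq_inner)
qed

lemma orthonormal_family_expand: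
  assumes B: "orthonormal_family I B" "finite I" and z: "z \<in> span (B ` I)"
  shows "z = (\<Sum>i\<in>I. (z \<bullet> B i) *\<^sub>R B i)"
proof -
  have "span (B ` I) \<subseteq> {z. z = (\<Sum>i\<in>I. (z \<bullet> B i) *\<^sub>R B i)}"
  proof (rule span_minimal)
    show "subspace {z. z = (\<Sum>i\<in>I. (z \<bullet> B i) *\<^sub>R B i)}"
    proof (rule subspaceI)
      fix a x assume "x \<in> {z. z = (\<Sum>i\<in>I. (z \<bullet> B i) *\<^sub>R B i)}"
      then have x: "(\<Sum>i\<in>I. (x \<bullet> B i) *\<^sub>R B i) = x" by simp
      have "(\<Sum>i\<in>I. ((a *\<^sub>R x) \<bullet> B i) *\<^sub>R B i) = a *\<^sub>R (\<Sum>i\<in>I. (x \<bullet> B i) *\<^sub>R B i)"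
        by (simp add: scaleR_sum_right)
      then show "a *\<^sub>R x \<in> {z. z = (\<Sum>i\<in>I. (z \<bullet> B i) *\<^sub>R B i)}"
        unfolding x by simp
    qed (auto simp: inner_add_left scaleR_add_left sum.distrib)
    show "B ` I \<subseteq> {z. z = (\<Sum>i\<in>I. (z \<bullet> B i) *\<^sub>R B i)}"
    proof clarify
      fix i assume i: "i \<in> I"
      have "(\<Sum>j\<in>I. (B i \<bullet> B j) *\<^sub>R B j) = (\<Sum>j\<in>I. if j = i then B i else 0)"
        using B(1) i by (intro sum.cong) (auto simp: orthonormal_family_def)
      then show "B i = (\<Sum>j\<in>I. (B i \<bullet> B j) *\<^sub>R B j)" using B(2) i by simp
    qed
  qed
  then show ?thesis using z by blast
qed

lemma orthonormal_family_card:
  fixes B :: "'i \<Rightarrow> 'a::euclidean_space"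
  assumes B: "orthonormal_family I B" and fin: "finite I"
  shows "card I = dim (span (B ` I))"
proof -
  have inj: "inj_on B I"
  proof (rule inj_onI)
    fix i j assume "i \<in> I" "j \<in> I" "B i = B j"
    then show "i = j" using B unfolding orthonormal_family_def by (metis zero_neq_one)
  qed
  have "pairwise orthogonal (B ` I)"
    using B by (auto simp: pairwise_def orthogonal_def orthonormal_family_def)
  moreover have "0 \<notin> B ` I"
    using B unfolding orthonormal_family_def by (metis imageE inner_zero_left zero_neq_one)
  ultimately have "independent (B ` I)"
    by (rule pairwise_orthogonal_independent)
  then show ?thesis by (simp add: dim_eq_card_independent card_image[OF inj])
qed

lemma nn_integral_std_normal_density: "(\<integral>\<^sup>+x. ennreal (std_normal_density x) \<partial>lborel) = 1"
proof -
  interpret prob_space "density lborel std_normal_density"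
    by (rule prob_space_normal_density) simp
  show ?thesis using emeasure_space_1 by (simp add: emeasure_density)
qed

text \<open>Uniqueness of Haar measure: both sides are invariant under the reflections
  \<open>x \<mapsto> z - x\<close> of the span and give the Gaussian weight \<open>f\<close> the same integral, so the two
  integrals of \<open>g\<close> agree by Tonelli applied to \<open>f(x) g(x - y)\<close>.\<close>

lemma nn_integral_orthonormal_family_eq:
  fixes B :: "'i \<Rightarrow> 'a::euclidean_space" and C :: "'j \<Rightarrow> 'a"
  assumes I: "orthonormal_family I B" "finite I" and J: "orthonormal_family J C" "finite J"
    and span: "span (B ` I) = span (C ` J)" and g[measurable]: "g \<in> borel_measurable borel"
  shows "(\<integral>\<^sup>+v. g (\<Sum>i\<in>I. v i *\<^sub>R B i) \<partial>lebPi I) = (\<integral>\<^sup>+v. g (\<Sum>j\<in>J. v j *\<^sub>R C j) \<partial>lebPi J)"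
proof -
  let ?B = "\<lambda>v. \<Sum>i\<in>I. v i *\<^sub>R B i" and ?C = "\<lambda>v. \<Sum>j\<in>J. v j *\<^sub>R C j"
  have mB[measurable]: "?B \<in> borel_measurable (lebPi I)" and mC[measurable]: "?C \<in> borel_measurable (lebPi J)"
    by (intro borel_measurable_sum borel_measurable_scaleR; simp)+
  have refl: "(\<integral>\<^sup>+v. F (z - (\<Sum>i\<in>K. v i *\<^sub>R D i)) \<partial>lebPi K) = (\<integral>\<^sup>+v. F (\<Sum>i\<in>K. v i *\<^sub>R D i) \<partial>lebPi K)"
    if K: "orthonormal_family K D" "finite K" and F: "F \<in> borel_measurable borel" and z: "z \<in> span (D ` K)"
    for K and D :: "'k \<Rightarrow> 'a" and F :: "'a \<Rightarrow> ennreal" and z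
  proof -
    have "z - (\<Sum>i\<in>K. v i *\<^sub>R D i) = (\<Sum>i\<in>K. (\<lambda>i\<in>K. z \<bullet> D i - v i) i *\<^sub>R D i)" for v
      using orthonormal_family_expand[OF K z] by (simp add: scaleR_diff_left sum_subtractf)
    moreover have "(\<lambda>v. F (\<Sum>i\<in>K. v i *\<^sub>R D i)) \<in> borel_measurable (lebPi K)"
      by (intro measurable_compose[OF _ F] borel_measurable_sum borel_measurable_scaleR) simp_all
    ultimately show ?thesis
      using nn_integral_lebPi_reflect[OF K(2), of "\<lambda>v. F (\<Sum>i\<in>K. v i *\<^sub>R D i)"] by simp
  qed
  have Bspan: "?B v \<in> span (B ` I)" for v
    by (intro span_sum span_scale span_base) auto
  have Cspan: "?C v \<in> span (B ` I)" for v
    unfolding span by (intro span_sum span_scale span_base) auto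
  have zero: "0 \<in> span (B ` I)" by (rule span_zero)
  \<comment> \<open>The standard Gaussian density depends on the norm only. In every orthonormal
    coordinate system with \<open>card I\<close> members it is the product of one-dimensional
    densities, so its integral is 1 for both families.\<close>
  define f where "f x = ennreal ((1 / sqrt (2 * pi)) ^ card I * exp (- (norm x)\<^sup>2 / 2))" for x :: 'a
  have f[measurable]: "f \<in> borel_measurable borel" unfolding f_def by measurable
  have f_sym: "f (x - y) = f (y - x)" for x y by (simp add: f_def norm_minus_commute)
  have f1: "(\<integral>\<^sup>+v. f (\<Sum>i\<in>K. v i *\<^sub>R D i) \<partial>lebPi K) = 1"
    if K: "orthonormal_family K D" "finite K" "card K = card I" for K and D :: "'k \<Rightarrow> 'a"
  proof -
    have "f (\<Sum>i\<in>K. v i *\<^sub>R D i) = (\<Prod>i\<in>K. ennreal (std_normal_density (v i)))" for v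
    proof -
      have "(\<Prod>i\<in>K. std_normal_density (v i)) = (\<Prod>i\<in>K. 1 / sqrt (2 * pi)) * (\<Prod>i\<in>K. exp (- (v i)\<^sup>2 / 2))"
        by (simp only: std_normal_density_def prod.distrib)
      also have "(\<Prod>i\<in>K. exp (- (v i)\<^sup>2 / 2)) = exp (- (\<Sum>i\<in>K. (v i)\<^sup>2) / 2)"
        using K(2) by (simp add: sum_negf sum_divide_distrib flip: exp_sum)
      finally show ?thesis
        by (simp add: f_def orthonormal_family_norm[OF K(1,2)] prod_ennreal K(3))
    qed
    then have "(\<integral>\<^sup>+v. f (\<Sum>i\<in>K. v i *\<^sub>R D i) \<partial>lebPi K)
        = (\<integral>\<^sup>+v. (\<Prod>i\<in>K. ennreal (std_normal_density (v i))) \<partial>lebPi K)"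
      by simp
    also have "\<dots> = (\<Prod>i\<in>K. \<integral>\<^sup>+x. ennreal (std_normal_density x) \<partial>lborel)"
      by (rule lborel_product.product_nn_integral_prod[OF K(2)]) measurable
    finally show ?thesis by (simp add: nn_integral_std_normal_density)
  qed
  have card: "card J = card I"
    using orthonormal_family_card[OF I] orthonormal_family_card[OF J] span by simp
  interpret sI: sigma_finite_measure "lebPi I" by (rule lborel_product.sigma_finite[OF I(2)])
  interpret sJ: sigma_finite_measure "lebPi J" by (rule lborel_product.sigma_finite[OF J(2)])
  interpret IJ: pair_sigma_finite "lebPi I" "lebPi J" ..
  have "(\<integral>\<^sup>+w. g (?C w) \<partial>lebPi J) = (\<integral>\<^sup>+v. f (?B v) * (\<integral>\<^sup>+w. g (?C w) \<partial>lebPi J) \<partial>lebPi I)"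
    by (simp add: nn_integral_multc f1[OF I])
  also have "\<dots> = (\<integral>\<^sup>+v. (\<integral>\<^sup>+w. f (?B v) * g (?B v - ?C w) \<partial>lebPi J) \<partial>lebPi I)"
  proof (rule nn_integral_cong)
    fix v
    have "(\<integral>\<^sup>+w. g (?B v - ?C w) \<partial>lebPi J) = (\<integral>\<^sup>+w. g (?C w) \<partial>lebPi J)"
      by (rule refl[OF J g]) (use Bspan span in simp)
    then show "f (?B v) * (\<integral>\<^sup>+w. g (?C w) \<partial>lebPi J) = (\<integral>\<^sup>+w. f (?B v) * g (?B v - ?C w) \<partial>lebPi J)"
      by (simp add: nn_integral_cmult)
  qed
  also have "\<dots> = (\<integral>\<^sup>+w. (\<integral>\<^sup>+v. f (?B v) * g (?B v - ?C w) \<partial>lebPi I) \<partial>lebPi J)"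
    by (rule IJ.Fubini'[symmetric]) measurable
  \<comment> \<open>Reflecting \<open>v\<close> at z = \<open>?C w\<close> frees \<open>g\<close> of
    \<open>w\<close>. After a second exchange of the integrals, \<open>w\<close> occurs in the
    Gaussian factor only and integrates to 1.\<close>
  also have "\<dots> = (\<integral>\<^sup>+w. (\<integral>\<^sup>+v. f (?C w - ?B v) * g (- ?B v) \<partial>lebPi I) \<partial>lebPi J)"
  proof (rule nn_integral_cong)
    fix w
    have "(\<lambda>x. f x * g (x - ?C w)) \<in> borel_measurable borel" by measurable
    from refl[OF I this Cspan[of w]]
    show "(\<integral>\<^sup>+v. f (?B v) * g (?B v - ?C w) \<partial>lebPi I) = (\<integral>\<^sup>+v. f (?C w - ?B v) * g (- ?B v) \<partial>lebPi I)"
      by simp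
  qed
  also have "\<dots> = (\<integral>\<^sup>+v. (\<integral>\<^sup>+w. f (?C w - ?B v) * g (- ?B v) \<partial>lebPi J) \<partial>lebPi I)"
    by (rule IJ.Fubini') measurable
  also have "\<dots> = (\<integral>\<^sup>+v. g (0 - ?B v) \<partial>lebPi I)"
  proof (rule nn_integral_cong)
    fix v
    have "(\<integral>\<^sup>+w. f (?C w - ?B v) * g (- ?B v) \<partial>lebPi J) = (\<integral>\<^sup>+w. f (?B v - ?C w) \<partial>lebPi J) * g (- ?B v)"
      by (simp add: nn_integral_multc f_sym[of "?B v"])
    also have "(\<integral>\<^sup>+w. f (?B v - ?C w) \<partial>lebPi J) = (\<integral>\<^sup>+w. f (?C w) \<partial>lebPi J)"
      by (rule refl[OF J f]) (use Bspan span in simp)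
    finally show "(\<integral>\<^sup>+w. f (?C w - ?B v) * g (- ?B v) \<partial>lebPi J) = g (0 - ?B v)"
      by (simp add: f1[OF J card])
  qed
  also have "\<dots> = (\<integral>\<^sup>+v. g (?B v) \<partial>lebPi I)"
    by (rule refl[OF I g zero])
  finally show ?thesis by simp
qed

text \<open>The given family, renumbered by \<open>h\<close>, shows that the basis chosen by
  \<open>SOME\<close> exists; independence of the basis then replaces the chosen one by the given
  one.\<close>

lemma nn_integral_subspace_lebesgue:
  fixes B :: "'i \<Rightarrow> 'a::euclidean_space"
  assumes I: "orthonormal_family I B" "finite I" and span: "span (B ` I) = Z"
    and g[measurable]: "g \<in> borel_measurable borel"
  shows "(\<integral>\<^sup>+x. g x \<partial>subspace_lebesgue Z) = (\<integral>\<^sup>+v. g (\<Sum>i\<in>I. v i *\<^sub>R B i) \<partial>lebPi I)"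
proof -
  have dimZ: "card I = dim Z" using orthonormal_family_card[OF I] span by simp
  then obtain h where h: "bij_betw h {1..dim Z} I"
    using finite_same_card_bij[of "{1..dim Z}" I] I(2) by auto
  have "orthonormal_basis Z (dim Z) (B \<circ> h)"
    unfolding orthonormal_basis_def
  proof (intro conjI ballI)
    fix a b assume "a \<in> {1..dim Z}" "b \<in> {1..dim Z}"
    then show "(B \<circ> h) a \<bullet> (B \<circ> h) b = (if a = b then 1 else 0)"
      using h I(1) by (auto simp: orthonormal_family_def bij_betw_def inj_on_def)
  next
    show "span ((B \<circ> h) ` {1..dim Z}) = Z"
      by (simp only: image_comp[symmetric] bij_betw_imp_surj_on[OF h] span)
  qed
  then have J: "orthonormal_basis Z (dim Z) (SOME J. orthonormal_basis Z (dim Z) J)" (is "orthonormal_basis Z _ ?J")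
    by (rule someI[where P = "orthonormal_basis Z (dim Z)"])
  have "(\<integral>\<^sup>+x. g x \<partial>subspace_lebesgue Z) = (\<integral>\<^sup>+v. g (\<Sum>k=1..dim Z. v k *\<^sub>R ?J k) \<partial>lebPi {1..dim Z})"
    unfolding subspace_lebesgue_def Let_def by (intro nn_integral_distr) measurable
  also have "\<dots> = (\<integral>\<^sup>+v. g (\<Sum>i\<in>I. v i *\<^sub>R B i) \<partial>lebPi I)"
    using J by (intro nn_integral_orthonormal_family_eq I g)
      (auto simp: orthonormal_family_def orthonormal_basis_def span)
  finally show ?thesis .
qed

section \<open>Measurability of the positive definite cone\<close>

lemma closed_symm: "closed {x :: 'n::finite sqmat. transpose x = x}"
  by (intro closed_Collect_eq continuous_intros linear_continuous_on
      linear_conv_bounded_linear[THEN iffD1] linear_transpose)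

text \<open>The quadratic form of a positive definite matrix attains a positive minimum on the unit
  sphere. So the cone is the union over \<open>n\<close> of the closed sets of symmetric matrices
  whose form is at least 1/(n+1) on the sphere.\<close>

lemma posdef_borel: "{x :: 'n::finite sqmat. posdef x} \<in> sets borel"
proof -
  let ?S = "sphere 0 1 :: (real^'n) set"
  let ?F = "\<lambda>n::nat. {x :: 'n sqmat. transpose x = x} \<inter> (\<Inter>v\<in>?S. {x. 1 / real (Suc n) \<le> v \<bullet> (x *v v)})"
  have closed: "closed (?F n)" for n
  proof (intro closed_Int closed_INT ballI closed_symm)
    fix v :: "real^'n"
    have "linear (\<lambda>x :: 'n sqmat. x *v v)"
      by (auto intro!: linearI simp: matrix_vector_mult_add_rdistrib scaleR_matrix_vector_assoc)
    then have "continuous_on UNIV (\<lambda>x :: 'n sqmat. x *v v)"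
      by (simp add: linear_continuous_on linear_conv_bounded_linear)
    then show "closed {x :: 'n sqmat. 1 / real (Suc n) \<le> v \<bullet> (x *v v)}"
      by (intro closed_Collect_le continuous_intros)
  qed
  have eq: "{x :: 'n sqmat. posdef x} = (\<Union>n. ?F n)"
  proof (intro equalityI subsetI)
    fix x :: "'n sqmat" assume "x \<in> {x. posdef x}"
    then have x: "transpose x = x" "\<And>v. v \<noteq> 0 \<Longrightarrow> v \<bullet> (x *v v) > 0" by (auto simp: posdef_def)
    have "\<exists>v\<in>?S. \<forall>y\<in>?S. v \<bullet> (x *v v) \<le> y \<bullet> (x *v y)"
      by (rule continuous_attains_inf) (auto intro!: continuous_intros)
    then obtain v where v: "v \<in> ?S" "\<And>y. y \<in> ?S \<Longrightarrow> v \<bullet> (x *v v) \<le> y \<bullet> (x *v y)" by blast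
    have "v \<bullet> (x *v v) > 0" using v(1) by (intro x(2)) auto
    then obtain n where n: "1 / real (Suc n) < v \<bullet> (x *v v)"
      by (metis nat_approx_posE)
    have "x \<in> ?F n"
      using x(1) order_trans[OF less_imp_le[OF n] v(2)] by auto
    then show "x \<in> (\<Union>n. ?F n)" by blast
  next
    fix x :: "'n sqmat" assume "x \<in> (\<Union>n. ?F n)"
    then obtain n where "x \<in> ?F n" by blast
    then have x: "transpose x = x" "\<And>v. v \<in> ?S \<Longrightarrow> 1 / real (Suc n) \<le> v \<bullet> (x *v v)" by auto
    have "v \<bullet> (x *v v) > 0" if "v \<noteq> 0" for v
    proof -
      let ?w = "(1 / norm v) *\<^sub>R v"
      have "0 < 1 / real (Suc n)" by simp
      also have "\<dots> \<le> ?w \<bullet> (x *v ?w)" using that by (intro x(2)) simp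
      also have "\<dots> = (v \<bullet> (x *v v)) / (norm v)\<^sup>2"
        by (simp add: matrix_vector_mult_scaleR power2_eq_square)
      finally show ?thesis using that by (simp add: zero_less_divide_iff)
    qed
    then show "x \<in> {x. posdef x}" using x(1) by (simp add: posdef_def)
  qed
  show ?thesis
    unfolding eq by (intro sets.countable_UN image_subsetI borel_closed closed)
qed

section \<open>Coordinates of the factor\<close>

lemma measurable_matrix_mult:
  fixes F G :: "'a \<Rightarrow> 'n::finite sqmat"
  assumes "F \<in> borel_measurable N" "G \<in> borel_measurable N"
  shows "(\<lambda>x. F x ** G x) \<in> borel_measurable N"
  by (rule borel_measurable_continuous_Pair[OF assms])
    (intro mm.continuous_on continuous_intros)

lemma measurable_transpose:
  fixes F :: "'a \<Rightarrow> 'n::finite sqmat"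
  assumes "F \<in> borel_measurable N"
  shows "(\<lambda>x. transpose (F x)) \<in> borel_measurable N"
  by (rule borel_measurable_continuous_on[OF _ assms])
    (intro linear_continuous_on linear_conv_bounded_linear[THEN iffD1] linear_transpose)

section \<open>Orthogonality of the Peirce components\<close>

context peirce_frame
begin

lemma norm_c: "k \<in> K \<Longrightarrow> c k \<bullet> c k = real (rank (c k))"
  by (simp add: inner_eq_trace c_sym c_idem trace_projection)

lemma c_inner_c: "k \<in> K \<Longrightarrow> l \<in> K \<Longrightarrow> k \<noteq> l \<Longrightarrow> c k \<bullet> c l = 0"
  by (simp add: inner_eq_trace c_sym c_mult trace_def)

lemma c_inner_H:
  assumes k: "k \<in> K" and l: "l \<in> K" and X: "X \<in> H l"
  shows "c k \<bullet> X = 0"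
proof (cases "k = l")
  case True
  have "c k \<bullet> X = (c k ** c k) \<bullet> X" using k by (simp add: c_idem)
  also have "\<dots> = c k \<bullet> (c k ** X)" by (simp only: inner_mult_left c_sym[OF k])
  finally show ?thesis using c_mult_H[OF l X k] True by simp
next
  case False
  have "c k \<bullet> X = (c k ** c k) \<bullet> X" using k by (simp add: c_idem)
  also have "\<dots> = c k \<bullet> (X ** c k)" by (simp only: inner_mult_right c_sym[OF k])
  finally show ?thesis using H_mult_c(2)[OF l X k False] by simp
qed

lemma H_inner_H:
  assumes k: "k \<in> K" and l: "l \<in> K" "k \<noteq> l" and X: "X \<in> H k" and Y: "Y \<in> H l"
  shows "X \<bullet> Y = 0"
proof -
  have "X \<bullet> Y = (X ** c k) \<bullet> Y" by (simp add: H_mult_c(1)[OF k X])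
  also have "\<dots> = X \<bullet> (Y ** c k)" by (simp only: inner_mult_right c_sym[OF k])
  finally show ?thesis using H_mult_c(2)[OF l(1) Y k l(2)] by simp
qed

text \<open>Strictly lower and strictly upper triangular matrices are orthogonal. The case
  \<open>k = l\<close> is included and gives f + f^T the norm sqrt 2.\<close>

lemma H_inner_transpose_H:
  assumes k: "k \<in> K" and l: "l \<in> K" and X: "X \<in> H k" and Y: "Y \<in> H l"
  shows "X \<bullet> transpose Y = 0"
proof -
  have *: "X \<bullet> transpose Y = 0" if k: "k \<in> K" and l: "l \<in> K" and X: "X \<in> H k" and Y: "Y \<in> H l"
    and le: "rk k \<le> rk l" for k l X Y
  proof -
    have "X \<bullet> transpose Y = (X ** c k) \<bullet> transpose Y" by (simp add: H_mult_c(1)[OF k X])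
    also have "\<dots> = X \<bullet> transpose (c k ** Y)"
      by (simp only: inner_mult_right matrix_transpose_mul c_sym[OF k])
    finally show ?thesis using c_mult_H[OF l Y k le] by simp
  qed
  show ?thesis
  proof (cases "rk k \<le> rk l")
    case True
    then show ?thesis using * assms by blast
  next
    case False
    then have "Y \<bullet> transpose X = 0" using *[OF l k Y X] by simp
    then show ?thesis by (metis inner_commute inner_transpose transpose_transpose)
  qed
qed

text \<open>Expand 1 x 1 along the frame and sort the pairs of indices by rank. By symmetry of
  \<open>x\<close> the terms on one side of the diagonal are transposes of those on the other. This
  shows later that the adapted basis spans \<open>Z\<close>.\<close>

lemma Z_peirce_expansion:
  assumes x: "x \<in> Z"
  shows "x = (\<Sum>k\<in>K. c k ** x ** c k
    + (above c K rk k ** x ** c k + transpose (above c K rk k ** x ** c k)))"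
proof -
  let ?A = "\<lambda>k l. c l ** x ** c k"
  have "x = (\<Sum>l\<in>K. c l) ** x ** (\<Sum>k\<in>K. c k)" by (simp add: c_sum)
  also have "\<dots> = (\<Sum>k\<in>K. \<Sum>l\<in>K. ?A k l)"
    by (simp only: mm.sum_left) (simp only: mm.sum_right, rule sum.swap)
  also have "\<dots> = (\<Sum>k\<in>K. \<Sum>l\<in>K. (if l = k then ?A k k else 0) + (if rk k < rk l then ?A k l else 0)
      + (if rk l < rk k then ?A k l else 0))"
  proof (intro sum.cong refl)
    fix k l assume "k \<in> K" "l \<in> K"
    then consider "l = k" | "rk k < rk l" | "rk l < rk k"
      using inj_rk by (metis inj_onD linorder_neqE)
    then show "?A k l = (if l = k then ?A k k else 0) + (if rk k < rk l then ?A k l else 0)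
        + (if rk l < rk k then ?A k l else 0)"
      by cases auto
  qed
  also have "\<dots> = (\<Sum>k\<in>K. ?A k k) + (\<Sum>k\<in>K. \<Sum>l\<in>K. if rk k < rk l then ?A k l else 0)
      + (\<Sum>k\<in>K. \<Sum>l\<in>K. if rk l < rk k then ?A k l else 0)"
    using finite_K by (simp add: sum.distrib)
  also have "(\<Sum>k\<in>K. \<Sum>l\<in>K. if rk k < rk l then ?A k l else 0) = (\<Sum>k\<in>K. above c K rk k ** x ** c k)"
    by (simp only: above_def mm.sum_left sum.inter_filter[OF finite_K, symmetric])
  also have "(\<Sum>k\<in>K. \<Sum>l\<in>K. if rk l < rk k then ?A k l else 0)
      = (\<Sum>l\<in>K. \<Sum>k\<in>K. if rk l < rk k then ?A k l else 0)"
    by (rule sum.swap)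
  also have "\<dots> = (\<Sum>l\<in>K. c l ** x ** above c K rk l)"
    by (simp only: above_def mm.sum_right sum.inter_filter[OF finite_K, symmetric])
  also have "\<dots> = (\<Sum>l\<in>K. transpose (above c K rk l ** x ** c l))"
    by (intro sum.cong refl) (simp add: matrix_transpose_mul above_sym c_sym symm_Z[OF x] matrix_mul_assoc)
  finally show ?thesis by (simp add: sum.distrib add.assoc)
qed

end

section \<open>The factor, its determinant and its traces in the given bases\<close>

locale framed_block_space_basis = framed_block_space blk r Z d c
  for blk :: "'n::{finite,linorder} \<Rightarrow> nat" and r :: nat and Z :: "'n sqmat set"
    and d :: "nat \<Rightarrow> nat" and c :: "nat \<Rightarrow> nat \<Rightarrow> 'n sqmat" +
  fixes m :: "nat \<Rightarrow> nat \<Rightarrow> nat" and f :: "nat \<Rightarrow> nat \<Rightarrow> nat \<Rightarrow> 'n sqmat"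
  assumes bases: "i \<in> {1..r} \<Longrightarrow> \<alpha> \<in> {1..d i} \<Longrightarrow>
    orthonormal_basis (hsp blk Z i (d i) (c i) \<alpha>) (m i \<alpha>) (f i \<alpha>)"
begin

abbreviation ek where "ek k \<equiv> etil c (fst k) (snd k)"
abbreviation mk where "mk k \<equiv> m (fst k) (snd k)"
abbreviation fk where "fk k \<equiv> f (fst k) (snd k)"
abbreviation \<mu> where "\<mu> k \<equiv> real (rank (ck k))"

definition col :: "nat \<times> nat \<Rightarrow> real \<Rightarrow> (nat \<Rightarrow> real) \<Rightarrow> 'n sqmat" where
  "col k t \<tau> = t *\<^sub>R ek k + (\<Sum>\<gamma>=1..mk k. \<tau> \<gamma> *\<^sub>R fk k \<gamma>)"

lemma fk_basis: "k \<in> K \<Longrightarrow> orthonormal_basis (peirce.H k) (mk k) (fk k)"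
  by (subst colspace_eq_hsp) (auto simp: K_def intro!: bases)

lemma fk_H: "k \<in> K \<Longrightarrow> \<gamma> \<in> {1..mk k} \<Longrightarrow> fk k \<gamma> \<in> peirce.H k"
proof -
  assume k: "k \<in> K" and "\<gamma> \<in> {1..mk k}"
  then have "fk k \<gamma> \<in> span (fk k ` {1..mk k})"
    by (intro span_base imageI)
  then show ?thesis using fk_basis[OF k] by (simp add: orthonormal_basis_def)
qed

lemma fk_inner: "k \<in> K \<Longrightarrow> a \<in> {1..mk k} \<Longrightarrow> b \<in> {1..mk k} \<Longrightarrow> fk k a \<bullet> fk k b = (if a = b then 1 else 0)"
  using fk_basis unfolding orthonormal_basis_def by blast

lemma mu_pos: "k \<in> K \<Longrightarrow> \<mu> k > 0"
  using peirce.rank_c_pos by simp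

lemma ek_eq: "etil c i \<alpha> = (1 / sqrt (real (rank (c i \<alpha>)))) *\<^sub>R c i \<alpha>"
  by (simp add: etil_def mu_def)

lemma col_column: "k \<in> K \<Longrightarrow> peirce.column k (t / sqrt (\<mu> k)) (col k t \<tau>)"
  unfolding peirce.column_def col_def ek_eq
  by (intro bexI[of _ "\<Sum>\<gamma>=1..mk k. \<tau> \<gamma> *\<^sub>R fk k \<gamma>"] subspace_sum[OF peirce.subspace_H]
      subspace_scale[OF peirce.subspace_H] fk_H) auto

lemma column_col:
  assumes k: "k \<in> K" and S: "peirce.column k s S"
  obtains \<tau> where "S = col k (s * sqrt (\<mu> k)) \<tau>"
proof -
  obtain X where X: "X \<in> peirce.H k" "S = s *\<^sub>R ck k + X"
    using S by (auto simp: peirce.column_def)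
  have "X = (\<Sum>\<gamma>=1..mk k. (X \<bullet> fk k \<gamma>) *\<^sub>R fk k \<gamma>)"
    using fk_basis[OF k] X(1) by (intro orthonormal_family_expand)
      (auto simp: orthonormal_family_def orthonormal_basis_def)
  then have "S = col k (s * sqrt (\<mu> k)) (\<lambda>\<gamma>. X \<bullet> fk k \<gamma>)"
    using mu_pos[OF k] X(2) by (simp add: col_def ek_eq)
  then show ?thesis by (rule that)
qed

lemma hT_eq: "hT r d m c f t \<tau> = (\<Sum>k\<in>K. col k (t (fst k) (snd k)) (\<tau> (fst k) (snd k)))"
  unfolding hT_def K_def col_def by (subst sum.Sigma) (auto simp: split_def)

lemma det_gram_hT:
  assumes t: "\<forall>i\<in>{1..r}. \<forall>\<alpha>\<in>{1..d i}. t i \<alpha> > 0"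
  shows "det (hT r d m c f t \<tau> ** transpose (hT r d m c f t \<tau>))
    = (\<Prod>i=1..r. \<Prod>\<alpha>=1..d i. (t i \<alpha> ^ 2 / real (mu c i \<alpha>)) ^ mu c i \<alpha>)"
proof -
  let ?t = "\<lambda>k. t (fst k) (snd k)"
  have "det (hT r d m c f t \<tau>) = (\<Prod>k\<in>K. (?t k / sqrt (\<mu> k)) ^ rank (ck k))"
    unfolding hT_eq
  proof (rule peirce.det_tri)
    fix k assume k: "k \<in> K"
    show "peirce.column k (?t k / sqrt (\<mu> k)) (col k (?t k) (\<tau> (fst k) (snd k)))"
      using k by (rule col_column)
    have "?t k > 0" using k t by (auto simp: K_def)
    then show "?t k / sqrt (\<mu> k) \<noteq> 0" using mu_pos[OF k] by simp
  qed
  then have "det (hT r d m c f t \<tau> ** transpose (hT r d m c f t \<tau>))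
      = (\<Prod>k\<in>K. ((?t k / sqrt (\<mu> k)) ^ rank (ck k))\<^sup>2)"
    by (simp add: det_mult_transpose_self prod_power_distrib)
  also have "\<dots> = (\<Prod>k\<in>K. ((?t k)\<^sup>2 / \<mu> k) ^ rank (ck k))"
    by (intro prod.cong refl) (simp add: power_divide flip: power_mult, simp add: power_mult mult.commute)
  also have "\<dots> = (\<Prod>i=1..r. \<Prod>\<alpha>=1..d i. (t i \<alpha> ^ 2 / real (mu c i \<alpha>)) ^ mu c i \<alpha>)"
    unfolding K_def mu_def by (subst prod.Sigma) (auto simp: split_def)
  finally show ?thesis .
qed

text \<open>\<open>phi\<close> is the matrix of the form (X, Y) \<mapsto> tr (A X Y^T) in the basis
  consisting of \<open>ek k\<close> and the \<open>fk k \<gamma>\<close>. Its first column is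
  defined as the mirror image of its first row, so the symmetry of \<open>A\<close> is used.\<close>

lemma trace_col:
  assumes k: "k \<in> K" and A: "transpose A = A"
  shows "trace (col k t \<tau> ** transpose (col k t \<tau>) ** A) = phi_quad m c f (fst k) (snd k) A t \<tau>"
proof -
  define b where "b a = (if a = 0 then ek k else fk k a)" for a
  define w where "w a = (if a = 0 then t else \<tau> a)" for a :: nat
  have tre: "transpose (ek k) = ek k" using k by (simp add: ek_eq transpose_scalar peirce.c_sym)
  have "col k t \<tau> = (\<Sum>a=0..mk k. w a *\<^sub>R b a)"
    unfolding col_def by (subst sum.atLeast_Suc_atMost) (auto simp: w_def b_def)
  then have "col k t \<tau> ** transpose (col k t \<tau>) ** A
      = (\<Sum>a=0..mk k. \<Sum>a'=0..mk k. (w a * w a') *\<^sub>R (b a ** transpose (b a') ** A))"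
    by (simp only: transpose_sum mm.sum_left transpose_scalar mm.scaleR_left)
      (simp only: mm.sum_right mm.sum_left mm.scaleR_right mm.scaleR_left scaleR_scaleR scaleR_sum_right)
  moreover have "trace (\<Sum>a\<in>I. g a) = (\<Sum>a\<in>I. trace (g a))" for I and g :: "nat \<Rightarrow> 'n sqmat"
    unfolding trace_def sum_component by (rule sum.swap)
  moreover have "trace (s *\<^sub>R X) = s * trace X" for s and X :: "'n sqmat"
    by (simp add: trace_def sum_distrib_left)
  ultimately have "trace (col k t \<tau> ** transpose (col k t \<tau>) ** A)
      = (\<Sum>a=0..mk k. \<Sum>a'=0..mk k. w a * w a' * trace (b a ** transpose (b a') ** A))"
    by simp
  also have "\<dots> = phi_quad m c f (fst k) (snd k) A t \<tau>"
    unfolding phi_quad_def Let_def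
  proof (intro sum.cong refl)
    fix a a' :: nat
    have "trace (b a ** transpose (b a') ** A) = phi c f (fst k) (snd k) A a a'"
    proof -
      have 1: "trace (b a ** transpose (b a') ** A) = trace (A ** b a ** transpose (b a'))"
        using trace_mul_sym[of "b a ** transpose (b a')" A] by (simp only: matrix_mul_assoc)
      have 2: "trace (b a ** transpose (b a') ** A) = trace (A ** b a' ** transpose (b a))"
      proof -
        have "trace (b a ** transpose (b a') ** A) = trace (transpose (b a ** transpose (b a') ** A))"
          by (simp add: trace_def transpose_def)
        then show ?thesis by (simp only: matrix_transpose_mul transpose_transpose A matrix_mul_assoc)
      qed
      show ?thesis
        using 1 2 by (cases "a = 0"; cases "a' = 0") (simp_all add: phi_def b_def tre)
    qed
    then show "w a * w a' * trace (b a ** transpose (b a') ** A)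
      = (if a = 0 then t else \<tau> a) * phi c f (fst k) (snd k) A a a' * (if a' = 0 then t else \<tau> a')"
      by (simp add: w_def)
  qed
  finally show ?thesis .
qed

lemma gram_hT: "hT r d m c f t \<tau> ** transpose (hT r d m c f t \<tau>)
  = (\<Sum>k\<in>K. col k (t (fst k) (snd k)) (\<tau> (fst k) (snd k)) **
      transpose (col k (t (fst k) (snd k)) (\<tau> (fst k) (snd k))))"
  unfolding hT_eq by (rule peirce.tri_gram) (rule col_column)

lemma trace_gram_hT:
  assumes A: "symm A"
  shows "trace (hT r d m c f t \<tau> ** transpose (hT r d m c f t \<tau>) ** A)
    = (\<Sum>i=1..r. \<Sum>\<alpha>=1..d i. phi_quad m c f i \<alpha> A (t i \<alpha>) (\<tau> i \<alpha>))"
proof -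
  have tr: "trace (\<Sum>k\<in>K. g k) = (\<Sum>k\<in>K. trace (g k))" for g :: "nat \<times> nat \<Rightarrow> 'n sqmat"
    unfolding trace_def sum_component by (rule sum.swap)
  have "trace (hT r d m c f t \<tau> ** transpose (hT r d m c f t \<tau>) ** A)
      = (\<Sum>k\<in>K. phi_quad m c f (fst k) (snd k) A (t (fst k) (snd k)) (\<tau> (fst k) (snd k)))"
    unfolding gram_hT mm.sum_left tr using A by (intro sum.cong refl trace_col) (auto simp: symm_def)
  then show ?thesis
    unfolding K_def by (subst sum.Sigma) (auto simp: split_def)
qed

lemma hplus_exists:
  assumes "x \<in> Z" "posdef x"
  obtains t \<tau> where "\<forall>i\<in>{1..r}. \<forall>\<alpha>\<in>{1..d i}. t i \<alpha> > 0"
    "x = hT r d m c f t \<tau> ** transpose (hT r d m c f t \<tau>)"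
proof -
  obtain s S where S: "\<And>k. k \<in> K \<Longrightarrow> s k > 0" "\<And>k. k \<in> K \<Longrightarrow> peirce.column k (s k) (S k)"
    "x = (\<Sum>k\<in>K. S k) ** transpose (\<Sum>k\<in>K. S k)"
    using peirce.cholesky_exists[OF assms] by blast
  have "\<forall>k\<in>K. \<exists>\<tau>. S k = col k (s k * sqrt (\<mu> k)) \<tau>"
  proof
    fix k assume k: "k \<in> K"
    show "\<exists>\<tau>. S k = col k (s k * sqrt (\<mu> k)) \<tau>"
      by (rule column_col[OF k S(2)[OF k]]) blast
  qed
  then obtain \<tau> where \<tau>: "\<And>k. k \<in> K \<Longrightarrow> S k = col k (s k * sqrt (\<mu> k)) (\<tau> k)"
    by metis
  let ?t = "\<lambda>i \<alpha>. s (i, \<alpha>) * sqrt (\<mu> (i, \<alpha>))" and ?\<tau> = "\<lambda>i \<alpha>. \<tau> (i, \<alpha>)"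
  have "hT r d m c f ?t ?\<tau> = (\<Sum>k\<in>K. S k)"
    unfolding hT_eq by (intro sum.cong refl) (simp add: \<tau>)
  moreover have "\<forall>i\<in>{1..r}. \<forall>\<alpha>\<in>{1..d i}. ?t i \<alpha> > 0"
  proof (intro ballI)
    fix i \<alpha> assume "i \<in> {1..r}" "\<alpha> \<in> {1..d i}"
    then have "(i, \<alpha>) \<in> K" by (simp add: K_def)
    then show "?t i \<alpha> > 0" using S(1)[of "(i, \<alpha>)"] mu_pos[of "(i, \<alpha>)"] by simp
  qed
  ultimately show ?thesis using that[of ?t ?\<tau>] S(3) by simp
qed

lemma hplus_unique:
  assumes t: "\<forall>i\<in>{1..r}. \<forall>\<alpha>\<in>{1..d i}. t i \<alpha> > 0" and t': "\<forall>i\<in>{1..r}. \<forall>\<alpha>\<in>{1..d i}. t' i \<alpha> > 0"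
    and eq: "hT r d m c f t \<tau> ** transpose (hT r d m c f t \<tau>)
      = hT r d m c f t' \<tau>' ** transpose (hT r d m c f t' \<tau>')"
  shows "hT r d m c f t \<tau> = hT r d m c f t' \<tau>'"
  unfolding hT_eq
proof (intro sum.cong refl)
  have pos: "t (fst k) (snd k) / sqrt (\<mu> k) > 0" "t' (fst k) (snd k) / sqrt (\<mu> k) > 0" if "k \<in> K" for k
    using that t t' mu_pos[OF that] by (auto simp: K_def)
  fix k assume k: "k \<in> K"
  show "col k (t (fst k) (snd k)) (\<tau> (fst k) (snd k)) = col k (t' (fst k) (snd k)) (\<tau>' (fst k) (snd k))"
    by (rule peirce.cholesky_unique(1)[OF col_column pos(1) col_column pos(2) eq[unfolded gram_hT] k])
qed

end

text \<open>One diagonal slope times \<open>n\<close> off-diagonal slopes, brought into the form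
  used by \<open>coord_density\<close>.\<close>

lemma jacobian_factor:
  fixes t \<mu>' :: real
  assumes t: "t > 0" and mu: "\<mu>' > 0"
  shows "2 * (1 / sqrt \<mu>') * t * (sqrt 2 * t / sqrt \<mu>') ^ n
    = 2 powr (1 + real n / 2) * \<mu>' powr (- (1 + real n) / 2) * t ^ (1 + n)"
proof -
  have s2: "sqrt 2 ^ n = 2 powr (real n / 2)"
    by (simp add: powr_half_sqrt[symmetric] powr_powr flip: powr_realpow)
  have "sqrt \<mu>' ^ Suc n = \<mu>' powr ((1 + real n) / 2)"
    using mu by (simp add: powr_half_sqrt[symmetric] powr_powr add.commute del: power_Suc flip: powr_realpow)
  moreover have "- (1 + real n) / 2 = - ((1 + real n) / 2)"
    by (rule minus_divide_left[symmetric])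
  ultimately have sm: "1 / sqrt \<mu>' ^ Suc n = \<mu>' powr (- (1 + real n) / 2)"
    by (simp only: powr_minus_divide)
  have "2 * (1 / sqrt \<mu>') * t * (sqrt 2 * t / sqrt \<mu>') ^ n = (2 * sqrt 2 ^ n) * (1 / sqrt \<mu>' ^ Suc n) * t ^ (1 + n)"
    by (simp add: power_divide power_mult_distrib)
  then show ?thesis unfolding s2 sm by (simp add: powr_add)
qed

section \<open>The triangular change of coordinates and the Lebesgue measure\<close>

context framed_block_space_basis
begin

abbreviation I where "I \<equiv> coord_idx r d m"
abbreviation key :: "nat \<times> nat \<times> nat \<Rightarrow> nat \<times> nat" where "key j \<equiv> (fst j, fst (snd j))"
abbreviation gam :: "nat \<times> nat \<times> nat \<Rightarrow> nat" where "gam j \<equiv> snd (snd j)"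
abbreviation idx :: "nat \<times> nat \<Rightarrow> nat \<Rightarrow> nat \<times> nat \<times> nat" where "idx k \<gamma> \<equiv> (fst k, snd k, \<gamma>)"
text \<open>Within a column the index \<gamma> = 0 comes first: the slope in a coordinate \<tau>
  contains the diagonal coordinate t of its column, which must be fixed before.\<close>

abbreviation rkI :: "nat \<times> nat \<times> nat \<Rightarrow> nat list" where "rkI j \<equiv> [fst j, fst (snd j), snd (snd j)]"

lemma idx_mem: "idx k \<gamma> \<in> I \<longleftrightarrow> k \<in> K \<and> \<gamma> \<le> mk k"
  by (cases k) (auto simp: coord_idx_def K_def)

lemma I_mem: "j \<in> I \<longleftrightarrow> key j \<in> K \<and> gam j \<le> mk (key j)"
  by (cases j) (auto simp: coord_idx_def K_def)

lemma I_Sigma: "I = (SIGMA i:{1..r}. SIGMA \<alpha>:{1..d i}. {0..m i \<alpha>})"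
  by (auto simp: coord_idx_def)

lemma finite_I: "finite I"
  by (simp add: I_Sigma)

definition bas :: "nat \<times> nat \<times> nat \<Rightarrow> 'n sqmat" where
  "bas j = (if gam j = 0 then ek (key j)
    else (1 / sqrt 2) *\<^sub>R (fk (key j) (gam j) + transpose (fk (key j) (gam j))))"

lemma bas_Z: "j \<in> I \<Longrightarrow> bas j \<in> Z"
proof -
  assume "j \<in> I"
  then have k: "key j \<in> K" and \<gamma>: "gam j \<noteq> 0 \<Longrightarrow> gam j \<in> {1..mk (key j)}" by (auto simp: I_mem)
  show ?thesis
  proof (cases "gam j = 0")
    case True
    then show ?thesis
      using subspace_scale[OF subspace_Z peirce.c_in_Z[OF k]] by (simp add: bas_def ek_eq)
  next
    case False
    then show ?thesis
      using subspace_scale[OF subspace_Z peirce.sym_col[OF k fk_H[OF k \<gamma>]]] by (simp add: bas_def)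
  qed
qed

lemma orthonormal_bas: "orthonormal_family I bas"
  unfolding orthonormal_family_def
proof (intro ballI)
  have e_f: "ek k \<bullet> (fk l \<gamma> + transpose (fk l \<gamma>)) = 0"
    if k: "k \<in> K" and l: "l \<in> K" "\<gamma> \<in> {1..mk l}" for k l \<gamma>
  proof -
    have "ck k \<bullet> transpose (fk l \<gamma>) = ck k \<bullet> fk l \<gamma>"
      by (metis inner_transpose peirce.c_sym[OF k])
    then show ?thesis
      using peirce.c_inner_H[OF k l(1) fk_H[OF l]] by (simp add: ek_eq inner_add_right)
  qed
  have f_f: "(fk k \<beta> + transpose (fk k \<beta>)) \<bullet> (fk l \<gamma> + transpose (fk l \<gamma>)) = (if k = l \<and> \<beta> = \<gamma> then 2 else 0)"
    if k: "k \<in> K" "\<beta> \<in> {1..mk k}" and l: "l \<in> K" "\<gamma> \<in> {1..mk l}" for k l \<beta> \<gamma>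
  proof -
    note X = fk_H[OF k] and Y = fk_H[OF l]
    have "transpose (fk k \<beta>) \<bullet> fk l \<gamma> = fk k \<beta> \<bullet> transpose (fk l \<gamma>)"
      by (metis inner_transpose transpose_transpose)
    moreover have "fk k \<beta> \<bullet> transpose (fk l \<gamma>) = 0"
      by (rule peirce.H_inner_transpose_H[OF k(1) l(1) X Y])
    moreover have "fk k \<beta> \<bullet> fk l \<gamma> = (if k = l \<and> \<beta> = \<gamma> then 1 else 0)"
    proof (cases "k = l")
      case True
      then show ?thesis using fk_inner[OF k] l(2) by simp
    next
      case False
      then show ?thesis using peirce.H_inner_H[OF k(1) l(1) False X Y] by simp
    qed
    ultimately show ?thesis
      by (auto simp: inner_add_left inner_add_right inner_transpose)
  qed
  fix j j' assume j: "j \<in> I" and j': "j' \<in> I"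
  then have mem: "key j \<in> K" "key j' \<in> K" "gam j \<noteq> 0 \<Longrightarrow> gam j \<in> {1..mk (key j)}"
    "gam j' \<noteq> 0 \<Longrightarrow> gam j' \<in> {1..mk (key j')}"
    by (auto simp: I_mem)
  have eq: "j = j' \<longleftrightarrow> key j = key j' \<and> gam j = gam j'"
    by (auto simp: prod_eq_iff)
  show "bas j \<bullet> bas j' = (if j = j' then 1 else 0)"
  proof (cases "gam j = 0")
    case True
    show ?thesis
    proof (cases "gam j' = 0")
      case True
      have "ek (key j) \<bullet> ek (key j') = (if key j = key j' then 1 else 0)"
        using peirce.c_inner_c[OF mem(1,2)] peirce.norm_c[OF mem(1)] mu_pos[OF mem(1)]
        by (auto simp: ek_eq)
      then show ?thesis using \<open>gam j = 0\<close> True by (simp add: bas_def eq)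
    next
      case False
      have "bas j \<bullet> bas j' = (1 / sqrt 2) * (ek (key j) \<bullet> (fk (key j') (gam j') + transpose (fk (key j') (gam j'))))"
        using \<open>gam j = 0\<close> False by (simp add: bas_def)
      then show ?thesis using e_f[OF mem(1,2) mem(4)[OF False]] \<open>gam j = 0\<close> False by (auto simp: eq)
    qed
  next
    case False
    show ?thesis
    proof (cases "gam j' = 0")
      case True
      have "bas j \<bullet> bas j' = (1 / sqrt 2) * (ek (key j') \<bullet> (fk (key j) (gam j) + transpose (fk (key j) (gam j))))"
        using \<open>gam j \<noteq> 0\<close> True by (simp add: bas_def inner_commute)
      then show ?thesis using e_f[OF mem(2,1) mem(3)[OF False]] \<open>gam j \<noteq> 0\<close> True by (auto simp: eq)
    next
      case f': False
      have "bas j \<bullet> bas j' = (1 / 2) * ((fk (key j) (gam j) + transpose (fk (key j) (gam j)))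
          \<bullet> (fk (key j') (gam j') + transpose (fk (key j') (gam j'))))"
        using False f' by (simp add: bas_def)
      then show ?thesis using f_f[OF mem(1) mem(3)[OF False] mem(2) mem(4)[OF f']]
        by (auto simp: eq split: if_splits)
    qed
  qed
qed

lemma span_bas: "span (bas ` I) = Z"
proof (rule span_subspace[OF _ _ subspace_Z])
  show "bas ` I \<subseteq> Z" using bas_Z by blast
  have c_span: "ck k \<in> span (bas ` I)" if k: "k \<in> K" for k
  proof -
    have "idx k 0 \<in> I" using k by (simp add: idx_mem)
    then have "sqrt (\<mu> k) *\<^sub>R bas (idx k 0) \<in> span (bas ` I)"
      by (intro span_scale span_base) blast
    then show ?thesis using mu_pos[OF k] by (simp add: bas_def ek_eq)
  qed
  have H_span: "X + transpose X \<in> span (bas ` I)" if k: "k \<in> K" and X: "X \<in> peirce.H k" for k X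
  proof -
    have "X = (\<Sum>\<gamma>=1..mk k. (X \<bullet> fk k \<gamma>) *\<^sub>R fk k \<gamma>)"
      using fk_basis[OF k] X by (intro orthonormal_family_expand)
        (auto simp: orthonormal_family_def orthonormal_basis_def)
    then have "X + transpose X = (\<Sum>\<gamma>=1..mk k. (X \<bullet> fk k \<gamma>) *\<^sub>R fk k \<gamma>)
        + transpose (\<Sum>\<gamma>=1..mk k. (X \<bullet> fk k \<gamma>) *\<^sub>R fk k \<gamma>)" by simp
    also have "\<dots> = (\<Sum>\<gamma>=1..mk k. (X \<bullet> fk k \<gamma> * sqrt 2) *\<^sub>R bas (idx k \<gamma>))"
      unfolding transpose_sum sum.distrib[symmetric]
      by (intro sum.cong refl) (auto simp: bas_def transpose_scalar scaleR_add_right)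
    also have "\<dots> \<in> span (bas ` I)"
    proof (intro span_sum span_scale span_base imageI)
      fix \<gamma> assume "\<gamma> \<in> {1..mk k}"
      then show "idx k \<gamma> \<in> I" using k by (simp add: idx_mem)
    qed
    finally show ?thesis .
  qed
  show "Z \<subseteq> span (bas ` I)"
  proof
    fix x assume x: "x \<in> Z"
    have "ck k ** x ** ck k + (above ck K rk k ** x ** ck k + transpose (above ck K rk k ** x ** ck k))
        \<in> span (bas ` I)" if k: "k \<in> K" for k
    proof (rule span_add)
      show "ck k ** x ** ck k \<in> span (bas ` I)"
        using peirce.c_primitive[OF x k] c_span[OF k] by (auto simp: span_scale)
      show "above ck K rk k ** x ** ck k + transpose (above ck K rk k ** x ** ck k) \<in> span (bas ` I)"
        by (rule H_span[OF k]) (use x in \<open>auto simp: colspace_def\<close>)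
    qed
    then show "x \<in> span (bas ` I)"
      by (subst peirce.Z_peirce_expansion[OF x]) (rule span_sum)
  qed
qed

definition ucol :: "(nat \<times> nat \<times> nat \<Rightarrow> real) \<Rightarrow> nat \<times> nat \<Rightarrow> 'n sqmat" where
  "ucol u k = col k (u (idx k 0)) (\<lambda>\<gamma>. u (idx k \<gamma>))"

definition low :: "(nat \<times> nat \<times> nat \<Rightarrow> real) \<Rightarrow> nat \<times> nat \<Rightarrow> 'n sqmat" where
  "low u k = (\<Sum>l\<in>{l\<in>K. rk l < rk k}. ucol u l ** transpose (ucol u l))"

definition gram :: "(nat \<times> nat \<times> nat \<Rightarrow> real) \<Rightarrow> 'n sqmat" where
  "gram u = coord_T r d m c f u ** transpose (coord_T r d m c f u)"

lemma coord_T_eq: "coord_T r d m c f u = (\<Sum>k\<in>K. ucol u k)"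
  unfolding coord_T_def hT_eq ucol_def by simp

lemma ucol_column: "k \<in> K \<Longrightarrow> peirce.column k (u (idx k 0) / sqrt (\<mu> k)) (ucol u k)"
  unfolding ucol_def by (rule col_column)

lemma gram_eq: "gram u = (\<Sum>k\<in>K. ucol u k ** transpose (ucol u k))"
  unfolding gram_def coord_T_eq by (rule peirce.tri_gram) (rule ucol_column)

lemma gram_Z: "gram u \<in> Z"
  unfolding gram_def coord_T_eq by (rule peirce.tri_gram_in_Z) (rule ucol_column)

lemma gram_posdef: "u \<in> coord_dom r d \<Longrightarrow> posdef (gram u)"
  unfolding gram_def coord_T_eq
proof (rule peirce.tri_posdef, rule ucol_column)
  fix k assume "u \<in> coord_dom r d" "k \<in> K"
  then show "u (idx k 0) / sqrt (\<mu> k) > 0"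
    using mu_pos[of k] by (auto simp: coord_dom_def K_def)
qed

lemma ucol_cong: "(\<And>\<gamma>. \<gamma> \<le> mk k \<Longrightarrow> u (idx k \<gamma>) = u' (idx k \<gamma>)) \<Longrightarrow> ucol u k = ucol u' k"
  unfolding ucol_def col_def by (auto intro!: arg_cong2[where f = "(+)"] sum.cong)

text \<open>The coordinate of \<open>gram u\<close> along \<open>bas j\<close>, split into the contribution of the column
  \<open>key j\<close> and that of the earlier columns.\<close>
definition xi :: "nat \<times> nat \<times> nat \<Rightarrow> (nat \<times> nat \<times> nat \<Rightarrow> real) \<Rightarrow> real" where
  "xi j u = (if gam j = 0 then (1 / sqrt (\<mu> (key j))) * (u j)\<^sup>2
      else sqrt 2 * u (idx (key j) 0) / sqrt (\<mu> (key j)) * u j) + bas j \<bullet> low u (key j)"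

text \<open>The diagonal entry of the triangular Jacobian, that is, the derivative of
  \<open>xi j\<close> in its own coordinate. The indicator, and \<open>ennreal\<close> for negative
  slopes, make it vanish where the diagonal coordinate is not positive.\<close>

definition wgt :: "nat \<times> nat \<times> nat \<Rightarrow> (nat \<times> nat \<times> nat \<Rightarrow> real) \<Rightarrow> ennreal" where
  "wgt j u = (if gam j = 0 then ennreal (2 * (1 / sqrt (\<mu> (key j))) * u j) * indicator {0<..} (u j)
      else ennreal (sqrt 2 * u (idx (key j) 0) / sqrt (\<mu> (key j))))"

lemma low_sym: "transpose (low u k) = low u k"
  by (simp add: low_def transpose_sum matrix_transpose_mul)

text \<open>Such an \<open>X\<close> pairs with the columns of \<open>ck k\<close> only, so
  \<open>gram_mult_c\<close> applies.\<close>

lemma inner_gram: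
  assumes k: "k \<in> K" and X: "X ** ck k = X"
  shows "X \<bullet> gram u = u (idx k 0) / sqrt (\<mu> k) * (X \<bullet> ucol u k) + X \<bullet> low u k"
proof -
  have mult: "X \<bullet> Y = X \<bullet> (Y ** ck k)" for Y
    by (metis X inner_mult_right peirce.c_sym[OF k])
  have "gram u ** ck k = (u (idx k 0) / sqrt (\<mu> k)) *\<^sub>R ucol u k + low u k ** ck k"
    unfolding gram_eq low_def by (rule peirce.gram_mult_c[OF ucol_column k])
  then show ?thesis
    using mult[of "gram u"] mult[of "low u k"] by (simp add: inner_add_right)
qed

lemma bas_inner_gram:
  assumes j: "j \<in> I"
  shows "bas j \<bullet> gram u = xi j u"
proof -
  have k: "key j \<in> K" using j by (simp add: I_mem)
  have fH: "fk (key j) \<gamma> \<in> peirce.H (key j)" if "\<gamma> \<in> {1..mk (key j)}" for \<gamma>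
    by (rule fk_H[OF k that])
  show ?thesis
  proof (cases "gam j = 0")
    case True
    have j0: "idx (key j) 0 = j" using True by (simp add: prod_eq_iff)
    have "ek (key j) \<bullet> fk (key j) \<gamma> = 0" if "\<gamma> \<in> {1..mk (key j)}" for \<gamma>
      using peirce.c_inner_H[OF k k fH[OF that]] by (simp add: ek_eq)
    then have "ek (key j) \<bullet> ucol u (key j) = u j"
      using peirce.norm_c[OF k] mu_pos[OF k] by (simp add: ucol_def col_def inner_add_right inner_sum_right ek_eq j0[simplified])
    moreover have "ek (key j) ** ck (key j) = ek (key j)"
      using peirce.c_idem[OF k] by (simp add: ek_eq mm.scaleR_left)
    ultimately show ?thesis
      using inner_gram[OF k, of "ek (key j)" u] True j0
      by (simp add: bas_def xi_def power2_eq_square)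
  next
    case False
    then have g: "gam j \<in> {1..mk (key j)}" using j by (auto simp: I_mem)
    let ?f = "fk (key j) (gam j)"
    have "?f \<bullet> (\<Sum>\<gamma>=1..mk (key j). u (idx (key j) \<gamma>) *\<^sub>R fk (key j) \<gamma>) = u (idx (key j) (gam j))"
      unfolding inner_commute[of ?f]
      using fk_inner[OF k] g by (intro orthonormal_family_inner) (auto simp: orthonormal_family_def)
    moreover have "?f \<bullet> ek (key j) = 0"
      using peirce.c_inner_H[OF k k fH[OF g]] by (simp add: ek_eq inner_commute)
    ultimately have "?f \<bullet> ucol u (key j) = u j"
      by (simp add: ucol_def col_def inner_add_right)
    then have *: "?f \<bullet> gram u = u (idx (key j) 0) / sqrt (\<mu> (key j)) * u j + ?f \<bullet> low u (key j)"
      using inner_gram[OF k peirce.H_mult_c(1)[OF k fH[OF g]], of u] by simp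
    \<comment> \<open>On symmetric matrices both halves of \<open>bas j\<close> contribute equally:
      2 / sqrt 2 = sqrt 2. This is the source of the factor sqrt 2 in \<open>xi\<close>.\<close>
    have tr: "bas j \<bullet> Y = sqrt 2 * (?f \<bullet> Y)" if "transpose Y = Y" for Y
    proof -
      have "transpose ?f \<bullet> Y = ?f \<bullet> Y" by (metis inner_transpose that)
      then have "bas j \<bullet> Y = (2 / sqrt 2) * (?f \<bullet> Y)"
        using False by (simp add: bas_def inner_add_left)
      then show ?thesis by (simp add: real_div_sqrt)
    qed
    have "transpose (gram u) = gram u" by (rule symm_Z[OF gram_Z])
    then show ?thesis
      using * False by (simp add: tr low_sym xi_def distrib_left mult.assoc)
  qed
qed

lemma gram_expand: "gram u = (\<Sum>j\<in>I. xi j u *\<^sub>R bas j)"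
proof -
  have "gram u = (\<Sum>j\<in>I. (gram u \<bullet> bas j) *\<^sub>R bas j)"
    using gram_Z span_bas by (intro orthonormal_family_expand orthonormal_bas finite_I) simp
  also have "\<dots> = (\<Sum>j\<in>I. xi j u *\<^sub>R bas j)"
    by (intro sum.cong refl) (simp add: bas_inner_gram inner_commute[of "gram u"])
  finally show ?thesis .
qed

lemma ucol_measurable: "k \<in> K \<Longrightarrow> (\<lambda>u. ucol u k) \<in> borel_measurable (lebPi I)"
  unfolding ucol_def col_def
  by (intro borel_measurable_add borel_measurable_sum borel_measurable_scaleR borel_measurable_const)
    (auto simp: idx_mem[of k, simplified] intro!: measurable_component_singleton)

lemma low_measurable: "(\<lambda>u. low u k) \<in> borel_measurable (lebPi I)"
  unfolding low_def
  by (intro borel_measurable_sum measurable_matrix_mult measurable_transpose ucol_measurable) auto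

lemma gram_measurable: "gram \<in> borel_measurable (lebPi I)"
  unfolding gram_eq[abs_def]
  by (intro borel_measurable_sum measurable_matrix_mult measurable_transpose ucol_measurable) auto

lemma coord_measurable: "j \<in> I \<Longrightarrow> (\<lambda>u. u j) \<in> borel_measurable (lebPi I)"
  by simp

lemma idx0_I: "j \<in> I \<Longrightarrow> idx (key j) 0 \<in> I"
  by (simp add: I_mem)

lemma xi_measurable: "j \<in> I \<Longrightarrow> xi j \<in> borel_measurable (lebPi I)"
  unfolding xi_def[abs_def]
  using coord_measurable[of j] coord_measurable[OF idx0_I, of j] low_measurable[of "key j"]
  by (cases "gam j = 0") (simp_all, measurable)

lemma wgt_measurable: "j \<in> I \<Longrightarrow> wgt j \<in> borel_measurable (lebPi I)"
  unfolding wgt_def[abs_def]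
  using coord_measurable[of j] coord_measurable[OF idx0_I, of j]
  by (cases "gam j = 0") (simp_all, measurable)

lemma low_cong:
  assumes "\<And>i. i \<in> I \<Longrightarrow> rk (key i) < rk k \<Longrightarrow> u i = u' i"
  shows "low u k = low u' k"
  unfolding low_def
proof (intro sum.cong refl)
  fix l assume l: "l \<in> {l\<in>K. rk l < rk k}"
  have "ucol u l = ucol u' l"
  proof (rule ucol_cong)
    fix \<gamma> assume "\<gamma> \<le> mk l"
    then show "u (idx l \<gamma>) = u' (idx l \<gamma>)" using l by (intro assms) (auto simp: I_mem)
  qed
  then show "ucol u l ** transpose (ucol u l) = ucol u' l ** transpose (ucol u' l)" by simp
qed

lemma rk_imp_rkI: "rk (key i) < rk (key j) \<Longrightarrow> rkI i < rkI j"
  by auto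

lemma xi_wgt_dep:
  assumes j: "j \<in> I" and eq: "\<And>i. i \<in> I \<Longrightarrow> rkI i \<le> rkI j \<Longrightarrow> u i = u' i"
  shows "xi j u = xi j u' \<and> wgt j u = wgt j u'"
proof -
  have "low u (key j) = low u' (key j)"
    by (rule low_cong) (use eq rk_imp_rkI in \<open>blast intro: less_imp_le\<close>)
  moreover have "u j = u' j" using j by (intro eq) auto
  moreover have "u (idx (key j) 0) = u' (idx (key j) 0)"
    using idx0_I[OF j] by (intro eq) auto
  ultimately show ?thesis by (simp add: xi_def wgt_def)
qed

lemma nn_integral_gram:
  assumes g: "g \<in> borel_measurable borel" and g0: "\<And>x. \<not> posdef x \<Longrightarrow> g x = 0"
  shows "(\<integral>\<^sup>+x. g x \<partial>subspace_lebesgue Z) = (\<integral>\<^sup>+u. (\<Prod>j\<in>I. wgt j u) * g (gram u) \<partial>lebPi I)"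
proof -
  let ?g = "\<lambda>v. g (\<Sum>j\<in>I. v j *\<^sub>R bas j)"
  have "(\<integral>\<^sup>+x. g x \<partial>subspace_lebesgue Z) = (\<integral>\<^sup>+v. ?g v \<partial>lebPi I)"
    by (rule nn_integral_subspace_lebesgue[OF orthonormal_bas finite_I span_bas g])
  also have "\<dots> = (\<integral>\<^sup>+u. (\<Prod>j\<in>I. wgt j u) * ?g (\<lambda>j\<in>I. xi j u) \<partial>lebPi I)"
  proof (rule nn_integral_triangular_substitution[where rk = rkI])
    show "finite I" by (rule finite_I)
    show "inj_on rkI I" by (auto simp: inj_on_def prod_eq_iff)
    show "xi j u = xi j u' \<and> wgt j u = wgt j u'"
      if "j \<in> I" "\<And>i. i \<in> I \<Longrightarrow> rkI i \<le> rkI j \<Longrightarrow> u i = u' i" for j u u'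
      using that by (rule xi_wgt_dep)
    show "xi j \<in> borel_measurable (lebPi I)" "wgt j \<in> borel_measurable (lebPi I)" if "j \<in> I" for j
      using that by (fact xi_measurable, fact wgt_measurable)
    show "?g \<in> borel_measurable (lebPi I)"
      by (intro measurable_compose[OF _ g] borel_measurable_sum borel_measurable_scaleR) simp_all
  next
    fix j u u' assume j: "j \<in> I" and eq: "\<And>i. i \<in> I \<Longrightarrow> rkI i < rkI j \<Longrightarrow> u i = u' i"
      and W: "wgt j u \<noteq> 0" "wgt j u' \<noteq> 0" and xi: "xi j u = xi j u'"
    have low: "low u (key j) = low u' (key j)"
      by (rule low_cong) (use eq rk_imp_rkI in blast)
    show "u j = u' j"
    proof (cases "gam j = 0")
      case True
      then have "u j > 0" "u' j > 0" using W by (auto simp: wgt_def split: split_indicator_asm)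
      moreover have "(u j)\<^sup>2 = (u' j)\<^sup>2"
        using xi True low mu_pos[of "key j"] j by (simp add: xi_def I_mem)
      ultimately show ?thesis by (simp add: power2_eq_iff_nonneg)
    next
      case False
      have t: "u (idx (key j) 0) = u' (idx (key j) 0)"
        using False idx0_I[OF j] by (intro eq) auto
      have "u (idx (key j) 0) \<noteq> 0" using W False by (auto simp: wgt_def)
      then show ?thesis
        using xi False low t mu_pos[of "key j"] j by (simp add: xi_def I_mem)
    qed
  next
    fix j u and h :: "real \<Rightarrow> ennreal"
    assume j: "j \<in> I" and h: "h \<in> borel_measurable borel"
      and W: "\<And>i. i \<in> I \<Longrightarrow> rkI i < rkI j \<Longrightarrow> wgt i u \<noteq> 0"
      and supp: "\<And>y. h y \<noteq> 0 \<Longrightarrow> \<exists>s. wgt j (u(j := s)) \<noteq> 0 \<and> xi j (u(j := s)) = y"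
    have low: "low (u(j := s)) (key j) = low u (key j)" for s
      by (rule low_cong) auto
    have mu: "\<mu> (key j) > 0" using j mu_pos[of "key j"] by (simp add: I_mem)
    let ?b = "bas j \<bullet> low u (key j)"
    show "(\<integral>\<^sup>+y. h y \<partial>lborel) = (\<integral>\<^sup>+s. wgt j (u(j := s)) * h (xi j (u(j := s))) \<partial>lborel)"
    proof (cases "gam j = 0")
      case True
      have xi: "xi j (u(j := s)) = (1 / sqrt (\<mu> (key j))) * s\<^sup>2 + ?b" for s
        using True by (simp add: xi_def low)
      have wgt: "wgt j (u(j := s)) = ennreal (2 * (1 / sqrt (\<mu> (key j))) * s) * indicator {0<..} s" for s
        using True by (simp add: wgt_def)
      have "h y = 0" if "y \<le> ?b" for y
      proof (rule ccontr)
        assume "h y \<noteq> 0"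
        then obtain s where s: "wgt j (u(j := s)) \<noteq> 0" "xi j (u(j := s)) = y" using supp by blast
        then have "s > 0" by (auto simp: wgt split: split_indicator_asm)
        then have "(1 / sqrt (\<mu> (key j))) * s\<^sup>2 > 0" using mu by simp
        then show False using s(2) that unfolding xi by linarith
      qed
      then show ?thesis
        unfolding xi wgt using mu by (intro nn_integral_square_substitution h) auto
    next
      case False
      let ?c = "sqrt 2 * u (idx (key j) 0) / sqrt (\<mu> (key j))"
      have ne: "idx (key j) 0 \<noteq> j" using False by (auto simp: prod_eq_iff)
      \<comment> \<open>The diagonal coordinate of the column precedes \<open>j\<close>, so its
        weight is nonzero and the slope \<open>?c\<close> is positive.\<close>
      have "wgt (idx (key j) 0) u \<noteq> 0"
        using False by (intro W idx0_I j) auto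
      then have "u (idx (key j) 0) > 0" by (auto simp: wgt_def split: split_indicator_asm)
      then have c: "?c > 0" using mu by simp
      have xi: "xi j (u(j := s)) = ?b + ?c * s" for s
        using False ne by (simp add: xi_def low)
      have wgt: "wgt j (u(j := s)) = ennreal ?c" for s
        using False ne by (simp add: wgt_def)
      have "(\<integral>\<^sup>+y. h y \<partial>lborel) = \<bar>?c\<bar> * (\<integral>\<^sup>+s. h (?b + ?c * s) \<partial>lborel)"
        by (rule nn_integral_real_affine[OF h less_imp_neq[OF c, symmetric]])
      also have "\<dots> = (\<integral>\<^sup>+s. ennreal ?c * h (?b + ?c * s) \<partial>lborel)"
      proof (subst nn_integral_cmult)
        have "(\<lambda>s. ?b + ?c * s) \<in> borel_measurable lborel" by measurable
        then show "(\<lambda>s. h (?b + ?c * s)) \<in> borel_measurable lborel"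
          using h by (rule measurable_compose)
      qed (simp only: abs_of_pos[OF c])
      finally show ?thesis unfolding xi wgt .
    qed
  next
    \<comment> \<open>The support condition is the existence half of the factorization: where
      \<open>g\<close> does not vanish the matrix is positive definite and has a factor, whose
      coefficients form the preimage.\<close>
    fix v :: "nat \<times> nat \<times> nat \<Rightarrow> real" assume "?g v \<noteq> 0"
    then have pd: "posdef (\<Sum>j\<in>I. v j *\<^sub>R bas j)" using g0 by blast
    have xZ: "(\<Sum>j\<in>I. v j *\<^sub>R bas j) \<in> Z"
      by (intro subspace_sum[OF subspace_Z] subspace_scale[OF subspace_Z] bas_Z)
    obtain t \<tau> where t: "\<forall>i\<in>{1..r}. \<forall>\<alpha>\<in>{1..d i}. t i \<alpha> > 0"
      and x: "(\<Sum>j\<in>I. v j *\<^sub>R bas j) = hT r d m c f t \<tau> ** transpose (hT r d m c f t \<tau>)"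
      by (rule hplus_exists[OF xZ pd])
    define u where "u j = (if gam j = 0 then t (fst j) (fst (snd j)) else \<tau> (fst j) (fst (snd j)) (gam j))" for j
    have "coord_T r d m c f u = hT r d m c f t \<tau>"
      unfolding coord_T_def hT_def by (intro sum.cong refl arg_cong2[where f = "(+)"]) (auto simp: u_def)
    then have gu: "gram u = (\<Sum>j\<in>I. v j *\<^sub>R bas j)" by (simp add: gram_def x)
    show "\<exists>u. \<forall>j\<in>I. wgt j u \<noteq> 0 \<and> xi j u = v j"
    proof (intro exI[of _ u] ballI conjI)
      fix j assume j: "j \<in> I"
      show "xi j u = v j"
        using bas_inner_gram[OF j, of u] orthonormal_family_inner[OF orthonormal_bas finite_I j, of v]
        by (simp add: gu inner_commute)
      have "u (idx (key j) 0) > 0" using t j by (auto simp: u_def I_mem K_def)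
      moreover have "gam j = 0 \<Longrightarrow> u j = u (idx (key j) 0)" by (simp add: u_def)
      ultimately show "wgt j u \<noteq> 0"
        using mu_pos[of "key j"] j by (auto simp: wgt_def I_mem)
    qed
  qed
  also have "\<dots> = (\<integral>\<^sup>+u. (\<Prod>j\<in>I. wgt j u) * g (gram u) \<partial>lebPi I)"
    by (simp add: gram_expand)
  finally show ?thesis .
qed

text \<open>In each column the weight with \<gamma> = 0 occurs once and the common weight of the
  coordinates \<tau> occurs m times. Outside the domain some diagonal weight is already 0.\<close>

lemma prod_wgt: "(\<Prod>j\<in>I. wgt j u) = ennreal (coord_density r d m c u) * indicator (coord_dom r d) u"
proof (cases "u \<in> coord_dom r d")
  case True
  have "(\<Prod>j\<in>I. wgt j u) = (\<Prod>i=1..r. \<Prod>\<alpha>=1..d i. \<Prod>\<gamma>=0..m i \<alpha>. wgt (i, \<alpha>, \<gamma>) u)"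
    unfolding I_Sigma by (simp add: prod.Sigma split_def)
  also have "\<dots> = (\<Prod>i=1..r. \<Prod>\<alpha>=1..d i. ennreal (2 powr (1 + real (m i \<alpha>) / 2)
      * real (mu c i \<alpha>) powr (- (1 + real (m i \<alpha>)) / 2) * u (i, \<alpha>, 0) ^ (1 + m i \<alpha>)))"
  proof (intro prod.cong refl)
    fix i \<alpha> assume "i \<in> {1..r}" "\<alpha> \<in> {1..d i}"
    then have t: "u (i, \<alpha>, 0) > 0" and mu: "real (mu c i \<alpha>) > 0"
      using True mu_pos[of "(i, \<alpha>)"] by (auto simp: coord_dom_def K_def mu_def)
    have "(\<Prod>\<gamma>=0..m i \<alpha>. wgt (i, \<alpha>, \<gamma>) u) = wgt (i, \<alpha>, 0) u * (\<Prod>\<gamma>=1..m i \<alpha>. wgt (i, \<alpha>, \<gamma>) u)"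
      by (subst prod.atLeast_Suc_atMost) auto
    also have "(\<Prod>\<gamma>=1..m i \<alpha>. wgt (i, \<alpha>, \<gamma>) u)
        = (\<Prod>\<gamma>=1..m i \<alpha>. ennreal (sqrt 2 * u (i, \<alpha>, 0) / sqrt (real (mu c i \<alpha>))))"
      by (intro prod.cong refl) (auto simp: wgt_def mu_def)
    also have "\<dots> = ennreal ((sqrt 2 * u (i, \<alpha>, 0) / sqrt (real (mu c i \<alpha>))) ^ m i \<alpha>)"
      using t by (simp add: ennreal_power)
    also have "wgt (i, \<alpha>, 0) u = ennreal (2 * (1 / sqrt (real (mu c i \<alpha>))) * u (i, \<alpha>, 0))"
      using t by (simp add: wgt_def mu_def)
    also have "ennreal (2 * (1 / sqrt (real (mu c i \<alpha>))) * u (i, \<alpha>, 0))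
        * ennreal ((sqrt 2 * u (i, \<alpha>, 0) / sqrt (real (mu c i \<alpha>))) ^ m i \<alpha>)
      = ennreal (2 * (1 / sqrt (real (mu c i \<alpha>))) * u (i, \<alpha>, 0)
        * (sqrt 2 * u (i, \<alpha>, 0) / sqrt (real (mu c i \<alpha>))) ^ m i \<alpha>)"
      using t by (intro ennreal_mult[symmetric]) auto
    finally show "(\<Prod>\<gamma>=0..m i \<alpha>. wgt (i, \<alpha>, \<gamma>) u) = ennreal (2 powr (1 + real (m i \<alpha>) / 2)
      * real (mu c i \<alpha>) powr (- (1 + real (m i \<alpha>)) / 2) * u (i, \<alpha>, 0) ^ (1 + m i \<alpha>))"
      unfolding jacobian_factor[OF t mu] .
  qed
  also have "\<dots> = ennreal (coord_density r d m c u)"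
  proof -
    have nn: "0 \<le> 2 powr (1 + real (m i \<alpha>) / 2)
      * real (mu c i \<alpha>) powr (- (1 + real (m i \<alpha>)) / 2) * u (i, \<alpha>, 0) ^ (1 + m i \<alpha>)"
      if "i \<in> {1..r}" "\<alpha> \<in> {1..d i}" for i \<alpha>
    proof -
      have "u (i, \<alpha>, 0) > 0" using True that by (auto simp: coord_dom_def)
      then show ?thesis by simp
    qed
    show ?thesis
      unfolding coord_density_def using nn
      by (subst prod_ennreal[symmetric], blast intro: prod_nonneg)
        (intro prod.cong refl prod_ennreal, blast)
  qed
  finally show ?thesis using True by simp
next
  case False
  then obtain i \<alpha> where i: "i \<in> {1..r}" "\<alpha> \<in> {1..d i}" "\<not> u (i, \<alpha>, 0) > 0"
    by (auto simp: coord_dom_def)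
  then have "(i, \<alpha>, 0) \<in> I" "wgt (i, \<alpha>, 0) u = 0"
    by (auto simp: coord_idx_def wgt_def)
  then have "(\<Prod>j\<in>I. wgt j u) = 0" using finite_I by (meson prod_zero)
  then show ?thesis using False by simp
qed

lemma lebesgue_coordinates:
  "density (subspace_lebesgue Z) (indicator {x \<in> Z. posdef x})
    = distr (density (lebPi I) (\<lambda>u. ennreal (coord_density r d m c u) * indicator (coord_dom r d) u))
        borel gram"
  (is "?L = distr (density _ ?\<rho>) borel gram")
proof (rule measure_eqI)
  have sets_L: "sets (subspace_lebesgue Z) = sets borel"
    by (simp add: subspace_lebesgue_def Let_def)
  then show "sets ?L = sets (distr (density (lebPi I) ?\<rho>) borel gram)" by simp
  have P: "{x \<in> Z. posdef x} \<in> sets borel"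
  proof -
    have "{x \<in> Z. posdef x} = Z \<inter> {x. posdef x}" by auto
    also have "\<dots> \<in> sets borel"
      by (intro sets.Int borel_closed closed_subspace subspace_Z posdef_borel)
    finally show ?thesis .
  qed
  have rho: "?\<rho> \<in> borel_measurable (lebPi I)"
    unfolding prod_wgt[symmetric] by (intro borel_measurable_prod_ennreal wgt_measurable)
  fix A assume "A \<in> sets ?L"
  then have A: "A \<in> sets borel" by (simp add: sets_L)
  let ?g = "\<lambda>x. indicator {x \<in> Z. posdef x} x * indicator A x :: ennreal"
  have g: "?g \<in> borel_measurable borel" using P A by measurable
  have "emeasure ?L A = (\<integral>\<^sup>+x. ?g x \<partial>subspace_lebesgue Z)"
    using P A by (subst emeasure_density) (auto simp: sets_L measurable_cong_sets[OF sets_L refl])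
  also have "\<dots> = (\<integral>\<^sup>+u. (\<Prod>j\<in>I. wgt j u) * ?g (gram u) \<partial>lebPi I)"
    by (rule nn_integral_gram[OF g]) simp
  also have "\<dots> = (\<integral>\<^sup>+u. ?\<rho> u * indicator (gram -` A \<inter> space (lebPi I)) u \<partial>lebPi I)"
    unfolding prod_wgt
  proof (rule nn_integral_cong)
    fix u assume "u \<in> space (lebPi I)"
    then show "?\<rho> u * ?g (gram u) = ?\<rho> u * indicator (gram -` A \<inter> space (lebPi I)) u"
      using gram_posdef[of u] gram_Z[of u] by (auto split: split_indicator)
  qed
  also have "\<dots> = emeasure (density (lebPi I) ?\<rho>) (gram -` A \<inter> space (lebPi I))"
    using rho measurable_sets[OF gram_measurable A] by (simp add: emeasure_density)
  also have "\<dots> = emeasure (distr (density (lebPi I) ?\<rho>) borel gram) A"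
    using gram_measurable A by (simp add: emeasure_distr)
  finally show "emeasure ?L A = emeasure (distr (density (lebPi I) ?\<rho>) borel gram) A" .
qed

end

theorem theorem4p13:
  fixes blk :: "'n::{finite,linorder} \<Rightarrow> nat" and r :: nat
    and Z :: "'n sqmat set"
    and d :: "nat \<Rightarrow> nat" and c :: "nat \<Rightarrow> nat \<Rightarrow> 'n sqmat"
    and m :: "nat \<Rightarrow> nat \<Rightarrow> nat" and f :: "nat \<Rightarrow> nat \<Rightarrow> nat \<Rightarrow> 'n sqmat"
  assumes part: "ordered_partition blk r"
    and subZ: "subspace Z" and symZ: "\<forall>x\<in>Z. symm x"
    and Z0: "condZ0 blk r Z" and Z1: "condZ1 blk Z"
    and frames: "\<forall>i\<in>{1..r}. jordan_frame blk Z i (d i) (c i)"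
    and bases: "\<forall>i\<in>{1..r}. \<forall>\<alpha>\<in>{1..d i}.
                  orthonormal_basis (hsp blk Z i (d i) (c i) \<alpha>) (m i \<alpha>) (f i \<alpha>)"
  shows "(\<forall>x\<in>Z. posdef x \<longrightarrow>
            (\<exists>!T. T \<in> hplus r d m c f \<and> x = T ** transpose T) \<and>
            (\<forall>t \<tau>. (\<forall>i\<in>{1..r}. \<forall>\<alpha>\<in>{1..d i}. t i \<alpha> > 0) \<and>
                    x = hT r d m c f t \<tau> ** transpose (hT r d m c f t \<tau>) \<longrightarrow>
               det x = (\<Prod>i=1..r. \<Prod>\<alpha>=1..d i. (t i \<alpha> ^ 2 / real (mu c i \<alpha>)) ^ mu c i \<alpha>) \<and>
               (\<forall>A. symm A \<longrightarrow>
                  trace (x ** A) = (\<Sum>i=1..r. \<Sum>\<alpha>=1..d i. phi_quad m c f i \<alpha> A (t i \<alpha>) (\<tau> i \<alpha>)))))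
         \<and> density (subspace_lebesgue Z) (indicator {x \<in> Z. posdef x})
           = distr (density (PiM (coord_idx r d m) (\<lambda>_. lborel))
                      (\<lambda>u. ennreal (coord_density r d m c u) * indicator (coord_dom r d) u))
                   borel (\<lambda>u. coord_T r d m c f u ** transpose (coord_T r d m c f u))"
proof -
  interpret framed_block_space_basis blk r Z d c m f
    using assms by unfold_locales (auto simp: symm_def)
  have "\<exists>!T. T \<in> hplus r d m c f \<and> x = T ** transpose T" if x: "x \<in> Z" "posdef x" for x
  proof -
    obtain t \<tau> where t: "\<forall>i\<in>{1..r}. \<forall>\<alpha>\<in>{1..d i}. t i \<alpha> > 0"
      "x = hT r d m c f t \<tau> ** transpose (hT r d m c f t \<tau>)"
      by (rule hplus_exists[OF x])
    show ?thesis
    proof (rule ex1I[of _ "hT r d m c f t \<tau>"])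
      show "hT r d m c f t \<tau> \<in> hplus r d m c f \<and> x = hT r d m c f t \<tau> ** transpose (hT r d m c f t \<tau>)"
        using t unfolding hplus_def by blast
      fix T assume T: "T \<in> hplus r d m c f \<and> x = T ** transpose T"
      then obtain t' \<tau>' where t': "T = hT r d m c f t' \<tau>'" "\<forall>i\<in>{1..r}. \<forall>\<alpha>\<in>{1..d i}. t' i \<alpha> > 0"
        unfolding hplus_def by blast
      show "T = hT r d m c f t \<tau>"
        unfolding t'(1) by (rule hplus_unique[OF t'(2) t(1)]) (use T t t' in simp)
    qed
  qed
  then show ?thesis
    using lebesgue_coordinates by (auto simp: gram_def[abs_def] det_gram_hT trace_gram_hT)
qed

end
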